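(* Every Dirichlet form decomposes into the sum of a recurrent, a dissipative and a transient-conservative Dirichlet form. That is: let $\mathcal{E}$ be a Dirichlet form in $L^2(X,m)$ with domain $\mathcal{D}$. Then there are pairwise disjoint (up to $m$-null sets) $\mathcal{E}$-invariant sets $Y_1,Y_2,Y_3$ with $X=Y_1\cup Y_2\cup Y_3$ such that $\mathcal{E}^{Y_1}$ is recurrent in $L^2(Y_1,m|_{Y_1})$, $\mathcal{E}^{Y_2}$ is dissipative in $L^2(Y_2,m|_{Y_2})$, $\mathcal{E}^{Y_3}$ is both transient and conservative in $L^2(Y_3,m|_{Y_3})$, and $$\mathcal{E}[u]=\mathcal{E}^{Y_1}[1_{Y_1}u]+\mathcal{E}^{Y_2}[1_{Y_2}u]+\mathcal{E}^{Y_3}[1_{Y_3}u]\qquad\text{for all }u\in\mathcal{D}.$$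
   Context: $X$ is a Hausdorff topological space and $m$ is a positive $\sigma$-finite Radon measure on a $\sigma$-algebra $\mathcal{A}$ of subsets of $X$, with full support $X$; $L^p=L^p(X,m)$. All equalities and inequalities of functions and sets are understood $m$-a.e. A Dirichlet form $\mathcal{E}$ with domain $\mathcal{D}\subset L^2$ is a (symmetric, nonnegative) densely defined closed quadratic form such that $u\in\mathcal{D}$ implies $u_{0,1}:=\min(\max(u,0),1)\in\mathcal{D}$ and $\mathcal{E}[u_{0,1}]\le\mathcal{E}[u]$. Let $(T_t)_{t>0}$ be the strongly continuous Markovian semigroup of selfadjoint operators on $L^2$ associated with $\mathcal{E}$, i.e. $T_t=e^{-tL}$ with $L$ the nonnegative selfadjoint operator of $\mathcal{E}$. It extends to $L^\infty$: choose $\varphi_k\in L^1\cap L^\infty$ with $0<\varphi_k\le1$, $\varphi_k\uparrow1$; for $0\le u\in L^\infty$ put $T_tu=\lim_kT_t(u\varphi_k)$, and $T_tu=T_tu^+-T_tu^-$ in general. A measurable set $Y\subset X$ is ($\mathcal{E}$-)invariant if $T_t(1_Yu)=1_YT_tu$ for all $u\in L^2$ and some (equivalently every) $t>0$. For invariant $Y$, $1_Yu\in\mathcal{D}$ for all $u\in\mathcal{D}$, and $\mathcal{E}^Y$ denotes the form with domain $\{1_Yu:u\in\mathcal{D}\}$ and $\mathcal{E}^Y[1_Yu]=\mathcal{E}[1_Yu]$; identifying $L^2(Y,m|_Y)$ with $\{u\in L^2:u=0\text{ on }X\setminus Y\}$, it is a Dirichlet form in $L^2(Y,m|_Y)$.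 For $f\in L^2\cap L^1$ put $S_tf=\int_0^tT_sf\,ds$; $S_t$ extends to a bounded positive operator on $L^1$. For $f\in L^1_+$ (nonnegative functions in $L^1$) put $Kf:=\lim_{n\to\infty}S_nf\in[0,\infty]$. The form $\mathcal{E}$ is transient if $Kg<\infty$ for some strictly positive $g\in L^1_+$; recurrent if for every $f\in L^1_+$, $Kf(x)\in\{0,\infty\}$ for $m$-a.e. $x$; conservative if $T_t1=1$ for some (equivalently every) $t>0$; dissipative if for $m$-a.e. $x\in X$ there is an integer $k\ge1$ with $T_k1(x)<1$. The same definitions are used for Dirichlet forms in $L^2(Y,m|_Y)$, with $1$ replaced by $1_Y$. Some of the three sets may be $m$-null; on a null set all four properties hold vacuously. *)

theory Defs
  imports "HOL-Analysis.Analysis"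
begin

section \<open>The underlying measure space\<close>

text \<open>The \<open>\<sigma>\<close>-algebra may be strictly larger than the Borel \<open>\<sigma>\<close>-algebra.\<close>

definition radon_measure :: "'a::t2_space measure \<Rightarrow> bool" where
  "radon_measure M \<longleftrightarrow>
     space M = UNIV \<and> sets borel \<subseteq> sets M \<and>
     (\<forall>x. \<exists>U. open U \<and> x \<in> U \<and> emeasure M U < \<infinity>) \<and>
     (\<forall>A\<in>sets M. emeasure M A = (SUP K\<in>{K. compact K \<and> K \<subseteq> A}. emeasure M K))"

definition full_support :: "'a::topological_space measure \<Rightarrow> bool" where
  "full_support M \<longleftrightarrow> (\<forall>U. open U \<and> U \<noteq> {} \<longrightarrow> 0 < emeasure M U)"


section \<open>Real \<open>L\<^sup>p\<close> spaces, as sets of representatives\<close>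

text \<open>
  Elements of \<open>L\<^sup>1\<close>, \<open>L\<^sup>2\<close>, \<open>L\<^sup>\<infinity>\<close> are represented by functions; operators act on representatives and
  are only determined almost everywhere. All notions below are for an arbitrary measure \<open>M\<close>, so that
  they apply to \<open>restrict_space M Y\<close> as well; functions on \<open>Y\<close> are then functions on the whole type
  whose values outside \<open>Y\<close> are irrelevant.
\<close>

definition L1 :: "'a measure \<Rightarrow> ('a \<Rightarrow> real) set" where
  "L1 M = {f. integrable M f}"

definition L1_pos :: "'a measure \<Rightarrow> ('a \<Rightarrow> real) set" where
  "L1_pos M = {f \<in> L1 M. AE x in M. 0 \<le> f x}"

definition L2 :: "'a measure \<Rightarrow> ('a \<Rightarrow> real) set" where
  "L2 M = {f \<in> borel_measurable M. integrable M (\<lambda>x. (f x)\<^sup>2)}"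

definition inner2 :: "'a measure \<Rightarrow> ('a \<Rightarrow> real) \<Rightarrow> ('a \<Rightarrow> real) \<Rightarrow> real" where
  "inner2 M f g = (\<integral>x. f x * g x \<partial>M)"

definition norm2 :: "'a measure \<Rightarrow> ('a \<Rightarrow> real) \<Rightarrow> real" where
  "norm2 M f = sqrt (inner2 M f f)"

definition dist1 :: "'a measure \<Rightarrow> ('a \<Rightarrow> real) \<Rightarrow> ('a \<Rightarrow> real) \<Rightarrow> ennreal" where
  "dist1 M f g = (\<integral>\<^sup>+x. ennreal \<bar>f x - g x\<bar> \<partial>M)"


section \<open>Dirichlet forms\<close>

text \<open>
  The form is given by its symmetric bilinear (polarized) version \<open>E u v\<close> on \<open>D \<times> D\<close>;
  the quadratic form is \<open>E u u\<close>.
\<close>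

locale dirichlet_form =
  fixes M :: "'a measure" and D :: "('a \<Rightarrow> real) set"
    and E :: "('a \<Rightarrow> real) \<Rightarrow> ('a \<Rightarrow> real) \<Rightarrow> real"
  assumes dom_L2: "D \<subseteq> L2 M"
    and dom_AE: "\<lbrakk>u \<in> D; v \<in> borel_measurable M; AE x in M. u x = v x\<rbrakk> \<Longrightarrow> v \<in> D"
    and dom_add: "\<lbrakk>u \<in> D; v \<in> D\<rbrakk> \<Longrightarrow> (\<lambda>x. u x + v x) \<in> D"
    and dom_scale: "u \<in> D \<Longrightarrow> (\<lambda>x. c * u x) \<in> D"
    and dom_dense: "\<lbrakk>f \<in> L2 M; 0 < \<epsilon>\<rbrakk> \<Longrightarrow> \<exists>u\<in>D. norm2 M (\<lambda>x. f x - u x) < \<epsilon>"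
    and form_AE: "\<lbrakk>u \<in> D; u' \<in> D; w \<in> D; AE x in M. u x = u' x\<rbrakk> \<Longrightarrow> E u w = E u' w"
    and form_add: "\<lbrakk>u \<in> D; v \<in> D; w \<in> D\<rbrakk> \<Longrightarrow> E (\<lambda>x. u x + v x) w = E u w + E v w"
    and form_scale: "\<lbrakk>u \<in> D; w \<in> D\<rbrakk> \<Longrightarrow> E (\<lambda>x. c * u x) w = c * E u w"
    and form_sym: "\<lbrakk>u \<in> D; v \<in> D\<rbrakk> \<Longrightarrow> E u v = E v u"
    and form_nonneg: "u \<in> D \<Longrightarrow> 0 \<le> E u u"
    and form_closed:
      "\<lbrakk>\<And>n. U n \<in> D; u \<in> L2 M;
        (\<lambda>n. norm2 M (\<lambda>x. U n x - u x)) \<longlonglongrightarrow> 0;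
        \<And>\<epsilon>. 0 < \<epsilon> \<Longrightarrow> \<exists>N. \<forall>m\<ge>N. \<forall>n\<ge>N. E (\<lambda>x. U m x - U n x) (\<lambda>x. U m x - U n x) < \<epsilon>\<rbrakk>
       \<Longrightarrow> u \<in> D \<and> (\<lambda>n. E (\<lambda>x. U n x - u x) (\<lambda>x. U n x - u x)) \<longlonglongrightarrow> 0"
    and form_markov:
      "u \<in> D \<Longrightarrow> (\<lambda>x. min (max (u x) 0) 1) \<in> D \<and>
        E (\<lambda>x. min (max (u x) 0) 1) (\<lambda>x. min (max (u x) 0) 1) \<le> E u u"

text \<open>\<open>form_operator M D E u f\<close> means that \<open>u \<in> dom L\<close> and \<open>L u = f\<close>, where \<open>L\<close> is the nonnegative
  selfadjoint operator of the form.\<close>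

definition form_operator ::
  "'a measure \<Rightarrow> ('a \<Rightarrow> real) set \<Rightarrow> (('a \<Rightarrow> real) \<Rightarrow> ('a \<Rightarrow> real) \<Rightarrow> real)
     \<Rightarrow> ('a \<Rightarrow> real) \<Rightarrow> ('a \<Rightarrow> real) \<Rightarrow> bool" where
  "form_operator M D E u f \<longleftrightarrow> u \<in> D \<and> f \<in> L2 M \<and> (\<forall>v\<in>D. E u v = inner2 M f v)"

text \<open>\<open>T\<close> is the semigroup \<open>exp (- t L)\<close>, \<open>t > 0\<close>: the strongly continuous semigroup of bounded
  selfadjoint operators on \<open>L\<^sup>2\<close> whose generator is \<open>- L\<close>.\<close>

definition is_form_semigroup ::
  "'a measure \<Rightarrow> ('a \<Rightarrow> real) set \<Rightarrow> (('a \<Rightarrow> real) \<Rightarrow> ('a \<Rightarrow> real) \<Rightarrow> real)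
     \<Rightarrow> (real \<Rightarrow> ('a \<Rightarrow> real) \<Rightarrow> ('a \<Rightarrow> real)) \<Rightarrow> bool" where
  "is_form_semigroup M D E T \<longleftrightarrow>
     (\<forall>t>0. \<forall>f\<in>L2 M. T t f \<in> L2 M) \<and>
     (\<forall>t>0. \<forall>f\<in>L2 M. \<forall>g\<in>L2 M. AE x in M. T t (\<lambda>y. f y + g y) x = T t f x + T t g x) \<and>
     (\<forall>t>0. \<forall>f\<in>L2 M. \<forall>c. AE x in M. T t (\<lambda>y. c * f y) x = c * T t f x) \<and>
     (\<forall>t>0. \<exists>C. \<forall>f\<in>L2 M. norm2 M (T t f) \<le> C * norm2 M f) \<and>
     (\<forall>t>0. \<forall>f\<in>L2 M. \<forall>g\<in>L2 M. inner2 M (T t f) g = inner2 M f (T t g)) \<and>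
     (\<forall>s>0. \<forall>t>0. \<forall>f\<in>L2 M. AE x in M. T (s + t) f x = T s (T t f) x) \<and>
     (\<forall>f\<in>L2 M. ((\<lambda>t. norm2 M (\<lambda>x. T t f x - f x)) \<longlongrightarrow> 0) (at_right 0)) \<and>
     (\<forall>f\<in>L2 M. \<forall>g\<in>L2 M. form_operator M D E f g \<longleftrightarrow>
        ((\<lambda>t. norm2 M (\<lambda>x. (f x - T t f x) / t - g x)) \<longlongrightarrow> 0) (at_right 0))"

definition form_semigroup ::
  "'a measure \<Rightarrow> ('a \<Rightarrow> real) set \<Rightarrow> (('a \<Rightarrow> real) \<Rightarrow> ('a \<Rightarrow> real) \<Rightarrow> real)
     \<Rightarrow> real \<Rightarrow> ('a \<Rightarrow> real) \<Rightarrow> ('a \<Rightarrow> real)" where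
  "form_semigroup M D E = (SOME T. is_form_semigroup M D E T)"


section \<open>Extension of the semigroup to \<open>L\<^sup>\<infinity>\<close>\<close>

definition is_cutoff :: "'a measure \<Rightarrow> (nat \<Rightarrow> 'a \<Rightarrow> real) \<Rightarrow> bool" where
  "is_cutoff M \<phi> \<longleftrightarrow>
     (\<forall>k. \<phi> k \<in> L1 M) \<and>
     (AE x in M. (\<forall>k. 0 < \<phi> k x \<and> \<phi> k x \<le> 1) \<and> incseq (\<lambda>k. \<phi> k x) \<and> (\<lambda>k. \<phi> k x) \<longlonglongrightarrow> 1)"

definition cutoff :: "'a measure \<Rightarrow> nat \<Rightarrow> 'a \<Rightarrow> real" where
  "cutoff M = (SOME \<phi>. is_cutoff M \<phi>)"

definition semigroup_Linf_pos ::
  "'a measure \<Rightarrow> ('a \<Rightarrow> real) set \<Rightarrow> (('a \<Rightarrow> real) \<Rightarrow> ('a \<Rightarrow> real) \<Rightarrow> real)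
     \<Rightarrow> real \<Rightarrow> ('a \<Rightarrow> real) \<Rightarrow> ('a \<Rightarrow> real)" where
  "semigroup_Linf_pos M D E t u x = lim (\<lambda>k. form_semigroup M D E t (\<lambda>y. u y * cutoff M k y) x)"

definition semigroup_Linf ::
  "'a measure \<Rightarrow> ('a \<Rightarrow> real) set \<Rightarrow> (('a \<Rightarrow> real) \<Rightarrow> ('a \<Rightarrow> real) \<Rightarrow> real)
     \<Rightarrow> real \<Rightarrow> ('a \<Rightarrow> real) \<Rightarrow> ('a \<Rightarrow> real)" where
  "semigroup_Linf M D E t u x =
     semigroup_Linf_pos M D E t (\<lambda>y. max (u y) 0) x -
     semigroup_Linf_pos M D E t (\<lambda>y. max (- u y) 0) x"


section \<open>The operators \<open>S\<^sub>t\<close> and \<open>K\<close>\<close>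

text \<open>The \<open>L\<^sup>2\<close>-valued integral of \<open>s \<mapsto> T\<^sub>s f\<close> over \<open>(0, t]\<close>. As there is no type of elements of
  \<open>L\<^sup>2 M\<close>, it is expressed by duality (the integrand is norm continuous and bounded, so the Bochner
  and the weak integral agree).\<close>

definition S2 ::
  "'a measure \<Rightarrow> ('a \<Rightarrow> real) set \<Rightarrow> (('a \<Rightarrow> real) \<Rightarrow> ('a \<Rightarrow> real) \<Rightarrow> real)
     \<Rightarrow> real \<Rightarrow> ('a \<Rightarrow> real) \<Rightarrow> ('a \<Rightarrow> real)" where
  "S2 M D E t f = (SOME g. g \<in> L2 M \<and>
     (\<forall>h\<in>L2 M. inner2 M g h = (LINT s:{0<..t}|lborel. inner2 M (form_semigroup M D E s f) h)))"

text \<open>The continuous extension of \<open>S2\<close> from \<open>L\<^sup>1 \<inter> L\<^sup>2\<close> to \<open>L\<^sup>1\<close>.\<close>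

definition S1 ::
  "'a measure \<Rightarrow> ('a \<Rightarrow> real) set \<Rightarrow> (('a \<Rightarrow> real) \<Rightarrow> ('a \<Rightarrow> real) \<Rightarrow> real)
     \<Rightarrow> real \<Rightarrow> ('a \<Rightarrow> real) \<Rightarrow> ('a \<Rightarrow> real)" where
  "S1 M D E t f = (SOME g. g \<in> L1 M \<and>
     (\<forall>F. (\<forall>n. F n \<in> L1 M \<inter> L2 M) \<longrightarrow> (\<lambda>n. dist1 M (F n) f) \<longlonglongrightarrow> 0 \<longrightarrow>
        (\<lambda>n. dist1 M (S2 M D E t (F n)) g) \<longlonglongrightarrow> 0))"

text \<open>For \<open>f\<close> in \<open>L1_pos M\<close> the sequence is almost everywhere nonnegative and increasing, so neither
  the truncation by \<open>ennreal\<close> nor the existence of the limit matters outside a null set.\<close>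

definition K ::
  "'a measure \<Rightarrow> ('a \<Rightarrow> real) set \<Rightarrow> (('a \<Rightarrow> real) \<Rightarrow> ('a \<Rightarrow> real) \<Rightarrow> real)
     \<Rightarrow> ('a \<Rightarrow> real) \<Rightarrow> 'a \<Rightarrow> ennreal" where
  "K M D E f x = lim (\<lambda>n::nat. ennreal (S1 M D E (real n) f x))"


section \<open>Global properties\<close>

definition transient ::
  "'a measure \<Rightarrow> ('a \<Rightarrow> real) set \<Rightarrow> (('a \<Rightarrow> real) \<Rightarrow> ('a \<Rightarrow> real) \<Rightarrow> real) \<Rightarrow> bool" where
  "transient M D E \<longleftrightarrow>
     (\<exists>g\<in>L1_pos M. (AE x in M. 0 < g x) \<and> (AE x in M. K M D E g x < \<infinity>))"

definition recurrent ::
  "'a measure \<Rightarrow> ('a \<Rightarrow> real) set \<Rightarrow> (('a \<Rightarrow> real) \<Rightarrow> ('a \<Rightarrow> real) \<Rightarrow> real) \<Rightarrow> bool" where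
  "recurrent M D E \<longleftrightarrow> (\<forall>f\<in>L1_pos M. AE x in M. K M D E f x \<in> {0, \<infinity>})"

definition conservative ::
  "'a measure \<Rightarrow> ('a \<Rightarrow> real) set \<Rightarrow> (('a \<Rightarrow> real) \<Rightarrow> ('a \<Rightarrow> real) \<Rightarrow> real) \<Rightarrow> bool" where
  "conservative M D E \<longleftrightarrow> (\<forall>t>0. AE x in M. semigroup_Linf M D E t (\<lambda>_. 1) x = 1)"

definition dissipative ::
  "'a measure \<Rightarrow> ('a \<Rightarrow> real) set \<Rightarrow> (('a \<Rightarrow> real) \<Rightarrow> ('a \<Rightarrow> real) \<Rightarrow> real) \<Rightarrow> bool" where
  "dissipative M D E \<longleftrightarrow>
     (AE x in M. \<exists>k::nat. 1 \<le> k \<and> semigroup_Linf M D E (real k) (\<lambda>_. 1) x < 1)"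


section \<open>Invariant sets and parts of forms\<close>

definition invariant_set ::
  "'a measure \<Rightarrow> ('a \<Rightarrow> real) set \<Rightarrow> (('a \<Rightarrow> real) \<Rightarrow> ('a \<Rightarrow> real) \<Rightarrow> real) \<Rightarrow> 'a set \<Rightarrow> bool" where
  "invariant_set M D E Y \<longleftrightarrow> Y \<in> sets M \<and>
     (\<forall>t>0. \<forall>u\<in>L2 M. AE x in M.
        form_semigroup M D E t (\<lambda>y. indicator Y y * u y) x = indicator Y x * form_semigroup M D E t u x)"

text \<open>Domain and form of the part of \<open>(D, E)\<close> on \<open>Y\<close>, regarded as a form in
  \<open>L2 (restrict_space M Y)\<close>.\<close>

definition part_dom :: "'a measure \<Rightarrow> ('a \<Rightarrow> real) set \<Rightarrow> 'a set \<Rightarrow> ('a \<Rightarrow> real) set" where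
  "part_dom M D Y = {v \<in> borel_measurable (restrict_space M Y).
     \<exists>u\<in>D. AE x in restrict_space M Y. v x = indicator Y x * u x}"

definition part_form ::
  "(('a \<Rightarrow> real) \<Rightarrow> ('a \<Rightarrow> real) \<Rightarrow> real) \<Rightarrow> 'a set \<Rightarrow> ('a \<Rightarrow> real) \<Rightarrow> ('a \<Rightarrow> real) \<Rightarrow> real" where
  "part_form E Y u v = E (\<lambda>x. indicator Y x * u x) (\<lambda>x. indicator Y x * v x)"

end

theory Submission
  imports Defs "HOL-Library.Function_Algebras"
begin

text \<open>
  The decomposition is read off from two excessive functions. Write \<open>T\<^sub>t\<close> for the semigroup, \<open>P t\<close> for its extension to
  nonnegative functions and \<open>potential u\<close> for the integral of \<open>P t u\<close> over all times. Take a strictly positive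
  integrable function \<open>g\<close>. Then \<open>potential g\<close> is excessive, that is \<open>P t (potential g) \<le> potential g\<close>, and so is the
  defect \<open>e = sup\<^sub>n (1 - P n 1)\<close>. If \<open>u\<close> is excessive, then \<open>u\<close> dominates \<open>\<infinity> * indicator {u = \<infinity>}\<close>, so
  \<open>P t (indicator {u = \<infinity>})\<close> must vanish where \<open>u\<close> is finite; by symmetry of \<open>P t\<close> the set \<open>{u = \<infinity>}\<close> is invariant
  (\<open>infinity_set_invariant\<close>). This applies to \<open>R = {potential g = \<infinity>}\<close> and, with \<open>u = \<infinity> * e\<close>, to the set
  \<open>W = {e > 0}\<close> where mass is lost. The sets \<open>R\<close>, \<open>W - R\<close> and the complement of \<open>R \<union> W\<close> carry the recurrent, the
  dissipative, and the transient and conservative part.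

  Only recurrence on \<open>R\<close> requires an argument (\<open>truncated_potential_invariant\<close>, \<open>potential_dichotomy\<close>). For every
  potential \<open>v = potential f\<close> and \<open>h = min v c\<close>, the symmetry of \<open>P t\<close> shows that \<open>\<integral> (h - P t h) * potential g\<close> is at
  most \<open>c\<close> times the integral of the time integral of \<open>g\<close> up to \<open>t\<close>, hence finite. So \<open>h = P t h\<close> on \<open>R\<close>, and as
  \<open>c\<close> grows, \<open>v = P t v\<close> on \<open>R\<close>. But \<open>v\<close> exceeds \<open>P t v\<close> by the time integral of \<open>f\<close> up to \<open>t\<close>, which therefore
  vanishes wherever \<open>v\<close> is finite on \<open>R\<close>; there, \<open>v = 0\<close>.

  Before this, the semigroup of a closed form has to be constructed and shown to be unique. Both rest on the implicit
  Euler scheme \<open>T\<^sub>t = lim (1 + (t / 2 ^ k) * L) ^ (- 2 ^ k)\<close>. The resolvents \<open>(1 + h * L) ^ (- 1)\<close> are solutions of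
  variational problems (\<open>variational_solution\<close>); the scheme converges on the domain of \<open>L\<^sup>2\<close> by the estimate
  \<open>res_add_close\<close> for two consecutive resolvents, and any semigroup with generator \<open>- L\<close> is its limit
  (\<open>semigroup_eq_sg\<close>). The Markov property holds for the resolvents, because truncation to the unit interval decreases
  the functional that they minimise (\<open>res_unit\<close>), and it passes to the limit.

  Finally, for an invariant set \<open>Y\<close> multiplication by the indicator function of \<open>Y\<close> preserves the domain of the form
  and the form does not couple \<open>Y\<close> with its complement (\<open>form_onY\<close>). So the part on \<open>Y\<close> is again a Dirichlet form.
  Its semigroup is the restriction of \<open>T\<^sub>t\<close> by uniqueness, and all properties of the part can be checked on \<open>M\<close>.
\<close>

section \<open>Semi-inner products\<close>

text \<open>Square integrable functions are handled as functions and not as equivalence classes. Their inner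
  product is therefore only semidefinite, and \<open>nrm (f - g) = 0\<close> takes the place of \<open>f = g\<close>.\<close>

locale semi_inner_space =
  fixes H :: "'v::real_vector set" and ip :: "'v \<Rightarrow> 'v \<Rightarrow> real"
  assumes subspace_H: "subspace H"
    and ip_sym: "\<lbrakk>u \<in> H; v \<in> H\<rbrakk> \<Longrightarrow> ip u v = ip v u"
    and ip_add_left: "\<lbrakk>u \<in> H; v \<in> H; w \<in> H\<rbrakk> \<Longrightarrow> ip (u + v) w = ip u w + ip v w"
    and ip_scale_left: "\<lbrakk>u \<in> H; w \<in> H\<rbrakk> \<Longrightarrow> ip (c *\<^sub>R u) w = c * ip u w"
    and ip_nonneg: "u \<in> H \<Longrightarrow> 0 \<le> ip u u"
begin

definition nrm :: "'v \<Rightarrow> real" where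
  "nrm u = sqrt (ip u u)"

lemma mem_zero [simp]: "0 \<in> H"
  and mem_add [simp]: "u \<in> H \<Longrightarrow> v \<in> H \<Longrightarrow> u + v \<in> H"
  and mem_diff [simp]: "u \<in> H \<Longrightarrow> v \<in> H \<Longrightarrow> u - v \<in> H"
  and mem_scale [simp]: "u \<in> H \<Longrightarrow> c *\<^sub>R u \<in> H"
  and mem_uminus [simp]: "u \<in> H \<Longrightarrow> - u \<in> H"
  using subspace_H by (auto simp: subspace_0 subspace_add subspace_diff subspace_scale subspace_neg)

lemma ip_add_right: "\<lbrakk>u \<in> H; v \<in> H; w \<in> H\<rbrakk> \<Longrightarrow> ip w (u + v) = ip w u + ip w v"
  by (metis ip_add_left ip_sym mem_add)

lemma ip_scale_right: "\<lbrakk>u \<in> H; w \<in> H\<rbrakk> \<Longrightarrow> ip w (c *\<^sub>R u) = c * ip w u"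
  by (metis ip_scale_left ip_sym mem_scale)

lemma ip_uminus_left: "\<lbrakk>u \<in> H; w \<in> H\<rbrakk> \<Longrightarrow> ip (- u) w = - ip u w"
  using ip_scale_left[of u w "-1"] by simp

lemma ip_uminus_right: "\<lbrakk>u \<in> H; w \<in> H\<rbrakk> \<Longrightarrow> ip w (- u) = - ip w u"
  using ip_scale_right[of u w "-1"] by simp

lemma ip_diff_left: "\<lbrakk>u \<in> H; v \<in> H; w \<in> H\<rbrakk> \<Longrightarrow> ip (u - v) w = ip u w - ip v w"
  using ip_add_left[of u "-v" w] by (simp add: ip_uminus_left)

lemma ip_diff_right: "\<lbrakk>u \<in> H; v \<in> H; w \<in> H\<rbrakk> \<Longrightarrow> ip w (u - v) = ip w u - ip w v"
  using ip_add_right[of u "-v" w] by (simp add: ip_uminus_right)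

lemmas ip_simps = ip_add_left ip_add_right ip_scale_left ip_scale_right
  ip_uminus_left ip_uminus_right ip_diff_left ip_diff_right

lemma nrm_nonneg [simp]: "u \<in> H \<Longrightarrow> 0 \<le> nrm u"
  by (simp add: nrm_def ip_nonneg)

lemma nrm_square: "u \<in> H \<Longrightarrow> (nrm u)\<^sup>2 = ip u u"
  by (simp add: nrm_def ip_nonneg)

lemma Cauchy_Schwarz_square:
  assumes "u \<in> H" "v \<in> H"
  shows "(ip u v)\<^sup>2 \<le> ip u u * ip v v"
proof -
  have q: "0 \<le> ip u u - 2 * t * ip u v + t\<^sup>2 * ip v v" for t
    using ip_nonneg[of "u - t *\<^sub>R v"] assms
    by (simp add: ip_simps ip_sym[of v u] algebra_simps power2_eq_square)
  show ?thesis
  proof (cases "ip v v = 0")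
    case True
    \<comment> \<open>For an isotropic \<open>v\<close> the quadratic polynomial \<open>q\<close> is affine and bounded below.\<close>
    have "ip u v = 0"
    proof (rule ccontr)
      assume "ip u v \<noteq> 0"
      then show False
        using q[of "(ip u u + 1) / (2 * ip u v)"] True by (simp add: field_simps)
    qed
    then show ?thesis using True by simp
  next
    case False
    then have pos: "0 < ip v v" using ip_nonneg[OF assms(2)] by simp
    have "ip u u - 2 * (ip u v / ip v v) * ip u v + (ip u v / ip v v)\<^sup>2 * ip v v
        = ip u u - (ip u v)\<^sup>2 / ip v v"
      using pos by (simp add: power2_eq_square field_simps)
    with q[of "ip u v / ip v v"] have "(ip u v)\<^sup>2 / ip v v \<le> ip u u" by linarith
    then show ?thesis using pos by (simp add: field_simps)
  qed
qed

lemma Cauchy_Schwarz: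
  assumes "u \<in> H" "v \<in> H"
  shows "\<bar>ip u v\<bar> \<le> nrm u * nrm v"
proof (rule power2_le_imp_le)
  show "\<bar>ip u v\<bar>\<^sup>2 \<le> (nrm u * nrm v)\<^sup>2"
    using Cauchy_Schwarz_square[OF assms] assms by (simp add: power_mult_distrib nrm_square)
qed (use assms in simp)

lemma nrm_scale: "u \<in> H \<Longrightarrow> nrm (c *\<^sub>R u) = \<bar>c\<bar> * nrm u"
  unfolding nrm_def by (simp add: ip_simps real_sqrt_mult)

lemma nrm_zero [simp]: "nrm 0 = 0"
  using nrm_scale[of 0 0] by simp

lemma nrm_minus_commute: "u \<in> H \<Longrightarrow> v \<in> H \<Longrightarrow> nrm (u - v) = nrm (v - u)"
  using nrm_scale[of "u - v" "-1"] by simp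

lemma nrm_triangle:
  assumes "u \<in> H" "v \<in> H"
  shows "nrm (u + v) \<le> nrm u + nrm v"
proof (rule power2_le_imp_le)
  have "(nrm (u + v))\<^sup>2 = ip u u + 2 * ip u v + ip v v"
    using assms by (simp add: nrm_square ip_simps ip_sym[of v u])
  also have "\<dots> \<le> (nrm u)\<^sup>2 + 2 * (nrm u * nrm v) + (nrm v)\<^sup>2"
    using Cauchy_Schwarz[OF assms] assms by (simp add: nrm_square)
  finally show "(nrm (u + v))\<^sup>2 \<le> (nrm u + nrm v)\<^sup>2"
    by (simp add: power2_sum algebra_simps)
qed (use assms in simp)

lemma nrm_triangle_diff:
  assumes "a \<in> H" "b \<in> H" "c \<in> H"
  shows "nrm (a - c) \<le> nrm (a - b) + nrm (b - c)"
  using nrm_triangle[of "a - b" "b - c"] assms by simp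

lemma nrm_triangle_sub:
  assumes "a \<in> H" "b \<in> H"
  shows "nrm a \<le> nrm (a - b) + nrm b"
  using nrm_triangle[of "a - b" b] assms by simp

lemma ip_null_left: "u \<in> H \<Longrightarrow> v \<in> H \<Longrightarrow> w \<in> H \<Longrightarrow> nrm (u - v) = 0 \<Longrightarrow> ip u w = ip v w"
  using Cauchy_Schwarz[of "u - v" w] by (simp add: ip_simps)

lemma ip_tendsto_left:
  assumes "\<And>n. U n \<in> H" "u \<in> H" "w \<in> H" "((\<lambda>n. nrm (U n - u)) \<longlongrightarrow> 0) F"
  shows "((\<lambda>n. ip (U n) w) \<longlongrightarrow> ip u w) F"
proof (rule LIM_zero_cancel, rule Lim_null_comparison)
  show "\<forall>\<^sub>F n in F. norm (ip (U n) w - ip u w) \<le> nrm (U n - u) * nrm w"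
    using Cauchy_Schwarz[of "U _ - u" w] assms by (simp add: ip_simps)
  show "((\<lambda>n. nrm (U n - u) * nrm w) \<longlongrightarrow> 0) F"
    using tendsto_mult_left_zero[OF assms(4)] by simp
qed

lemma nrm_tendsto:
  assumes "\<And>n. U n \<in> H" "u \<in> H" "((\<lambda>n. nrm (U n - u)) \<longlongrightarrow> 0) F"
  shows "((\<lambda>n. nrm (U n)) \<longlongrightarrow> nrm u) F"
proof (rule LIM_zero_cancel, rule Lim_null_comparison[OF _ assms(3)])
  have "\<bar>nrm (U n) - nrm u\<bar> \<le> nrm (U n - u)" for n
    using nrm_triangle_sub[of "U n" u] nrm_triangle_sub[of u "U n"]
      nrm_minus_commute[of u "U n"] assms by simp
  then show "\<forall>\<^sub>F n in F. norm (nrm (U n) - nrm u) \<le> nrm (U n - u)"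
    by simp
qed

lemma nrm_limit_unique:
  assumes "\<And>n. U n \<in> H" "u \<in> H" "v \<in> H" "F \<noteq> bot"
    "((\<lambda>n. nrm (U n - u)) \<longlongrightarrow> 0) F" "((\<lambda>n. nrm (U n - v)) \<longlongrightarrow> 0) F"
  shows "nrm (u - v) = 0"
proof -
  have "((\<lambda>n. nrm (U n - u) + nrm (U n - v)) \<longlongrightarrow> 0) F"
    using tendsto_add[OF assms(5,6)] by simp
  moreover have "nrm (u - v) \<le> nrm (U n - u) + nrm (U n - v)" for n
    using nrm_triangle_diff[of u "U n" v] nrm_minus_commute[of u "U n"] assms by simp
  ultimately have "nrm (u - v) \<le> 0"
    using tendsto_lowerbound[of _ 0 F "nrm (u - v)"] assms(4) by simp
  then show ?thesis using assms by (simp add: order_antisym)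
qed

text \<open>Operators on representatives are linear only up to vectors of seminorm zero.\<close>

definition lin_contr :: "('v \<Rightarrow> 'v) \<Rightarrow> bool" where
  "lin_contr A \<longleftrightarrow> (\<forall>f\<in>H. A f \<in> H) \<and> (\<forall>f\<in>H. nrm (A f) \<le> nrm f) \<and>
     (\<forall>f\<in>H. \<forall>g\<in>H. nrm (A (f + g) - (A f + A g)) = 0) \<and>
     (\<forall>f\<in>H. \<forall>c. nrm (A (c *\<^sub>R f) - c *\<^sub>R A f) = 0)"

lemma lin_contr_mem: "lin_contr A \<Longrightarrow> f \<in> H \<Longrightarrow> A f \<in> H"
  and lin_contr_le: "lin_contr A \<Longrightarrow> f \<in> H \<Longrightarrow> nrm (A f) \<le> nrm f"
  and lin_contr_add: "lin_contr A \<Longrightarrow> f \<in> H \<Longrightarrow> g \<in> H \<Longrightarrow> nrm (A (f + g) - (A f + A g)) = 0"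
  and lin_contr_scale: "lin_contr A \<Longrightarrow> f \<in> H \<Longrightarrow> nrm (A (c *\<^sub>R f) - c *\<^sub>R A f) = 0"
  by (auto simp: lin_contr_def)

lemma linear_diff_null:
  assumes mem: "\<And>f. f \<in> H \<Longrightarrow> A f \<in> H"
    and add: "\<And>f g. f \<in> H \<Longrightarrow> g \<in> H \<Longrightarrow> nrm (A (f + g) - (A f + A g)) = 0"
    and "f \<in> H" "g \<in> H"
  shows "nrm (A (f - g) - (A f - A g)) = 0"
  using add[of "f - g" g] nrm_minus_commute[of "A f - A g" "A (f - g)"] assms(3,4) mem
  by (simp add: algebra_simps)

lemma lin_contr_lipschitz:
  assumes "lin_contr A" "f \<in> H" "g \<in> H"
  shows "nrm (A f - A g) \<le> nrm (f - g)"
proof -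
  have "nrm (A (f - g) - (A f - A g)) = 0"
    by (rule linear_diff_null) (use assms in \<open>auto simp: lin_contr_def\<close>)
  moreover have "nrm (A f - A g) \<le> nrm ((A f - A g) - A (f - g)) + nrm (A (f - g))"
    using nrm_triangle_sub assms by (simp add: lin_contr_mem)
  moreover have "nrm ((A f - A g) - A (f - g)) = nrm (A (f - g) - (A f - A g))"
    using nrm_minus_commute assms by (simp add: lin_contr_mem)
  moreover have "nrm (A (f - g)) \<le> nrm (f - g)"
    using assms by (simp add: lin_contr_le)
  ultimately show ?thesis by linarith
qed

lemma lin_contr_id: "lin_contr (\<lambda>f. f)"
  by (simp add: lin_contr_def)

lemma null_if_le: "u \<in> H \<Longrightarrow> nrm u \<le> 0 \<Longrightarrow> nrm u = 0"
  by (simp add: order_antisym)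

lemma null_trans:
  assumes "a \<in> H" "b \<in> H" "c \<in> H" "nrm (a - b) = 0" "nrm (b - c) = 0"
  shows "nrm (a - c) = 0"
  by (rule null_if_le) (use nrm_triangle_diff[of a b c] assms in auto)

lemma lin_contr_comp:
  assumes A: "lin_contr A" and B: "lin_contr B"
  shows "lin_contr (\<lambda>f. A (B f))"
  unfolding lin_contr_def
proof (intro conjI ballI allI)
  note mem = lin_contr_mem[OF A] lin_contr_mem[OF B]
  fix f assume f: "f \<in> H"
  show "A (B f) \<in> H" using f mem by simp
  show "nrm (A (B f)) \<le> nrm f" using lin_contr_le[OF A, of "B f"] lin_contr_le[OF B f] f mem by simp
  fix g assume g: "g \<in> H"
  have "nrm (A (B (f + g)) - A (B f + B g)) = 0"
    using lin_contr_lipschitz[OF A, of "B (f + g)" "B f + B g"] lin_contr_add[OF B f g] f g mem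
    by (simp add: order_antisym)
  then show "nrm (A (B (f + g)) - (A (B f) + A (B g))) = 0"
    by (rule null_trans[rotated 3]) (use lin_contr_add[OF A, of "B f" "B g"] f g mem in simp_all)
next
  note mem = lin_contr_mem[OF A] lin_contr_mem[OF B]
  fix f c assume f: "f \<in> H"
  have "nrm (A (B (c *\<^sub>R f)) - A (c *\<^sub>R B f)) = 0"
    using lin_contr_lipschitz[OF A, of "B (c *\<^sub>R f)" "c *\<^sub>R B f"] lin_contr_scale[OF B f] f mem
    by (simp add: order_antisym)
  then show "nrm (A (B (c *\<^sub>R f)) - c *\<^sub>R A (B f)) = 0"
    by (rule null_trans[rotated 3]) (use lin_contr_scale[OF A, of "B f"] f mem in simp_all)
qed

lemma lin_contr_funpow: "lin_contr A \<Longrightarrow> lin_contr (A ^^ n)"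
  by (induction n) (use lin_contr_id lin_contr_comp in \<open>auto simp: id_def comp_def\<close>)

lemma lin_contr_limit:
  assumes A: "\<And>k. lin_contr (A k)" and mem: "\<And>f. f \<in> H \<Longrightarrow> B f \<in> H"
    and lim: "\<And>f. f \<in> H \<Longrightarrow> (\<lambda>k. nrm (A k f - B f)) \<longlonglongrightarrow> 0"
  shows "lin_contr B"
  unfolding lin_contr_def
proof (intro conjI ballI allI)
  note mm = mem lin_contr_mem[OF A]
  fix f assume f: "f \<in> H"
  show "B f \<in> H" using f mem by simp
  have "(\<lambda>k. nrm (A k f)) \<longlonglongrightarrow> nrm (B f)"
    using nrm_tendsto[OF _ _ lim[OF f]] f mm by simp
  then show "nrm (B f) \<le> nrm f"
    using LIMSEQ_le_const2 lin_contr_le[OF A f] by blast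
  fix g assume g: "g \<in> H"
  have "(\<lambda>k. nrm (A k f - B f) + nrm (A k g - B g)) \<longlonglongrightarrow> 0"
    using tendsto_add[OF lim[OF f] lim[OF g]] by simp
  moreover have "nrm (A k (f + g) - (B f + B g)) \<le> nrm (A k f - B f) + nrm (A k g - B g)" for k
  proof -
    have "nrm (A k (f + g) - (B f + B g)) \<le> nrm (A k (f + g) - (A k f + A k g)) + nrm ((A k f + A k g) - (B f + B g))"
      using nrm_triangle_diff f g mm by simp
    also have "\<dots> = nrm ((A k f - B f) + (A k g - B g))"
      using lin_contr_add[OF A f g] by (simp add: algebra_simps)
    also have "\<dots> \<le> nrm (A k f - B f) + nrm (A k g - B g)"
      using nrm_triangle f g mm by simp
    finally show ?thesis .
  qed
  ultimately have "(\<lambda>k. nrm (A k (f + g) - (B f + B g))) \<longlonglongrightarrow> 0"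
    by (rule_tac tendsto_sandwich[of "\<lambda>_. 0"]) (use f g mm in \<open>auto intro!: always_eventually\<close>)
  then show "nrm (B (f + g) - (B f + B g)) = 0"
    using nrm_limit_unique[OF _ _ _ _ lim[of "f + g"]] f g mm by simp
next
  note mm = mem lin_contr_mem[OF A]
  fix f c assume f: "f \<in> H"
  have "(\<lambda>k. \<bar>c\<bar> * nrm (A k f - B f)) \<longlonglongrightarrow> 0"
    using tendsto_mult_right_zero[OF lim[OF f]] by simp
  moreover have "nrm (A k (c *\<^sub>R f) - c *\<^sub>R B f) \<le> \<bar>c\<bar> * nrm (A k f - B f)" for k
  proof -
    have "nrm (A k (c *\<^sub>R f) - c *\<^sub>R B f) \<le> nrm (A k (c *\<^sub>R f) - c *\<^sub>R A k f) + nrm (c *\<^sub>R A k f - c *\<^sub>R B f)"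
      using nrm_triangle_diff f mm by simp
    also have "\<dots> = nrm (c *\<^sub>R (A k f - B f))"
      using lin_contr_scale[OF A f] by (simp add: algebra_simps)
    finally show ?thesis using nrm_scale f mm by simp
  qed
  ultimately have "(\<lambda>k. nrm (A k (c *\<^sub>R f) - c *\<^sub>R B f)) \<longlonglongrightarrow> 0"
    by (rule_tac tendsto_sandwich[of "\<lambda>_. 0"]) (use f mm in \<open>auto intro!: always_eventually\<close>)
  then show "nrm (B (c *\<^sub>R f) - c *\<^sub>R B f) = 0"
    using nrm_limit_unique[OF _ _ _ _ lim[of "c *\<^sub>R f"]] f mm by simp
qed

end

section \<open>Closed forms and their resolvents\<close>

locale closed_form = semi_inner_space H ip + form: semi_inner_space D E
  for H :: "'v::real_vector set" and ip and D :: "'v set" and E +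
  assumes D_subset: "D \<subseteq> H"
    and complete: "\<lbrakk>\<And>n. U n \<in> H; \<And>\<epsilon>. 0 < \<epsilon> \<Longrightarrow> \<exists>N. \<forall>m\<ge>N. \<forall>n\<ge>N. nrm (U m - U n) < \<epsilon>\<rbrakk>
        \<Longrightarrow> \<exists>u\<in>H. (\<lambda>n. nrm (U n - u)) \<longlonglongrightarrow> 0"
    and closed: "\<lbrakk>\<And>n. U n \<in> D; u \<in> H; (\<lambda>n. nrm (U n - u)) \<longlonglongrightarrow> 0;
        \<And>\<epsilon>. 0 < \<epsilon> \<Longrightarrow> \<exists>N. \<forall>m\<ge>N. \<forall>n\<ge>N. E (U m - U n) (U m - U n) < \<epsilon>\<rbrakk>
       \<Longrightarrow> u \<in> D \<and> (\<lambda>n. E (U n - u) (U n - u)) \<longlonglongrightarrow> 0"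
    and dense: "\<lbrakk>f \<in> H; 0 < \<epsilon>\<rbrakk> \<Longrightarrow> \<exists>u\<in>D. nrm (f - u) < \<epsilon>"
begin

lemma D_mem [simp]: "u \<in> D \<Longrightarrow> u \<in> H"
  using D_subset by auto

text \<open>Apply closedness to the constant sequence \<open>u\<close>, which also converges to \<open>v\<close>.\<close>

lemma D_null_cong:
  assumes "u \<in> D" "v \<in> H" "nrm (u - v) = 0"
  shows "v \<in> D" "w \<in> D \<Longrightarrow> E u w = E v w"
proof -
  have E0: "E 0 0 = 0" using form.ip_scale_left[of 0 0 0] by simp
  have *: "v \<in> D \<and> (\<lambda>n::nat. E (u - v) (u - v)) \<longlonglongrightarrow> 0"
    by (rule closed) (use assms E0 in auto)
  then show "v \<in> D" by simp
  assume "w \<in> D"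
  moreover have "E (u - v) (u - v) = 0" using * LIMSEQ_const_iff by blast
  ultimately show "E u w = E v w"
    using * assms(1) by (intro form.ip_null_left) (simp_all add: form.nrm_def)
qed

text \<open>Lax--Milgram: the solution minimises \<open>h * E u u + ip u u - 2 * \<phi> u\<close>, and a minimising sequence is
  Cauchy by the parallelogram law.\<close>

lemma variational_solution:
  assumes h: "0 < h"
    and add: "\<And>u v. u \<in> D \<Longrightarrow> v \<in> D \<Longrightarrow> \<phi> (u + v) = \<phi> u + \<phi> v"
    and scale: "\<And>u c. u \<in> D \<Longrightarrow> \<phi> (c *\<^sub>R u) = c * \<phi> u"
    and bd: "\<And>u. u \<in> D \<Longrightarrow> \<bar>\<phi> u\<bar> \<le> C * nrm u"
  shows "\<exists>u\<in>D. \<forall>v\<in>D. h * E u v + ip u v = \<phi> v"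
proof -
  define B where "B = (\<lambda>u v. h * E u v + ip u v)"
  define Q where "Q u = B u u - 2 * \<phi> u" for u
  interpret B: semi_inner_space D B
  proof
    show "subspace D" by (rule form.subspace_H)
  next
    fix u v assume "u \<in> D" "v \<in> D"
    then show "B u v = B v u" by (simp add: B_def form.ip_sym[of u v] ip_sym[of u v])
  next
    fix u v w assume "u \<in> D" "v \<in> D" "w \<in> D"
    then show "B (u + v) w = B u w + B v w" by (simp add: B_def form.ip_simps ip_simps algebra_simps)
  next
    fix u w c assume "u \<in> D" "w \<in> D"
    then show "B (c *\<^sub>R u) w = c * B u w" by (simp add: B_def form.ip_simps ip_simps algebra_simps)
  next
    fix u assume "u \<in> D"
    then show "0 \<le> B u u" using h by (simp add: B_def form.ip_nonneg ip_nonneg)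
  qed
  have lower: "- C\<^sup>2 \<le> Q u" if u: "u \<in> D" for u
  proof -
    have "0 \<le> h * E u u" using h form.ip_nonneg[OF u] by simp
    moreover have "(nrm u)\<^sup>2 - 2 * (C * nrm u) + C\<^sup>2 \<ge> 0"
      using zero_le_power2[of "nrm u - C"] by (simp add: power2_diff algebra_simps)
    ultimately show ?thesis
      using bd[OF u] nrm_square[of u] u unfolding Q_def B_def by fastforce
  qed
  define m where "m = Inf (Q ` D)"
  have bdd: "bdd_below (Q ` D)" using lower by (auto intro!: bdd_belowI2)
  have ne: "Q ` D \<noteq> {}" using form.mem_zero by blast
  have m_le: "m \<le> Q u" if "u \<in> D" for u
    unfolding m_def by (rule cInf_lower) (use that bdd in auto)
  have "\<exists>u\<in>D. Q u < m + 1 / real (Suc n)" for n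
  proof -
    have "m < m + 1 / real (Suc n)" by simp
    then show ?thesis unfolding m_def using cInf_lessD[OF ne] by blast
  qed
  then obtain U where U: "\<And>n. U n \<in> D" "\<And>n. Q (U n) < m + 1 / real (Suc n)" by metis
  have par: "B (u - v) (u - v) \<le> 2 * (Q u - m) + 2 * (Q v - m)" if u: "u \<in> D" and v: "v \<in> D" for u v
  proof -
    have "B (u - v) (u - v) = 2 * Q u + 2 * Q v - 4 * Q ((1/2) *\<^sub>R (u + v))"
      using u v by (simp add: Q_def B.ip_simps B.ip_sym[of v u] add scale algebra_simps)
    moreover have "m \<le> Q ((1/2) *\<^sub>R (u + v))" using m_le u v by simp
    ultimately show ?thesis unfolding B_def by (simp add: algebra_simps)
  qed
  have BU: "B (U i - U j) (U i - U j) < 4 * \<epsilon>" if "1 / real (Suc N) < \<epsilon>" "i \<ge> N" "j \<ge> N" for i j N \<epsilon>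
  proof -
    have "1 / real (Suc i) \<le> 1 / real (Suc N)" "1 / real (Suc j) \<le> 1 / real (Suc N)"
      using that by (auto simp: field_simps)
    then show ?thesis using par[OF U(1)[of i] U(1)[of j]] U(2)[of i] U(2)[of j] that
      by (simp only: algebra_simps)
  qed
  have BC: "\<exists>N. \<forall>i\<ge>N. \<forall>j\<ge>N. B (U i - U j) (U i - U j) < \<epsilon>" if "0 < \<epsilon>" for \<epsilon>
  proof -
    obtain N where N: "1 / real (Suc N) < \<epsilon> / 4"
      using reals_Archimedean[of "\<epsilon>/4"] \<open>0 < \<epsilon>\<close> unfolding inverse_eq_divide by (metis divide_pos_pos zero_less_numeral)
    then have "\<forall>i\<ge>N. \<forall>j\<ge>N. B (U i - U j) (U i - U j) < 4 * (\<epsilon> / 4)" using BU by blast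
    then show ?thesis by auto
  qed
  have Ble: "h * E w w \<le> B w w" "ip w w \<le> B w w" if "w \<in> D" for w
    using that h form.ip_nonneg[of w] ip_nonneg[of w] by (auto simp: B_def)
  have "\<exists>u\<in>H. (\<lambda>n. nrm (U n - u)) \<longlonglongrightarrow> 0"
  proof (rule complete)
    fix \<epsilon> :: real assume "0 < \<epsilon>"
    then obtain N where N: "\<forall>i\<ge>N. \<forall>j\<ge>N. B (U i - U j) (U i - U j) < \<epsilon>\<^sup>2" using BC[of "\<epsilon>\<^sup>2"] by auto
    have "nrm (U i - U j) < \<epsilon>" if "i \<ge> N" "j \<ge> N" for i j
    proof (rule power2_less_imp_less)
      show "(nrm (U i - U j))\<^sup>2 < \<epsilon>\<^sup>2"
        using N that Ble(2)[of "U i - U j"] U(1) by (fastforce simp: nrm_square)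
    qed (use \<open>0 < \<epsilon>\<close> in simp)
    then show "\<exists>N. \<forall>m\<ge>N. \<forall>n\<ge>N. nrm (U m - U n) < \<epsilon>" by blast
  qed (use U in simp)
  then obtain u where u: "u \<in> H" "(\<lambda>n. nrm (U n - u)) \<longlonglongrightarrow> 0" by blast
  have uD: "u \<in> D \<and> (\<lambda>n. E (U n - u) (U n - u)) \<longlonglongrightarrow> 0"
  proof (rule closed[OF U(1) u])
    fix \<epsilon> :: real assume "0 < \<epsilon>"
    then obtain N where N: "\<forall>i\<ge>N. \<forall>j\<ge>N. B (U i - U j) (U i - U j) < h * \<epsilon>" using BC[of "h * \<epsilon>"] h by auto
    have "E (U i - U j) (U i - U j) < \<epsilon>" if "i \<ge> N" "j \<ge> N" for i j
    proof -
      have "h * E (U i - U j) (U i - U j) < h * \<epsilon>"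
        using N that Ble(1)[of "U i - U j"] U(1) by fastforce
      then show ?thesis using h by simp
    qed
    then show "\<exists>N. \<forall>m\<ge>N. \<forall>n\<ge>N. E (U m - U n) (U m - U n) < \<epsilon>" by blast
  qed
  have "B u v = \<phi> v" if v: "v \<in> D" for v
  proof -
    have "(\<lambda>n. form.nrm (U n - u)) \<longlonglongrightarrow> 0"
      using tendsto_real_sqrt[OF conjunct2[OF uD]] by (simp add: form.nrm_def)
    then have "(\<lambda>n. E (U n) v) \<longlonglongrightarrow> E u v"
      using form.ip_tendsto_left[of U, OF U(1) conjunct1[OF uD] v] by simp
    moreover have "(\<lambda>n. ip (U n) v) \<longlonglongrightarrow> ip u v"
      using ip_tendsto_left[OF _ u(1) _ u(2)] U v by simp
    ultimately have BL: "(\<lambda>n. B (U n) v) \<longlonglongrightarrow> B u v"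
      unfolding B_def by (intro tendsto_intros)
    have ineq: "0 \<le> 2 * t * (B u v - \<phi> v) + t\<^sup>2 * B v v" for t
    proof -
      have "(\<lambda>n. 2 * t * (B (U n) v - \<phi> v) + t\<^sup>2 * B v v + 1 / real (Suc n))
          \<longlonglongrightarrow> 2 * t * (B u v - \<phi> v) + t\<^sup>2 * B v v + 0"
        by (intro tendsto_intros BL LIMSEQ_inverse_real_of_nat[unfolded inverse_eq_divide])
      moreover have "0 \<le> 2 * t * (B (U n) v - \<phi> v) + t\<^sup>2 * B v v + 1 / real (Suc n)" for n
      proof -
        have "Q (U n + t *\<^sub>R v) = Q (U n) + 2 * t * (B (U n) v - \<phi> v) + t\<^sup>2 * B v v"
          using U(1)[of n] v
          by (simp add: Q_def B.ip_simps B.ip_sym[of v "U n"] add scale algebra_simps power2_eq_square)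
        then show ?thesis using m_le[of "U n + t *\<^sub>R v"] U(1)[of n] U(2)[of n] v by simp
      qed
      ultimately show ?thesis using LIMSEQ_le_const[of _ _ 0] by (simp only: add_0_right) blast
    qed
    show ?thesis
    proof (rule ccontr)
      assume ne: "B u v \<noteq> \<phi> v"
      define d where "d = B u v - \<phi> v"
      define b where "b = B v v + 1"
      have b: "b > 0" using B.ip_nonneg[OF v] by (simp add: b_def)
      have "2 * (- d / b) * d + (- d / b)\<^sup>2 * (b - 1) = - (d\<^sup>2 * (b + 1)) / b\<^sup>2"
        using b by (simp add: field_simps power2_eq_square)
      then have "2 * (- d / b) * d + (- d / b)\<^sup>2 * B v v = - (d\<^sup>2 * (b + 1)) / b\<^sup>2"
        by (simp add: b_def)
      moreover have "0 < d\<^sup>2 * (b + 1) / b\<^sup>2" using ne b by (simp add: d_def)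
      ultimately show False using ineq[of "- d / b"] by (simp add: d_def)
    qed
  qed
  then show ?thesis using uD unfolding B_def by blast
qed

text \<open>This is the variational problem for the closed form \<open>0\<close> with domain \<open>H\<close>.\<close>

lemma Riesz_representation:
  assumes add: "\<And>u v. u \<in> H \<Longrightarrow> v \<in> H \<Longrightarrow> \<phi> (u + v) = \<phi> u + \<phi> v"
    and scale: "\<And>u c. u \<in> H \<Longrightarrow> \<phi> (c *\<^sub>R u) = c * \<phi> u"
    and bd: "\<And>u. u \<in> H \<Longrightarrow> \<bar>\<phi> u\<bar> \<le> C * nrm u"
  shows "\<exists>g\<in>H. \<forall>h\<in>H. ip g h = \<phi> h"
proof -
  interpret Z: closed_form H ip H "\<lambda>_ _. 0"
  proof (unfold_locales; (fact subspace_H complete; fail)?)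
    show "\<exists>u\<in>H. nrm (f - u) < \<epsilon>" if "f \<in> H" "0 < \<epsilon>" for f \<epsilon>
      using that by (intro bexI[of _ f]) auto
  qed auto
  show ?thesis using Z.variational_solution[of 1 \<phi> C] assms by simp
qed

text \<open>\<open>res h = (1 + h * L) ^ (- 1)\<close>, where \<open>L\<close> is the operator of the form.\<close>

definition res :: "real \<Rightarrow> 'v \<Rightarrow> 'v" where
  "res h f = (SOME u. u \<in> D \<and> (\<forall>v\<in>D. h * E u v + ip u v = ip f v))"

text \<open>\<open>gen u g\<close>: \<open>u\<close> is in the domain of the operator \<open>L\<close> of the form and \<open>L u = g\<close>.\<close>

definition gen :: "'v \<Rightarrow> 'v \<Rightarrow> bool" where
  "gen u g \<longleftrightarrow> u \<in> D \<and> g \<in> H \<and> (\<forall>v\<in>D. E u v = ip g v)"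

lemma res_props:
  assumes "0 < h" "f \<in> H"
  shows res_D [simp]: "res h f \<in> D" and res_eq: "v \<in> D \<Longrightarrow> h * E (res h f) v + ip (res h f) v = ip f v"
proof -
  have "\<exists>u. u \<in> D \<and> (\<forall>v\<in>D. h * E u v + ip u v = ip f v)"
    using variational_solution[of h "ip f" "nrm f"] assms Cauchy_Schwarz[OF assms(2)]
    by (auto simp: ip_simps)
  from someI_ex[OF this] show "res h f \<in> D" "v \<in> D \<Longrightarrow> h * E (res h f) v + ip (res h f) v = ip f v"
    unfolding res_def by blast+
qed

text \<open>Test the equation with its solution \<open>u\<close>. By linearity, a solution for the datum \<open>0\<close> is null, which gives
  uniqueness.\<close>

lemma solution_le:
  assumes "0 < h" "u \<in> D" "f \<in> H" "\<And>v. v \<in> D \<Longrightarrow> h * E u v + ip u v = ip f v"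
  shows "nrm u \<le> nrm f"
proof -
  have "(nrm u)\<^sup>2 \<le> ip f u"
    using assms(4)[OF assms(2)] mult_nonneg_nonneg[OF less_imp_le[OF assms(1)] form.ip_nonneg[OF assms(2)]]
      nrm_square[OF D_mem[OF assms(2)]] by linarith
  also have "\<dots> \<le> nrm f * nrm u" using Cauchy_Schwarz[of f u] assms by simp
  finally have "nrm u * nrm u \<le> nrm f * nrm u" by (simp add: power2_eq_square)
  then show ?thesis using nrm_nonneg[of u] nrm_nonneg[of f] assms(2,3)
    by (metis D_mem mult_le_cancel_right order_antisym_conv not_le)
qed

lemma solution_unique:
  assumes "0 < h" "u \<in> D" "f \<in> H" "\<And>v. v \<in> D \<Longrightarrow> h * E u v + ip u v = ip f v"
  shows "nrm (u - res h f) = 0"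
proof -
  have "nrm (u - res h f) \<le> nrm 0"
  proof (rule solution_le[OF assms(1)])
    fix v assume v: "v \<in> D"
    then show "h * E (u - res h f) v + ip (u - res h f) v = ip 0 v"
      using assms(4)[OF v] res_eq[OF assms(1,3) v] assms ip_scale_left[of 0 v 0]
      by (simp add: form.ip_simps ip_simps algebra_simps)
  qed (use assms in auto)
  then show ?thesis using assms by (simp add: order_antisym)
qed

lemma res_lin_contr:
  assumes h: "0 < h"
  shows "lin_contr (res h)"
  unfolding lin_contr_def
proof (intro conjI ballI allI)
  fix f assume f: "f \<in> H"
  show "res h f \<in> H" using h f by simp
  show "nrm (res h f) \<le> nrm f" by (rule solution_le[OF h _ f res_eq[OF h f]]) (use h f in simp_all)
  fix g assume g: "g \<in> H"
  have "nrm (res h f + res h g - res h (f + g)) = 0"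
    by (rule solution_unique[OF h])
      (use h f g res_eq[OF h f] res_eq[OF h g] in \<open>auto simp: form.ip_simps ip_simps algebra_simps\<close>)
  then show "nrm (res h (f + g) - (res h f + res h g)) = 0"
    using nrm_minus_commute[of "res h f + res h g" "res h (f + g)"] f g h by simp
next
  fix f c assume f: "f \<in> H"
  have "nrm (c *\<^sub>R res h f - res h (c *\<^sub>R f)) = 0"
  proof (rule solution_unique[OF h])
    fix v assume v: "v \<in> D"
    have "c * (h * E (res h f) v + ip (res h f) v) = c * ip f v" using res_eq[OF h f v] by simp
    then show "h * E (c *\<^sub>R res h f) v + ip (c *\<^sub>R res h f) v = ip (c *\<^sub>R f) v"
      using v f h by (simp add: form.ip_simps ip_simps algebra_simps)
  qed (use h f in auto)
  then show "nrm (res h (c *\<^sub>R f) - c *\<^sub>R res h f) = 0"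
    using nrm_minus_commute[of "c *\<^sub>R res h f" "res h (c *\<^sub>R f)"] f h by simp
qed

lemmas res_lipschitz = lin_contr_lipschitz[OF res_lin_contr]

lemma res_mem [simp]: "0 < h \<Longrightarrow> f \<in> H \<Longrightarrow> res h f \<in> H"
  by simp

lemma res_sym:
  assumes "0 < h" "f \<in> H" "g \<in> H"
  shows "ip (res h f) g = ip f (res h g)"
  using res_eq[OF assms(1,2), of "res h g"] res_eq[OF assms(1,3), of "res h f"] assms
    form.ip_sym[of "res h f" "res h g"] ip_sym[of "res h f" "res h g"] ip_sym[of g "res h f"] by simp

lemma gen_res:
  assumes "0 < h" "f \<in> H"
  shows "gen (res h f) ((1 / h) *\<^sub>R (f - res h f))"
  unfolding gen_def using res_eq[OF assms] assms by (auto simp: ip_simps field_simps)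

lemma gen_imp_res:
  assumes "0 < h" "gen u g"
  shows "nrm (u - res h (u + h *\<^sub>R g)) = 0"
  by (rule solution_unique) (use assms in \<open>auto simp: gen_def ip_simps\<close>)

lemma gen_D: "gen u g \<Longrightarrow> u \<in> D" and gen_mem: "gen u g \<Longrightarrow> u \<in> H" "gen u g \<Longrightarrow> g \<in> H"
  by (auto simp: gen_def)

lemma gen_diff: "gen u g \<Longrightarrow> gen v k \<Longrightarrow> gen (u - v) (g - k)"
  by (auto simp: gen_def ip_simps form.ip_simps)

lemma gen_cong:
  assumes "gen u g" "u' \<in> H" "g' \<in> H" "nrm (u - u') = 0" "nrm (g - g') = 0"
  shows "gen u' g'"
  unfolding gen_def
proof (intro conjI ballI)
  show "u' \<in> D" using D_null_cong assms gen_D by blast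
  fix v assume v: "v \<in> D"
  show "E u' v = ip g' v"
    using D_null_cong(2)[OF gen_D[OF assms(1)] assms(2,4) v] ip_null_left[OF _ assms(3) _ assms(5), of v]
      assms(1) v by (auto simp: gen_def)
qed (use assms in simp)

text \<open>Here \<open>g = L u\<close>, and \<open>u = res h (u + h * g)\<close> is expanded by linearity.\<close>

lemma gen_res_expand:
  assumes "0 < h" "gen u g"
  shows "nrm (u - (res h u + h *\<^sub>R res h g)) = 0"
proof -
  note m = gen_mem[OF assms(2)]
  have A: "lin_contr (res h)" using res_lin_contr assms by simp
  have "nrm (res h (u + h *\<^sub>R g) - (res h u + res h (h *\<^sub>R g))) = 0"
    using lin_contr_add[OF A] m by simp
  moreover have "nrm ((res h u + res h (h *\<^sub>R g)) - (res h u + h *\<^sub>R res h g)) = 0"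
    using lin_contr_scale[OF A m(2), of h] m by simp
  ultimately have "nrm (res h (u + h *\<^sub>R g) - (res h u + h *\<^sub>R res h g)) = 0"
    by (rule null_trans[rotated 3]) (use m assms(1) in auto)
  then show ?thesis
    by (rule null_trans[rotated 3, OF gen_imp_res[OF assms]]) (use m assms(1) in auto)
qed

lemma gen_res_commute:
  assumes "0 < h" "gen u g"
  shows "gen (res h u) (res h g)"
proof (rule gen_cong[OF gen_res[OF assms(1) gen_mem(1)[OF assms(2)]]])
  note m = gen_mem[OF assms(2)]
  have "nrm ((1/h) *\<^sub>R (u - (res h u + h *\<^sub>R res h g))) = 0"
    using nrm_scale gen_res_expand[OF assms] m assms(1) by simp
  then show "nrm ((1/h) *\<^sub>R (u - res h u) - res h g) = 0"
    using assms(1) by (simp add: algebra_simps)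
qed (use assms gen_mem in auto)

lemma res_gen_close:
  assumes "0 < h" "gen u g"
  shows "nrm (res h u - u) \<le> h * nrm g"
proof -
  note m = gen_mem[OF assms(2)]
  have "nrm (res h u - u) \<le> nrm (res h u - res h (u + h *\<^sub>R g)) + nrm (res h (u + h *\<^sub>R g) - u)"
    using nrm_triangle_diff m assms(1) by simp
  also have "nrm (res h (u + h *\<^sub>R g) - u) = 0"
    using gen_imp_res[OF assms] nrm_minus_commute[of u "res h (u + h *\<^sub>R g)"] m assms(1) by simp
  also have "nrm (res h u - res h (u + h *\<^sub>R g)) \<le> nrm (u - (u + h *\<^sub>R g))"
    using res_lipschitz[OF assms(1), of u "u + h *\<^sub>R g"] m by simp
  also have "\<dots> = h * nrm g"
    using nrm_scale[OF m(2), of "- h"] assms(1) by simp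
  finally show ?thesis by simp
qed

text \<open>Test the equation of \<open>res h u\<close> with \<open>res h u - u\<close>.\<close>

lemma res_D_close:
  assumes h: "0 < h" and u: "u \<in> D"
  shows "(nrm (res h u - u))\<^sup>2 \<le> h * E u u"
proof -
  define w where "w = res h u"
  have w: "w \<in> D" using h u by (simp add: w_def)
  have "h * E w (w - u) + ip w (w - u) = ip u (w - u)"
    using res_eq[OF h, of u "w - u"] u w by (simp add: w_def)
  then have e: "(nrm (w - u))\<^sup>2 = h * (E w u - E w w)"
    using u w by (simp add: nrm_square ip_simps form.ip_simps algebra_simps)
  have "0 \<le> E (u - 2 *\<^sub>R w) (u - 2 *\<^sub>R w)" using form.ip_nonneg u w by simp
  also have "\<dots> = E u u - 4 * (E w u - E w w)"
    using u w by (simp add: form.ip_simps form.ip_sym[of u w] algebra_simps)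
  finally have "E w u - E w w \<le> E u u" using form.ip_nonneg[OF u] by simp
  then show ?thesis using e h by (simp add: w_def)
qed

lemma res_tendsto:
  assumes f: "f \<in> H"
  shows "((\<lambda>h. nrm (res h f - f)) \<longlongrightarrow> 0) (at_right 0)"
proof (rule tendstoI)
  fix e :: real assume e: "0 < e"
  obtain u where u: "u \<in> D" "nrm (f - u) < e / 4" using dense[OF f, of "e/4"] e by auto
  define d where "d = (e/4)\<^sup>2 / (E u u + 1)"
  have Eu: "0 \<le> E u u" using form.ip_nonneg u by simp
  then have d: "0 < d" using e by (simp add: d_def)
  have "nrm (res h f - f) < e" if h: "0 < h" "h < d" for h
  proof -
    have "h * (E u u + 1) < (e/4)\<^sup>2" using h Eu by (simp add: d_def field_simps)
    moreover have "h * E u u \<le> h * (E u u + 1)" using h by simp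
    ultimately have "(nrm (res h u - u))\<^sup>2 < (e/4)\<^sup>2" using res_D_close[OF h(1) u(1)] by linarith
    then have "nrm (res h u - u) < e/4" by (rule power2_less_imp_less) (use e in simp)
    moreover have "nrm (res h f - f) \<le> nrm (res h f - res h u) + nrm (res h u - f)"
      using nrm_triangle_diff u f h by simp
    moreover have "nrm (res h u - f) \<le> nrm (res h u - u) + nrm (u - f)"
      using nrm_triangle_diff u f h by simp
    moreover have "nrm (res h f - res h u) \<le> nrm (f - u)" using res_lipschitz h u f by simp
    moreover have "nrm (u - f) = nrm (f - u)" using nrm_minus_commute u f by simp
    ultimately show ?thesis using u(2) e by linarith
  qed
  moreover have "nrm (res h f - f) \<ge> 0" if "0 < h" for h using that f by simp
  ultimately show "\<forall>\<^sub>F h in at_right 0. dist (nrm (res h f - f)) 0 < e"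
    unfolding eventually_at_right_field using d by (auto intro!: exI[of _ d])
qed

lemma res_small:
  assumes "f \<in> H" "0 < e"
  obtains h where "0 < h" "nrm (res h f - f) < e"
proof -
  have "\<forall>\<^sub>F h in at_right 0. dist (nrm (res h f - f)) 0 < e"
    using tendstoD[OF res_tendsto[OF assms(1)] assms(2)] .
  moreover have "\<forall>\<^sub>F h in at_right (0::real). 0 < h" by (simp add: eventually_at_right_less)
  ultimately have "\<forall>\<^sub>F h in at_right 0. 0 < h \<and> nrm (res h f - f) < e"
    by eventually_elim (auto simp: dist_real_def)
  then show ?thesis using that eventually_happens[of _ "at_right (0::real)"] by auto
qed

text \<open>For small \<open>h\<close>, \<open>res h f\<close> is close to \<open>f\<close>; and it lies in the domain of \<open>L\<close>. If \<open>f\<close> is already in this domain, then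
  \<open>res h f\<close> is in the domain of \<open>L\<^sup>2\<close>.\<close>

lemma gen_dense:
  assumes "f \<in> H" "0 < e"
  obtains u g where "gen u g" "nrm (f - u) < e"
proof -
  obtain h where "0 < h" "nrm (res h f - f) < e" using res_small assms by blast
  then show ?thesis using that[OF gen_res] nrm_minus_commute[of f "res h f"] assms by simp
qed

lemma gen2_dense:
  assumes "f \<in> H" "0 < e"
  obtains u g k where "gen u g" "gen g k" "nrm (f - u) < e"
proof -
  obtain u g where u: "gen u g" "nrm (f - u) < e/2" using gen_dense[of f "e/2"] assms by auto
  obtain h where h: "0 < h" "nrm (res h u - u) < e/2" using res_small[of u "e/2"] assms gen_mem[OF u(1)] by auto
  note m = gen_mem[OF u(1)]
  have "nrm (f - res h u) \<le> nrm (f - u) + nrm (u - res h u)" using nrm_triangle_diff assms m h by simp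
  also have "nrm (u - res h u) = nrm (res h u - u)" using nrm_minus_commute m h by simp
  finally show ?thesis
    using that[OF gen_res_commute[OF h(1) u(1)] gen_res[OF h(1) m(2)]] u(2) h(2) by simp
qed

end

section \<open>The semigroup of a closed form\<close>

context semi_inner_space
begin

text \<open>\<open>A ^^ n - B ^^ n\<close> is the sum of the \<open>A ^^ i (A - B) B ^^ j\<close> with \<open>i + j = n - 1\<close>, and the powers of
  \<open>A\<close> do not increase the seminorm.\<close>

lemma funpow_telescoping:
  assumes A: "lin_contr A"
    and B: "\<And>j. (B ^^ j) f \<in> H" "\<And>j. nrm (A ((B ^^ j) f) - B ((B ^^ j) f)) \<le> e"
  shows "nrm ((A ^^ n) f - (B ^^ n) f) \<le> real n * e"
proof (induction n)
  case 0
  then show ?case using B(1)[of 0] by simp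
next
  case (Suc n)
  have An: "(A ^^ n) f \<in> H" using lin_contr_mem[OF lin_contr_funpow[OF A]] B(1)[of 0] by simp
  have "nrm ((A ^^ Suc n) f - (B ^^ Suc n) f)
      \<le> nrm (A ((A ^^ n) f) - A ((B ^^ n) f)) + nrm (A ((B ^^ n) f) - B ((B ^^ n) f))"
    using nrm_triangle_diff[of "A ((A ^^ n) f)" "A ((B ^^ n) f)" "B ((B ^^ n) f)"] lin_contr_mem[OF A]
      An B(1)[of n] B(1)[of "Suc n"] by simp
  also have "nrm (A ((A ^^ n) f) - A ((B ^^ n) f)) \<le> nrm ((A ^^ n) f - (B ^^ n) f)"
    using lin_contr_lipschitz[OF A An B(1)] .
  finally show ?case using Suc B(2)[of n] by (simp add: algebra_simps)
qed

lemma null_sym: "u \<in> H \<Longrightarrow> v \<in> H \<Longrightarrow> nrm (u - v) = 0 \<Longrightarrow> nrm (v - u) = 0"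
  using nrm_minus_commute by simp

lemma lin_contr_null:
  assumes "lin_contr A" "f \<in> H" "g \<in> H" "nrm (f - g) = 0"
  shows "nrm (A f - A g) = 0"
  using lin_contr_lipschitz[OF assms(1-3)] assms null_if_le lin_contr_mem by simp

lemma funpow_commute:
  assumes mem: "\<And>f. f \<in> H \<Longrightarrow> A f \<in> H" and B: "lin_contr B"
    and AB: "\<And>f. f \<in> H \<Longrightarrow> nrm (A (B f) - B (A f)) = 0" and f: "f \<in> H"
  shows "nrm (A ((B ^^ n) f) - (B ^^ n) (A f)) = 0"
proof (induction n)
  case 0
  then show ?case using f mem by simp
next
  case (Suc n)
  have m: "(B ^^ n) f \<in> H" "(B ^^ n) (A f) \<in> H"
    using lin_contr_mem[OF lin_contr_funpow[OF B]] f mem by auto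
  have "nrm (B (A ((B ^^ n) f)) - B ((B ^^ n) (A f))) = 0"
    using lin_contr_null[OF B] Suc m mem by simp
  with AB[OF m(1)] show ?case
    using null_trans[of "A (B ((B ^^ n) f))" "B (A ((B ^^ n) f))" "B ((B ^^ n) (A f))"]
      m mem lin_contr_mem[OF B] by simp
qed

lemma funpow_comp_commute:
  assumes A: "lin_contr A" and B: "lin_contr B"
    and AB: "\<And>f. f \<in> H \<Longrightarrow> nrm (A (B f) - B (A f)) = 0" and f: "f \<in> H"
  shows "nrm (((\<lambda>f. A (B f)) ^^ n) f - (A ^^ n) ((B ^^ n) f)) = 0"
proof (induction n)
  case 0
  then show ?case using f by simp
next
  case (Suc n)
  note mA = lin_contr_mem[OF A] and mB = lin_contr_mem[OF B]
  note mAn = lin_contr_mem[OF lin_contr_funpow[OF A]] and mBn = lin_contr_mem[OF lin_contr_funpow[OF B]]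
  note mABn = lin_contr_mem[OF lin_contr_funpow[OF lin_contr_comp[OF A B]]]
  let ?g = "(B ^^ n) f"
  have "nrm (A (B (((\<lambda>f. A (B f)) ^^ n) f)) - A (B ((A ^^ n) ?g))) = 0"
    using lin_contr_null[OF lin_contr_comp[OF A B] _ _ Suc] mABn mAn mBn f by simp
  moreover have "nrm (B ((A ^^ n) ?g) - (A ^^ n) (B ?g)) = 0"
    by (rule funpow_commute) (use A mA mB mBn AB f null_sym in auto)
  then have "nrm (A (B ((A ^^ n) ?g)) - A ((A ^^ n) (B ?g))) = 0"
    using lin_contr_null[OF A] mAn mBn mB f by simp
  ultimately have "nrm (A (B (((\<lambda>f. A (B f)) ^^ n) f)) - A ((A ^^ n) (B ?g))) = 0"
    by (rule null_trans[rotated 3]) (use mA mB mAn mBn mABn f in auto)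
  then show ?case by simp
qed

lemma nrm_add_close:
  assumes "a \<in> H" "b \<in> H" "c \<in> H" "nrm (a - b) \<le> x" "nrm (b - c) \<le> y"
  shows "nrm (a - c) \<le> x + y"
  using nrm_triangle_diff[of a b c] assms by linarith

lemma null_if_small:
  assumes "u \<in> H" "\<And>e. 0 < e \<Longrightarrow> nrm u \<le> C * e"
  shows "nrm u = 0"
proof (rule ccontr)
  assume "nrm u \<noteq> 0"
  then have pos: "0 < nrm u" using nrm_nonneg[OF assms(1)] by linarith
  have C: "0 < C" using assms(2)[of 1] pos by simp
  show False using assms(2)[of "nrm u / (2 * C)"] pos C by simp
qed

end

context closed_form
begin

text \<open>Since \<open>(1 + a * L) (1 + b * L) = 1 + (a + b) * L + a * b * L\<^sup>2\<close>, the vector \<open>v = res a (res b u)\<close> solves the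
  equation of \<open>res (a + b)\<close> for the datum \<open>u - a * b * res a (res b (L\<^sup>2 u))\<close> in place of \<open>u\<close>. Below,
  \<open>g = L u\<close> and \<open>k = L\<^sup>2 u\<close>.\<close>

lemma res_add_close:
  assumes a: "0 < a" and b: "0 < b" and g: "gen u g" and k: "gen g k"
  shows "nrm (res a (res b u) - res (a + b) u) \<le> a * b * nrm k"
proof -
  note m = gen_mem[OF g] gen_mem[OF k]
  let ?p = "res b u" and ?q = "res b g"
  let ?v = "res a ?p" and ?y = "res a ?q"
  have ab: "0 < a + b" using a b by simp
  have pq: "gen ?p ?q" by (rule gen_res_commute[OF b g])
  have "nrm (?v - res (a + b) (?v + (a + b) *\<^sub>R ?y)) = 0"
    by (rule gen_imp_res[OF ab gen_res_commute[OF a pq]])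
  moreover have "nrm (res (a + b) (?v + (a + b) *\<^sub>R ?y) - res (a + b) u) \<le> nrm ((?v + (a + b) *\<^sub>R ?y) - u)"
    by (rule res_lipschitz[OF ab]) (use m a b in simp_all)
  moreover have "nrm ((?v + (a + b) *\<^sub>R ?y) - u) \<le> a * b * nrm k"
  proof -
    have 1: "nrm ((?v + (a + b) *\<^sub>R ?y) - (?p + b *\<^sub>R ?y)) \<le> 0"
      using null_sym[OF _ _ gen_res_expand[OF a pq]] m a b by (simp add: algebra_simps)
    have "(?p + b *\<^sub>R ?y) - (?p + b *\<^sub>R ?q) = b *\<^sub>R (?y - ?q)" by (simp add: algebra_simps)
    then have "nrm ((?p + b *\<^sub>R ?y) - (?p + b *\<^sub>R ?q)) = b * nrm (?y - ?q)" using nrm_scale m a b by simp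
    also have "\<dots> \<le> b * (a * nrm (res b k))"
      using res_gen_close[OF a gen_res_commute[OF b k]] b by simp
    also have "\<dots> \<le> b * (a * nrm k)"
      using lin_contr_le[OF res_lin_contr[OF b] m(4)] a b by simp
    finally have 2: "nrm ((?p + b *\<^sub>R ?y) - (?p + b *\<^sub>R ?q)) \<le> a * b * nrm k" by (simp add: mult_ac)
    have 3: "nrm ((?p + b *\<^sub>R ?q) - u) \<le> 0" using null_sym[OF _ _ gen_res_expand[OF b g]] m b by simp
    have "nrm ((?v + (a + b) *\<^sub>R ?y) - u) \<le> 0 + (a * b * nrm k + 0)"
      by (rule nrm_add_close[OF _ _ _ 1 nrm_add_close[OF _ _ _ 2 3]]) (use m a b in simp_all)
    then show ?thesis by simp
  qed
  ultimately show ?thesis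
    using nrm_triangle_diff[of ?v "res (a + b) (?v + (a + b) *\<^sub>R ?y)" "res (a + b) u"] m a b by simp
qed

lemma res_funpow_gen: "0 < h \<Longrightarrow> gen u g \<Longrightarrow> gen ((res h ^^ n) u) ((res h ^^ n) g)"
  by (induction n) (auto intro: gen_res_commute)

text \<open>The resolvents commute with \<open>L\<close>, so the second order bound is the same along the whole orbit of \<open>u\<close>
  under \<open>res (a + b)\<close>. For \<open>n\<close> steps of size proportional to \<open>1 / n\<close> the error is therefore \<open>O(1 / n)\<close>.\<close>

lemma res_funpow_add_close:
  assumes a: "0 < a" and b: "0 < b" and g: "gen u g" and k: "gen g k"
  shows "nrm (((\<lambda>f. res a (res b f)) ^^ n) u - (res (a + b) ^^ n) u) \<le> real n * (a * b * nrm k)"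
proof (rule funpow_telescoping)
  have ab: "0 < a + b" using a b by simp
  show "lin_contr (\<lambda>f. res a (res b f))" using lin_contr_comp res_lin_contr a b by blast
  fix j
  let ?J = "res (a + b) ^^ j"
  show "?J u \<in> H" using res_funpow_gen[OF ab g] gen_mem by blast
  have "nrm (?J k) \<le> nrm k"
    using lin_contr_le[OF lin_contr_funpow[OF res_lin_contr[OF ab]]] gen_mem[OF k] by simp
  then have "a * b * nrm (?J k) \<le> a * b * nrm k" using a b by (intro mult_left_mono) auto
  then show "nrm (res a (res b (?J u)) - res (a + b) (?J u)) \<le> a * b * nrm k"
    using res_add_close[OF a b res_funpow_gen[OF ab g] res_funpow_gen[OF ab k], of j] by linarith
qed

text \<open>The implicit Euler scheme for the equation \<open>u' = - L u\<close>, with \<open>2 ^ k\<close> steps up to time \<open>t\<close>.\<close>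

definition approx :: "nat \<Rightarrow> real \<Rightarrow> 'v \<Rightarrow> 'v" where
  "approx k t = res (t / 2 ^ k) ^^ (2 ^ k)"

lemma approx_lin_contr: "0 < t \<Longrightarrow> lin_contr (approx k t)"
  unfolding approx_def by (intro lin_contr_funpow res_lin_contr) simp

lemma approx_mem [simp]: "0 < t \<Longrightarrow> f \<in> H \<Longrightarrow> approx k t f \<in> H"
  using lin_contr_mem approx_lin_contr by blast

lemma approx_Suc_close:
  assumes t: "0 < t" and g: "gen u g" and k: "gen g k"
  shows "nrm (approx (Suc i) t u - approx i t u) \<le> t\<^sup>2 * nrm k / 2 ^ i"
proof -
  let ?c = "t / 2 ^ Suc i"
  have c: "0 < ?c" "?c + ?c = t / 2 ^ i" using t by (auto simp: field_simps)
  have "(\<lambda>f. res ?c (res ?c f)) = res ?c ^^ 2" by (simp add: numeral_2_eq_2 comp_def)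
  then have "(\<lambda>f. res ?c (res ?c f)) ^^ (2 ^ i) = approx (Suc i) t"
    by (simp add: approx_def funpow_mult)
  moreover have "res (?c + ?c) ^^ (2 ^ i) = approx i t" unfolding c(2) approx_def by simp
  ultimately have "nrm (approx (Suc i) t u - approx i t u) \<le> real (2 ^ i) * (?c * ?c * nrm k)"
    using res_funpow_add_close[OF c(1) c(1) g k, of "2 ^ i"] by simp
  also have "\<dots> = t\<^sup>2 * nrm k / 2 ^ i / 4" by (simp add: field_simps power2_eq_square)
  also have "\<dots> \<le> t\<^sup>2 * nrm k / 2 ^ i"
  proof -
    have "0 \<le> t\<^sup>2 * nrm k / 2 ^ i" using gen_mem[OF k] by simp
    moreover have "x / 4 \<le> x" if "0 \<le> x" for x :: real using that by simp
    ultimately show ?thesis by blast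
  qed
  finally show ?thesis .
qed

lemma approx_Cauchy_gen:
  assumes t: "0 < t" and g: "gen u g" and k: "gen g k"
  shows "nrm (approx (i + j) t u - approx i t u) \<le> 2 * t\<^sup>2 * nrm k / 2 ^ i - 2 * t\<^sup>2 * nrm k / 2 ^ (i + j)"
proof (induction j)
  case 0
  then show ?case using gen_mem[OF g] t by simp
next
  case (Suc j)
  have "nrm (approx (i + Suc j) t u - approx i t u)
      \<le> t\<^sup>2 * nrm k / 2 ^ (i + j) + (2 * t\<^sup>2 * nrm k / 2 ^ i - 2 * t\<^sup>2 * nrm k / 2 ^ (i + j))"
    by (rule nrm_add_close[OF _ _ _ _ Suc]) (use approx_Suc_close[OF assms, of "i + j"] gen_mem[OF g] t in auto)
  then show ?case by (simp add: field_simps)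
qed

text \<open>On the domain of \<open>L\<^sup>2\<close> consecutive approximations differ by \<open>O(1 / 2 ^ k)\<close>; this domain is dense and the
  approximations are contractions.\<close>

lemma approx_convergent:
  assumes t: "0 < t" and f: "f \<in> H"
  shows "\<exists>g\<in>H. (\<lambda>k. nrm (approx k t f - g)) \<longlonglongrightarrow> 0"
proof (rule complete)
  fix e :: real assume e: "0 < e"
  obtain u g k where u: "gen u g" "gen g k" "nrm (f - u) < e / 8" using gen2_dense[OF f, of "e/8"] e by auto
  note m = gen_mem[OF u(1)] gen_mem[OF u(2)]
  let ?C = "2 * t\<^sup>2 * nrm k"
  have C: "0 \<le> ?C" using m by simp
  obtain N :: nat where "?C / (e/8) < 2 ^ N" using real_arch_pow[of 2 "?C / (e/8)"] by auto
  then have N: "?C / 2 ^ N < e / 8" using e by (simp add: field_simps)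
  have close: "nrm (approx (N + j) t f - approx N t f) < 3 * e / 8" for j
  proof -
    have 1: "nrm (approx i t f - approx i t u) \<le> e / 8" for i
      using order_trans[OF lin_contr_lipschitz[OF approx_lin_contr[OF t] f m(1)] less_imp_le[OF u(3)]] .
    have "nrm (approx i t u - approx i t f) \<le> e / 8" for i
      using 1[of i] nrm_minus_commute[of "approx i t u" "approx i t f"] f m t by simp
    moreover have "0 \<le> ?C / 2 ^ (N + j)" using C by simp
    then have "nrm (approx (N + j) t u - approx N t u) \<le> ?C / 2 ^ N"
      using approx_Cauchy_gen[OF t u(1,2), of N j] by linarith
    ultimately have "nrm (approx (N + j) t f - approx N t f) \<le> e / 8 + (?C / 2 ^ N + e / 8)"
      by (intro nrm_add_close[OF _ _ _ 1 nrm_add_close]) (use f m t in auto)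
    then show ?thesis using N by linarith
  qed
  have "nrm (approx i t f - approx j t f) < e" if "i \<ge> N" "j \<ge> N" for i j
  proof -
    have "nrm (approx i t f - approx N t f) < 3 * e / 8" "nrm (approx j t f - approx N t f) < 3 * e / 8"
      using close[of "i - N"] close[of "j - N"] that by auto
    then show ?thesis
      using nrm_triangle_diff[of "approx i t f" "approx N t f" "approx j t f"]
        nrm_minus_commute[of "approx N t f" "approx j t f"] f t e by simp
  qed
  then show "\<exists>N. \<forall>i\<ge>N. \<forall>j\<ge>N. nrm (approx i t f - approx j t f) < e" by blast
qed (use t f in simp)

definition sg :: "real \<Rightarrow> 'v \<Rightarrow> 'v" where
  "sg t f = (SOME g. g \<in> H \<and> (\<lambda>k. nrm (approx k t f - g)) \<longlonglongrightarrow> 0)"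

lemma sg_props:
  assumes "0 < t" "f \<in> H"
  shows sg_mem [simp]: "sg t f \<in> H" and sg_limit: "(\<lambda>k. nrm (approx k t f - sg t f)) \<longlonglongrightarrow> 0"
proof -
  have "\<exists>g. g \<in> H \<and> (\<lambda>k. nrm (approx k t f - g)) \<longlonglongrightarrow> 0" using approx_convergent[OF assms] by blast
  from someI_ex[OF this] show "sg t f \<in> H" "(\<lambda>k. nrm (approx k t f - sg t f)) \<longlonglongrightarrow> 0"
    unfolding sg_def by blast+
qed

lemma sg_lin_contr: "0 < t \<Longrightarrow> lin_contr (sg t)"
  by (rule lin_contr_limit[of "\<lambda>k. approx k t"]) (simp_all add: approx_lin_contr sg_limit)

lemmas sg_lipschitz = lin_contr_lipschitz[OF sg_lin_contr]

lemma res_funpow_sym: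
  assumes h: "0 < h"
  shows "f \<in> H \<Longrightarrow> g \<in> H \<Longrightarrow> ip ((res h ^^ n) f) g = ip f ((res h ^^ n) g)"
proof (induction n arbitrary: f g)
  case (Suc n)
  note m = lin_contr_mem[OF lin_contr_funpow[OF res_lin_contr[OF h]]]
  have "ip ((res h ^^ Suc n) f) g = ip ((res h ^^ n) f) (res h g)"
    using res_sym[OF h] m Suc.prems by simp
  also have "\<dots> = ip f ((res h ^^ n) (res h g))" using Suc h by simp
  finally show ?case by (simp add: funpow_swap1)
qed simp

lemma sg_sym:
  assumes t: "0 < t" and f: "f \<in> H" and g: "g \<in> H"
  shows "ip (sg t f) g = ip f (sg t g)"
proof -
  have *: "(\<lambda>k. ip (approx k t f) g) \<longlonglongrightarrow> ip (sg t f) g" if "f \<in> H" "g \<in> H" for f g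
    using ip_tendsto_left[OF _ _ _ sg_limit] t that by simp
  have "ip (approx k t f) g = ip (approx k t g) f" for k
    unfolding approx_def using res_funpow_sym[of "t / 2 ^ k" f g] ip_sym t f g approx_mem[of t g k]
    by (simp add: approx_def)
  then have "(\<lambda>k. ip (approx k t f) g) \<longlonglongrightarrow> ip (sg t g) f" using *[OF g f] by simp
  then have "ip (sg t f) g = ip (sg t g) f" using *[OF f g] LIMSEQ_unique by blast
  then show ?thesis using ip_sym t f g by simp
qed

text \<open>Whatever commutes with \<open>L\<close> commutes with its resolvents.\<close>

lemma commute_res:
  assumes mem: "\<And>f. f \<in> H \<Longrightarrow> A f \<in> H"
    and add: "\<And>f g. f \<in> H \<Longrightarrow> g \<in> H \<Longrightarrow> nrm (A (f + g) - (A f + A g)) = 0"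
    and scale: "\<And>f c. f \<in> H \<Longrightarrow> nrm (A (c *\<^sub>R f) - c *\<^sub>R A f) = 0"
    and gen: "\<And>u g. gen u g \<Longrightarrow> gen (A u) (A g)"
    and h: "0 < h" and f: "f \<in> H"
  shows "nrm (A (res h f) - res h (A f)) = 0"
proof -
  let ?p = "res h f"
  have "nrm (A ((1/h) *\<^sub>R (f - ?p)) - (1/h) *\<^sub>R A (f - ?p)) = 0" using scale f h by simp
  moreover have "nrm (A (f - ?p) - (A f - A ?p)) = 0" by (rule linear_diff_null[OF mem add]) (use f h in auto)
  then have "nrm ((1/h) *\<^sub>R (A (f - ?p) - (A f - A ?p))) = 0" using nrm_scale mem f h by simp
  then have "nrm ((1/h) *\<^sub>R A (f - ?p) - (1/h) *\<^sub>R (A f - A ?p)) = 0" by (simp add: algebra_simps)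
  ultimately have "nrm (A ((1/h) *\<^sub>R (f - ?p)) - (1/h) *\<^sub>R (A f - A ?p)) = 0"
    by (rule null_trans[rotated 3]) (use mem f h in auto)
  then have "gen (A ?p) ((1/h) *\<^sub>R (A f - A ?p))"
    using gen_cong[OF gen[OF gen_res[OF h f]]] mem f h by simp
  from gen_imp_res[OF h this] show ?thesis using h by simp
qed

lemma res_commute:
  assumes "0 < a" "0 < b" "f \<in> H"
  shows "nrm (res a (res b f) - res b (res a f)) = 0"
  by (rule commute_res) (use assms res_lin_contr lin_contr_def gen_res_commute in auto)

text \<open>The schemes for \<open>s + t\<close> and for \<open>s\<close> after \<open>t\<close> use \<open>res (a + b)\<close> and \<open>res a \<circ> res b\<close> in each step, with
  \<open>a = s / 2 ^ i\<close> and \<open>b = t / 2 ^ i\<close>.\<close>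

lemma sg_add_gen:
  assumes s: "0 < s" and t: "0 < t" and g: "gen u g" and k: "gen g k"
  shows "nrm (sg (s + t) u - sg s (sg t u)) = 0"
proof (rule nrm_limit_unique[OF _ _ _ _ sg_limit])
  note m = gen_mem[OF g]
  let ?F = "\<lambda>i. approx i s (approx i t u)"
  show "(\<lambda>i. nrm (approx i (s + t) u - sg s (sg t u))) \<longlonglongrightarrow> 0"
  proof (rule tendsto_sandwich[of "\<lambda>_. 0"])
    have lim: "(\<lambda>i. s * t * nrm k * (1 / 2) ^ i) \<longlonglongrightarrow> s * t * nrm k * 0"
      by (intro tendsto_intros LIMSEQ_power_zero) simp
    show "(\<lambda>i. s * t * nrm k * (1 / 2) ^ i + (nrm (approx i t u - sg t u) + nrm (approx i s (sg t u) - sg s (sg t u)))) \<longlonglongrightarrow> 0"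
      using tendsto_add[OF lim tendsto_add[OF sg_limit[OF t m(1)] sg_limit[OF s sg_mem[OF t m(1)]]]] by simp
    have 1: "nrm (approx i (s + t) u - ?F i) \<le> s * t * nrm k * (1 / 2) ^ i" for i
    proof -
      let ?a = "s / 2 ^ i" and ?b = "t / 2 ^ i"
      have ab: "0 < ?a" "0 < ?b" using s t by auto
      let ?P = "((\<lambda>f. res ?a (res ?b f)) ^^ (2 ^ i)) u"
      have P: "?P \<in> H"
        using lin_contr_mem[OF lin_contr_funpow[OF lin_contr_comp[OF res_lin_contr[OF ab(1)] res_lin_contr[OF ab(2)]]]] m by blast
      have "nrm (?P - ?F i) = 0"
        unfolding approx_def by (rule funpow_comp_commute) (use ab m res_lin_contr res_commute in auto)
      then have 1: "nrm (?P - ?F i) \<le> 0" by simp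
      have "?a + ?b = (s + t) / 2 ^ i" by (simp add: add_divide_distrib)
      then have "nrm (?P - approx i (s + t) u) \<le> real (2 ^ i) * (?a * ?b * nrm k)"
        using res_funpow_add_close[OF ab g k, of "2 ^ i"] by (simp add: approx_def)
      also have "\<dots> = s * t * nrm k * (1 / 2) ^ i"
        by (simp add: field_simps)
      finally have 2: "nrm (approx i (s + t) u - ?P) \<le> s * t * nrm k * (1 / 2) ^ i"
        using nrm_minus_commute[of ?P "approx i (s + t) u"] P m s t by simp
      show ?thesis using nrm_add_close[OF _ P _ 2 1] m s t by simp
    qed
    have 2: "nrm (?F i - approx i s (sg t u)) \<le> nrm (approx i t u - sg t u)" for i
      using lin_contr_lipschitz[OF approx_lin_contr[OF s]] m t by simp
    show "\<forall>\<^sub>F i in sequentially. nrm (approx i (s + t) u - sg s (sg t u)) \<le>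
        s * t * nrm k * (1 / 2) ^ i + (nrm (approx i t u - sg t u) + nrm (approx i s (sg t u) - sg s (sg t u)))"
      by (intro always_eventually allI nrm_add_close[OF _ _ _ 1 nrm_add_close[OF _ _ _ 2 order_refl]])
        (use m s t in auto)
  qed (use m s t in \<open>auto intro: always_eventually\<close>)
qed (use gen_mem[OF g] s t in auto)

lemma lin_contr_eq_dense:
  assumes A: "lin_contr A" and B: "lin_contr B"
    and dense: "\<And>u g k. gen u g \<Longrightarrow> gen g k \<Longrightarrow> nrm (A u - B u) = 0" and f: "f \<in> H"
  shows "nrm (A f - B f) = 0"
proof (rule null_if_small)
  note m = lin_contr_mem[OF A] lin_contr_mem[OF B]
  show "A f - B f \<in> H" using m f by simp
  fix e :: real assume e: "0 < e"
  obtain u g k where u: "gen u g" "gen g k" "nrm (f - u) < e" using gen2_dense[OF f e] by auto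
  note uH = gen_mem(1)[OF u(1)]
  have 1: "nrm (A f - A u) \<le> e" using lin_contr_lipschitz[OF A f uH] u(3) by simp
  have 2: "nrm (B u - B f) \<le> e"
    using lin_contr_lipschitz[OF B uH f] u(3) nrm_minus_commute[OF f uH] by simp
  have "nrm (A f - B f) \<le> e + (0 + e)"
    by (rule nrm_add_close[OF _ _ _ 1 nrm_add_close[OF _ _ _ _ 2]]) (use dense[OF u(1,2)] m f uH in auto)
  then show "nrm (A f - B f) \<le> 2 * e" by simp
qed

lemma sg_add:
  assumes "0 < s" "0 < t" "f \<in> H"
  shows "nrm (sg (s + t) f - sg s (sg t f)) = 0"
  by (rule lin_contr_eq_dense) (use assms sg_lin_contr lin_contr_comp sg_add_gen in auto)

lemma res_funpow_close:
  assumes h: "0 < h" and g: "gen u g"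
  shows "nrm ((res h ^^ n) u - u) \<le> real n * h * nrm g"
proof -
  have "nrm ((res h ^^ n) u - ((\<lambda>x. x) ^^ n) u) \<le> real n * (h * nrm g)"
  proof (rule funpow_telescoping[OF res_lin_contr[OF h]])
    fix j
    have [simp]: "((\<lambda>x. x) ^^ j) u = u" by (induction j) auto
    show "((\<lambda>x. x) ^^ j) u \<in> H" using gen_mem[OF g] by simp
    show "nrm (res h (((\<lambda>x. x) ^^ j) u) - ((\<lambda>x. x) ^^ j) u) \<le> h * nrm g" using res_gen_close[OF h g] by simp
  qed
  moreover have "((\<lambda>x. x) ^^ n) u = u" by (induction n) auto
  ultimately show ?thesis by (simp add: mult.assoc)
qed

lemma sg_gen_close:
  assumes t: "0 < t" and g: "gen u g"
  shows "nrm (sg t u - u) \<le> t * nrm g"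
proof -
  note m = gen_mem[OF g]
  have "nrm (approx k t u - u) \<le> t * nrm g" for k
    unfolding approx_def using res_funpow_close[of "t / 2 ^ k" u g "2 ^ k"] t g by simp
  moreover have "(\<lambda>k. nrm (approx k t u - u)) \<longlonglongrightarrow> nrm (sg t u - u)"
    using nrm_tendsto[of "\<lambda>k. approx k t u - u" "sg t u - u"] sg_limit[OF t m(1)] m t by simp
  ultimately show ?thesis using LIMSEQ_le_const2 by blast
qed

lemma sg_tendsto:
  assumes f: "f \<in> H"
  shows "((\<lambda>t. nrm (sg t f - f)) \<longlongrightarrow> 0) (at_right 0)"
proof (rule tendstoI)
  fix e :: real assume e: "0 < e"
  obtain u g where u: "gen u g" "nrm (f - u) < e / 4" using gen_dense[OF f, of "e/4"] e by auto
  note m = gen_mem[OF u(1)]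
  define d where "d = e / 4 / (nrm g + 1)"
  have d: "0 < d" using e m by (auto simp: d_def intro!: divide_pos_pos add_nonneg_pos)
  have "nrm (sg t f - f) < e" if t: "0 < t" "t < d" for t
  proof -
    have "0 < nrm g + 1" using nrm_nonneg[OF m(2)] by linarith
    then have "t * (nrm g + 1) < e / 4" using t(2) unfolding d_def by (simp only: pos_less_divide_eq)
    then have "t * nrm g \<le> e / 4" using t by (simp add: algebra_simps)
    then have 1: "nrm (sg t u - u) \<le> e / 4" using sg_gen_close[OF t(1) u(1)] by linarith
    have 2: "nrm (sg t f - sg t u) \<le> e / 4" using sg_lipschitz[OF t(1) f m(1)] u(2) by simp
    have 3: "nrm (u - f) \<le> e / 4" using u(2) nrm_minus_commute f m by simp
    have "nrm (sg t f - f) \<le> e / 4 + (e / 4 + e / 4)"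
      by (rule nrm_add_close[OF _ _ _ 2 nrm_add_close[OF _ _ _ 1 3]]) (use f m t in auto)
    then show ?thesis using e by simp
  qed
  moreover have "0 \<le> nrm (sg t f - f)" if "0 < t" for t using that f by simp
  ultimately show "\<forall>\<^sub>F t in at_right 0. dist (nrm (sg t f - f)) 0 < e"
    unfolding eventually_at_right_field using d by (auto intro!: exI[of _ d])
qed

text \<open>The difference quotient of the discrete semigroup at \<open>u\<close> is an average of \<open>res h ^^ j\<close> applied to
  \<open>L u\<close>, and these vectors are uniformly close to \<open>L u\<close> for small times.\<close>

lemma res_funpow_quotient:
  assumes h: "0 < h" and g: "gen u g" and w: "gen w k" and t: "real n * h \<le> t"
  shows "nrm (u - (res h ^^ n) u - (real n * h) *\<^sub>R g) \<le> real n * h * (2 * nrm (g - w) + t * nrm k)"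
  using t
proof (induction n)
  case 0
  then show ?case using gen_mem[OF g] by simp
next
  case (Suc n)
  note m = gen_mem[OF g] gen_mem[OF w]
  note A = res_lin_contr[OF h] and An = lin_contr_funpow[OF res_lin_contr[OF h]]
  note mn = lin_contr_mem[OF An]
  let ?J = "res h ^^ n" and ?J1 = "res h ^^ Suc n"
  let ?c = "2 * nrm (g - w) + t * nrm k"
  have n: "real n * h \<le> t" using Suc.prems h by (simp add: algebra_simps)
  have "nrm (?J1 g - g) \<le> nrm (g - w) + (t * nrm k + nrm (g - w))"
  proof (rule nrm_add_close[of _ "?J1 w"], goal_cases)
    case 4 show ?case using lin_contr_lipschitz[OF An] m by blast
  next
    case 5 show ?case
    proof (rule nrm_add_close[of _ w], goal_cases)
      case 4
      have "real (Suc n) * h * nrm k \<le> t * nrm k" using Suc.prems m by (intro mult_right_mono) auto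
      then show ?case using res_funpow_close[OF h w, of "Suc n"] by linarith
    qed (use m mn[of w "Suc n"] nrm_minus_commute[of w g] in auto)
  qed (use m mn[of _ "Suc n"] mn A in auto)
  then have J1: "nrm (?J1 g - g) \<le> ?c" by simp
  have "nrm (?J u - (res h (?J u) + h *\<^sub>R res h (?J g))) = 0"
    using gen_res_expand[OF h res_funpow_gen[OF h g]] .
  moreover have "?J u - (res h (?J u) + h *\<^sub>R res h (?J g)) = (?J u - ?J1 u - h *\<^sub>R g) - h *\<^sub>R (?J1 g - g)"
    by (simp add: algebra_simps)
  ultimately have "nrm ((?J u - ?J1 u - h *\<^sub>R g) - h *\<^sub>R (?J1 g - g)) = 0" by simp
  then have "nrm (?J u - ?J1 u - h *\<^sub>R g) \<le> nrm (h *\<^sub>R (?J1 g - g))"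
    using nrm_triangle_sub[of "?J u - ?J1 u - h *\<^sub>R g" "h *\<^sub>R (?J1 g - g)"] m mn mn[of _ "Suc n"] by simp
  also have "\<dots> \<le> h * ?c" using nrm_scale J1 m mn[of _ "Suc n"] h by simp
  finally have 1: "nrm (?J u - ?J1 u - h *\<^sub>R g) \<le> h * ?c" .
  have "u - ?J1 u - (real (Suc n) * h) *\<^sub>R g = (u - ?J u - (real n * h) *\<^sub>R g) + (?J u - ?J1 u - h *\<^sub>R g)"
    by (simp add: algebra_simps)
  then have "nrm (u - ?J1 u - (real (Suc n) * h) *\<^sub>R g)
      = nrm ((u - ?J u - (real n * h) *\<^sub>R g) + (?J u - ?J1 u - h *\<^sub>R g))" by (rule arg_cong)
  also have "\<dots> \<le> nrm (u - ?J u - (real n * h) *\<^sub>R g) + nrm (?J u - ?J1 u - h *\<^sub>R g)"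
    by (rule nrm_triangle) (use m mn mn[of _ "Suc n"] in simp_all)
  also have "\<dots> \<le> real n * h * ?c + h * ?c" using Suc.IH[OF n] 1 by simp
  finally show ?case by (simp add: algebra_simps)
qed

lemma sg_quotient_close:
  assumes t: "0 < t" and g: "gen u g" and w: "gen w k"
  shows "nrm ((1 / t) *\<^sub>R (u - sg t u) - g) \<le> 2 * nrm (g - w) + t * nrm k"
proof -
  note m = gen_mem[OF g] gen_mem[OF w]
  have "nrm (u - approx i t u - t *\<^sub>R g) \<le> t * (2 * nrm (g - w) + t * nrm k)" for i
    using res_funpow_quotient[of "t / 2 ^ i" u g w k "2 ^ i" t] t g w by (simp add: approx_def)
  moreover have "(\<lambda>i. nrm (u - approx i t u - t *\<^sub>R g)) \<longlonglongrightarrow> nrm (u - sg t u - t *\<^sub>R g)"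
    using nrm_tendsto[of "\<lambda>i. u - approx i t u - t *\<^sub>R g" "u - sg t u - t *\<^sub>R g"] sg_limit[OF t m(1)] m t
      nrm_minus_commute[of "sg t u"] by simp
  ultimately have *: "nrm (u - sg t u - t *\<^sub>R g) \<le> t * (2 * nrm (g - w) + t * nrm k)"
    using LIMSEQ_le_const2 by blast
  have "(1 / t) *\<^sub>R (u - sg t u) - g = (1 / t) *\<^sub>R (u - sg t u - t *\<^sub>R g)" using t by (simp add: algebra_simps)
  then have "nrm ((1 / t) *\<^sub>R (u - sg t u) - g) = (1 / t) * nrm (u - sg t u - t *\<^sub>R g)"
    using nrm_scale m t by simp
  also have "\<dots> \<le> (1 / t) * (t * (2 * nrm (g - w) + t * nrm k))" using * t by (intro mult_left_mono) auto
  finally show ?thesis using t by simp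
qed

lemma gen_imp_sg_derivative:
  assumes g: "gen u g"
  shows "((\<lambda>t. nrm ((1 / t) *\<^sub>R (u - sg t u) - g)) \<longlongrightarrow> 0) (at_right 0)"
proof (rule tendstoI)
  note m = gen_mem[OF g]
  fix e :: real assume e: "0 < e"
  obtain w k where w: "gen w k" "nrm (g - w) < e / 4" using gen_dense[OF m(2), of "e/4"] e by auto
  note mw = gen_mem[OF w(1)]
  define d where "d = e / 4 / (nrm k + 1)"
  have d: "0 < d" using e mw by (auto simp: d_def intro!: divide_pos_pos add_nonneg_pos)
  have "nrm ((1 / t) *\<^sub>R (u - sg t u) - g) < e" if t: "0 < t" "t < d" for t
  proof -
    have "0 < nrm k + 1" using nrm_nonneg[OF mw(2)] by linarith
    then have "t * (nrm k + 1) < e / 4" using t(2) unfolding d_def by (simp only: pos_less_divide_eq)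
    then have "t * nrm k \<le> e / 4" using t by (simp add: algebra_simps)
    then show ?thesis using sg_quotient_close[OF t(1) g w(1)] w(2) e by linarith
  qed
  moreover have "0 \<le> nrm ((1 / t) *\<^sub>R (u - sg t u) - g)" if "0 < t" for t using that m by simp
  ultimately show "\<forall>\<^sub>F t in at_right 0. dist (nrm ((1 / t) *\<^sub>R (u - sg t u) - g)) 0 < e"
    unfolding eventually_at_right_field using d by (auto intro!: exI[of _ d])
qed

lemma ip_tendsto_right_0:
  assumes "\<forall>\<^sub>F t in at_right 0. U t \<in> H" "u \<in> H" "w \<in> H" "((\<lambda>t. nrm (U t - u)) \<longlongrightarrow> 0) (at_right (0::real))"
  shows "((\<lambda>t. ip (U t) w) \<longlongrightarrow> ip u w) (at_right 0)"
proof (rule LIM_zero_cancel, rule Lim_null_comparison)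
  show "\<forall>\<^sub>F t in at_right 0. norm (ip (U t) w - ip u w) \<le> nrm (U t - u) * nrm w"
    using assms(1)
  proof eventually_elim
    case (elim t)
    then show ?case using Cauchy_Schwarz[of "U t - u" w] assms by (simp add: ip_simps)
  qed
  show "((\<lambda>n. nrm (U n - u) * nrm w) \<longlongrightarrow> 0) (at_right 0)"
    using tendsto_mult_left_zero[OF assms(4)] by simp
qed

text \<open>Testing with \<open>res 1 w\<close>, which lies in the domain of \<open>L\<close>, and moving the difference quotient to the other
  side gives \<open>ip f w = ip (f + g) (res 1 w)\<close> for all \<open>w\<close>, that is, \<open>f = res 1 (f + g)\<close>.\<close>

lemma sg_derivative_imp_gen:
  assumes f: "f \<in> H" and g: "g \<in> H"
    and lim: "((\<lambda>t. nrm ((1 / t) *\<^sub>R (f - sg t f) - g)) \<longlongrightarrow> 0) (at_right 0)"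
  shows "gen f g"
proof -
  have pos: "\<forall>\<^sub>F t in at_right (0::real). 0 < t" by (simp add: eventually_at_right_less)
  have key: "ip f w = ip (res 1 (f + g)) w" if w: "w \<in> H" for w
  proof -
    let ?v = "res 1 w"
    have v: "gen ?v (w - ?v)" using gen_res[of 1 w] w by simp
    have lim1: "((\<lambda>t. ip ((1 / t) *\<^sub>R (f - sg t f)) ?v) \<longlongrightarrow> ip g ?v) (at_right 0)"
      by (rule ip_tendsto_right_0[OF _ _ _ lim]) (use f g w in \<open>auto intro!: eventually_mono[OF pos]\<close>)
    have lim2: "((\<lambda>t. ip ((1 / t) *\<^sub>R (?v - sg t ?v)) f) \<longlongrightarrow> ip (w - ?v) f) (at_right 0)"
      by (rule ip_tendsto_right_0[OF _ _ _ gen_imp_sg_derivative[OF v]])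
        (use f g w in \<open>auto intro!: eventually_mono[OF pos]\<close>)
    have eq: "\<forall>\<^sub>F t in at_right 0. ip ((1 / t) *\<^sub>R (f - sg t f)) ?v = ip ((1 / t) *\<^sub>R (?v - sg t ?v)) f"
      using pos
    proof eventually_elim
      case (elim t)
      then show ?case using sg_sym[OF elim f, of ?v] ip_sym[of f ?v] ip_sym[of "sg t ?v" f] f w
        by (simp add: ip_simps)
    qed
    have "ip g ?v = ip (w - ?v) f"
      using tendsto_unique[OF trivial_limit_at_right_real iffD1[OF tendsto_cong[OF eq] lim1] lim2] .
    then have "ip f w = ip (f + g) ?v"
      using f g w ip_sym[of f ?v] ip_sym[of f w] by (simp add: ip_simps)
    then show ?thesis using res_sym[of 1 "f + g" w] f g w by simp
  qed
  let ?r = "res 1 (f + g)"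
  have "ip (f - ?r) (f - ?r) = 0" using key[of "f - ?r"] f g by (simp add: ip_simps)
  then have 0: "nrm (f - ?r) = 0" by (simp add: nrm_def)
  have "gen ?r (f + g - ?r)" using gen_res[of 1 "f + g"] f g by simp
  then show ?thesis
    by (rule gen_cong) (use f g 0 null_sym in \<open>auto simp: algebra_simps\<close>)
qed

section \<open>Uniqueness of the semigroup\<close>

definition semigroup_of_form :: "(real \<Rightarrow> 'v \<Rightarrow> 'v) \<Rightarrow> bool" where
  "semigroup_of_form T \<longleftrightarrow>
     (\<forall>t>0. \<forall>f\<in>H. T t f \<in> H) \<and>
     (\<forall>t>0. \<forall>f\<in>H. \<forall>g\<in>H. nrm (T t (f + g) - (T t f + T t g)) = 0) \<and>
     (\<forall>t>0. \<forall>f\<in>H. \<forall>c. nrm (T t (c *\<^sub>R f) - c *\<^sub>R T t f) = 0) \<and>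
     (\<forall>t>0. \<exists>C. \<forall>f\<in>H. nrm (T t f) \<le> C * nrm f) \<and>
     (\<forall>t>0. \<forall>f\<in>H. \<forall>g\<in>H. ip (T t f) g = ip f (T t g)) \<and>
     (\<forall>s>0. \<forall>t>0. \<forall>f\<in>H. nrm (T (s + t) f - T s (T t f)) = 0) \<and>
     (\<forall>f\<in>H. ((\<lambda>t. nrm (T t f - f)) \<longlongrightarrow> 0) (at_right 0)) \<and>
     (\<forall>f\<in>H. \<forall>g\<in>H. gen f g \<longleftrightarrow> ((\<lambda>t. nrm ((1 / t) *\<^sub>R (f - T t f) - g)) \<longlongrightarrow> 0) (at_right 0))"

lemma semigroup_of_formD:
  assumes "semigroup_of_form T"
  shows semigroup_mem: "0 < t \<Longrightarrow> f \<in> H \<Longrightarrow> T t f \<in> H"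
    and semigroup_plus: "0 < t \<Longrightarrow> f \<in> H \<Longrightarrow> g \<in> H \<Longrightarrow> nrm (T t (f + g) - (T t f + T t g)) = 0"
    and semigroup_scale: "0 < t \<Longrightarrow> f \<in> H \<Longrightarrow> nrm (T t (c *\<^sub>R f) - c *\<^sub>R T t f) = 0"
    and semigroup_bounded: "0 < t \<Longrightarrow> \<exists>C. \<forall>f\<in>H. nrm (T t f) \<le> C * nrm f"
    and semigroup_sym: "0 < t \<Longrightarrow> f \<in> H \<Longrightarrow> g \<in> H \<Longrightarrow> ip (T t f) g = ip f (T t g)"
    and semigroup_add: "0 < s \<Longrightarrow> 0 < t \<Longrightarrow> f \<in> H \<Longrightarrow> nrm (T (s + t) f - T s (T t f)) = 0"
    and semigroup_gen: "f \<in> H \<Longrightarrow> g \<in> H \<Longrightarrow>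
      gen f g \<longleftrightarrow> ((\<lambda>t. nrm ((1 / t) *\<^sub>R (f - T t f) - g)) \<longlongrightarrow> 0) (at_right 0)"
  using assms unfolding semigroup_of_form_def by simp_all

text \<open>A symmetric semigroup satisfies \<open>nrm (T (t/2) f)\<^sup>2 = ip (T t f) f\<close>, so a bound \<open>C\<close> of \<open>T t\<close> gives the
  bound \<open>C powr (1 / 2 ^ k)\<close> of \<open>T (t / 2 ^ k)\<close>.\<close>

lemma semigroup_dyadic_bound:
  assumes T: "semigroup_of_form T" and t: "0 < t"
    and C: "1 \<le> C" "\<And>f. f \<in> H \<Longrightarrow> nrm (T t f) \<le> C * nrm f"
  shows "\<exists>c\<ge>1. c ^ (2 ^ k) = C \<and> (\<forall>f\<in>H. nrm (T (t / 2 ^ k) f) \<le> c * nrm f)"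
proof (induction k)
  case 0
  then show ?case using C by (intro exI[of _ C]) auto
next
  case (Suc k)
  then obtain c where c: "c \<ge> 1" "c ^ (2 ^ k) = C" "\<And>f. f \<in> H \<Longrightarrow> nrm (T (t / 2 ^ k) f) \<le> c * nrm f" by blast
  let ?r = "t / 2 ^ Suc k"
  have r: "0 < ?r" "?r + ?r = t / 2 ^ k" using t by (auto simp: field_simps)
  note mem = semigroup_mem[OF T]
  show ?case
  proof (intro exI[of _ "sqrt c"] conjI ballI)
    show "1 \<le> sqrt c" using c by simp
    show "sqrt c ^ (2 ^ Suc k) = C" using c by (simp add: power_mult)
    fix f assume f: "f \<in> H"
    show "nrm (T ?r f) \<le> sqrt c * nrm f"
    proof (rule power2_le_imp_le)
      have "(nrm (T ?r f))\<^sup>2 = ip (T ?r (T ?r f)) f"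
        using semigroup_sym[OF T r(1) mem[OF r(1) f] f] mem[OF r(1)] f by (simp add: nrm_square)
      also have "\<dots> = ip (T (t / 2 ^ k) f) f"
        using ip_null_left[OF _ _ f null_sym[OF _ _ semigroup_add[OF T r(1) r(1) f]]] mem r t f by simp
      also have "\<dots> \<le> nrm (T (t / 2 ^ k) f) * nrm f" using Cauchy_Schwarz[of "T (t / 2 ^ k) f" f] mem t f by simp
      also have "\<dots> \<le> c * nrm f * nrm f" using c(3)[OF f] f by (intro mult_right_mono) auto
      also have "\<dots> = (sqrt c * nrm f)\<^sup>2"
        using c(1) by (simp add: power_mult_distrib power2_eq_square[of "nrm f"])
      finally show "(nrm (T ?r f))\<^sup>2 \<le> (sqrt c * nrm f)\<^sup>2" .
    qed (use c f in auto)
  qed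
qed

lemma semigroup_diff:
  assumes "semigroup_of_form T" "0 < t" "f \<in> H" "g \<in> H"
  shows "nrm (T t (f - g) - (T t f - T t g)) = 0"
  using semigroup_mem[OF assms(1,2)] semigroup_plus[OF assms(1,2)]
  by (rule linear_diff_null) (use assms in auto)

lemma semigroup_lipschitz:
  assumes T: "semigroup_of_form T" and t: "0 < t" and f: "f \<in> H" "g \<in> H"
    and c: "\<And>f. f \<in> H \<Longrightarrow> nrm (T t f) \<le> c * nrm f"
  shows "nrm (T t f - T t g) \<le> c * nrm (f - g)"
proof -
  note mem = semigroup_mem[OF T t]
  have "nrm (T t f - T t g) \<le> nrm ((T t f - T t g) - T t (f - g)) + nrm (T t (f - g))"
    using nrm_triangle_sub mem f by simp
  also have "nrm ((T t f - T t g) - T t (f - g)) = 0"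
    using null_sym[OF _ _ semigroup_diff[OF T t f]] mem f by simp
  finally show ?thesis using c[of "f - g"] f by simp
qed

text \<open>\<open>T t\<close> commutes with the difference quotients that define \<open>L\<close>, and it is bounded.\<close>

lemma semigroup_gen_commute:
  assumes T: "semigroup_of_form T" and t: "0 < t" and g: "gen u g"
  shows "gen (T t u) (T t g)"
proof -
  note m = gen_mem[OF g] and mem = semigroup_mem[OF T]
  obtain C where C: "\<And>f. f \<in> H \<Longrightarrow> nrm (T t f) \<le> C * nrm f" using semigroup_bounded[OF T t] by blast
  have lim: "((\<lambda>s. nrm ((1 / s) *\<^sub>R (u - T s u) - g)) \<longlongrightarrow> 0) (at_right 0)"
    using semigroup_gen[OF T m] g by simp
  have "((\<lambda>s. nrm ((1 / s) *\<^sub>R (T t u - T s (T t u)) - T t g)) \<longlongrightarrow> 0) (at_right 0)"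
  proof (rule Lim_null_comparison)
    show "((\<lambda>s. C * nrm ((1 / s) *\<^sub>R (u - T s u) - g)) \<longlongrightarrow> 0) (at_right 0)"
      using tendsto_mult_right_zero[OF lim] by simp
    have pos: "\<forall>\<^sub>F s in at_right (0::real). 0 < s" by (simp add: eventually_at_right_less)
    show "\<forall>\<^sub>F s in at_right 0. norm (nrm ((1 / s) *\<^sub>R (T t u - T s (T t u)) - T t g)) \<le> C * nrm ((1 / s) *\<^sub>R (u - T s u) - g)"
      using pos
    proof eventually_elim
      case (elim s)
      let ?q = "(1 / s) *\<^sub>R (u - T s u)"
      have "nrm (T s (T t u) - T t (T s u)) = 0"
        by (rule null_trans[of _ "T (s + t) u"])
          (use semigroup_add[OF T elim t m(1)] semigroup_add[OF T t elim m(1)] mem elim t m null_sym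
            in \<open>auto simp: add.commute\<close>)
      then have "nrm ((T t u - T t (T s u)) - (T t u - T s (T t u))) = 0" by simp
      with semigroup_diff[OF T t m(1) mem[OF elim m(1)]]
      have "nrm (T t (u - T s u) - (T t u - T s (T t u))) = 0"
        by (rule null_trans[rotated 3]) (use mem elim t m in auto)
      then have "nrm ((1 / s) *\<^sub>R (T t (u - T s u) - (T t u - T s (T t u)))) = 0"
        using nrm_scale mem elim t m by simp
      then have "nrm ((1 / s) *\<^sub>R T t (u - T s u) - (1 / s) *\<^sub>R (T t u - T s (T t u))) = 0"
        by (simp add: algebra_simps)
      moreover have "nrm (T t ?q - (1 / s) *\<^sub>R T t (u - T s u)) = 0"
        by (rule semigroup_scale[OF T t]) (use mem elim m in simp)
      ultimately have "nrm (T t ?q - (1 / s) *\<^sub>R (T t u - T s (T t u))) = 0"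
        by (rule_tac null_trans[of _ "(1 / s) *\<^sub>R T t (u - T s u)"]) (use mem elim t m in simp_all)
      then have "nrm ((1 / s) *\<^sub>R (T t u - T s (T t u)) - T t ?q) \<le> 0"
        using null_sym mem elim t m by simp
      then have "nrm ((1 / s) *\<^sub>R (T t u - T s (T t u)) - T t g) \<le> 0 + C * nrm (?q - g)"
        using semigroup_lipschitz[OF T t _ m(2) C, of ?q]
        by (rule_tac nrm_add_close[of _ "T t ?q"]) (use mem elim t m in simp_all)
      then show ?case using mem elim t m by simp
    qed
  qed
  then show ?thesis using semigroup_gen[OF T] mem t m by simp
qed

lemma semigroup_funpow:
  assumes T: "semigroup_of_form T" and h: "0 < h" and f: "f \<in> H"
  shows "(T h ^^ n) f \<in> H \<and> nrm (T (real (Suc n) * h) f - (T h ^^ Suc n) f) = 0"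
proof (induction n)
  case 0
  then show ?case using f h semigroup_mem[OF T h] by simp
next
  case (Suc n)
  note mem = semigroup_mem[OF T]
  let ?s = "real (Suc n) * h"
  obtain C where C: "\<And>f. f \<in> H \<Longrightarrow> nrm (T h f) \<le> C * nrm f" using semigroup_bounded[OF T h] by blast
  have s: "0 < ?s" using h by simp
  have m: "(T h ^^ Suc n) f \<in> H" using Suc mem h by simp
  have "nrm (T h (T ?s f) - T h ((T h ^^ Suc n) f)) \<le> C * nrm (T ?s f - (T h ^^ Suc n) f)"
    by (rule semigroup_lipschitz[OF T h _ m C]) (use mem s f in auto)
  then have "nrm (T h (T ?s f) - T h ((T h ^^ Suc n) f)) = 0"
    using Suc m mem h s f null_if_le by simp
  moreover have "real (Suc (Suc n)) * h = h + ?s" by (simp add: algebra_simps)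
  then have "nrm (T (real (Suc (Suc n)) * h) f - T h (T ?s f)) = 0" using semigroup_add[OF T h s f] by simp
  ultimately have "nrm (T (real (Suc (Suc n)) * h) f - T h ((T h ^^ Suc n) f)) = 0"
    by (rule_tac null_trans[of _ "T h (T ?s f)"]) (use m mem h s f in \<open>auto simp del: of_nat_Suc\<close>)
  then show ?case using m by simp
qed

text \<open>Both \<open>T h\<close> and \<open>res h\<close> are \<open>u - h * L u\<close> up to \<open>o(h)\<close>, and they commute; so their powers
  \<open>T (t / 2 ^ k) ^^ (2 ^ k)\<close> (which is \<open>T t\<close>) and \<open>approx k t\<close> have the same limit.\<close>

lemma semigroup_eq_sg_gen:
  assumes T: "semigroup_of_form T" and t: "0 < t" and g: "gen u g"
  shows "nrm (T t u - sg t u) = 0"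
proof -
  note m = gen_mem[OF g] and mem = semigroup_mem[OF T]
  obtain C0 where "\<And>f. f \<in> H \<Longrightarrow> nrm (T t f) \<le> C0 * nrm f" using semigroup_bounded[OF T t] by blast
  moreover define C where "C = max C0 1"
  moreover have "C0 * nrm f \<le> C * nrm f" if "f \<in> H" for f
    using that by (intro mult_right_mono) (auto simp: C_def)
  ultimately have C: "1 \<le> C" "\<And>f. f \<in> H \<Longrightarrow> nrm (T t f) \<le> C * nrm f"
    using order_trans by (simp, blast)
  define q where "q h = nrm ((1 / h) *\<^sub>R (u - T h u) - g) + nrm (res h g - g)" for h
  have bound: "nrm (T t u - approx k t u) \<le> C * t * q (t / 2 ^ k)" for k
  proof -
    define h where "h = t / 2 ^ k"
    have h: "0 < h" using t by (simp add: h_def)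
    obtain c where c: "c \<ge> 1" "c ^ (2 ^ k) = C" "\<And>f. f \<in> H \<Longrightarrow> nrm (T h f) \<le> c * nrm f"
      using semigroup_dyadic_bound[OF T t C] unfolding h_def by blast
    define d where "d = nrm (T h u - res h u)"
    have Jn: "(res h ^^ j) f \<in> H" if "f \<in> H" for j f
      using lin_contr_mem[OF lin_contr_funpow[OF res_lin_contr[OF h]]] that .
    have d: "d \<le> h * q h"
    proof -
      have "(- h) *\<^sub>R (((1 / h) *\<^sub>R (u - T h u) - g) - (res h g - g)) = (T h u - res h u) + ((res h u + h *\<^sub>R res h g) - u)"
        using h by (simp add: algebra_simps)
      then have "nrm ((T h u - res h u) + ((res h u + h *\<^sub>R res h g) - u))
          = h * nrm (((1 / h) *\<^sub>R (u - T h u) - g) - (res h g - g))"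
        using nrm_scale[of "((1 / h) *\<^sub>R (u - T h u) - g) - (res h g - g)" "- h"] h m mem by simp
      also have "\<dots> \<le> h * q h"
        unfolding q_def using nrm_triangle[of "(1 / h) *\<^sub>R (u - T h u) - g" "- (res h g - g)"]
          nrm_minus_commute[of g "res h g"] h m mem by (intro mult_left_mono) auto
      finally have 1: "nrm ((T h u - res h u) + ((res h u + h *\<^sub>R res h g) - u)) \<le> h * q h" .
      have "nrm (T h u - res h u) \<le> nrm ((T h u - res h u) - (u - (res h u + h *\<^sub>R res h g))) + nrm (u - (res h u + h *\<^sub>R res h g))"
        by (rule nrm_triangle_sub) (use h m mem in auto)
      then show ?thesis using 1 gen_res_expand[OF h g] unfolding d_def by (simp add: algebra_simps)
    qed
    have d0: "0 \<le> d" using h m mem by (simp add: d_def)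
    have step: "nrm (T h ((res h ^^ j) u) - res h ((res h ^^ j) u)) \<le> d" for j
    proof -
      let ?J = "res h ^^ j"
      have "nrm (T h (?J u) - ?J (T h u)) = 0"
      proof (rule funpow_commute[OF _ res_lin_contr[OF h] _ m(1)])
        fix f assume "f \<in> H"
        then show "nrm (T h (res h f) - res h (T h f)) = 0"
          using commute_res[of "T h", OF _ _ _ _ h] mem[OF h] semigroup_plus[OF T h] semigroup_scale[OF T h]
            semigroup_gen_commute[OF T h] by blast
      qed (use mem h in auto)
      moreover have "nrm (?J (T h u) - ?J (res h u)) \<le> d"
        unfolding d_def by (rule lin_contr_lipschitz[OF lin_contr_funpow[OF res_lin_contr[OF h]]]) (use mem h m in auto)
      moreover have "?J (res h u) = res h (?J u)" by (simp add: funpow_swap1)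
      ultimately have "nrm (T h (?J u) - res h (?J u)) \<le> 0 + d"
        by (intro nrm_add_close[of _ "?J (T h u)"]) (use mem h m Jn in auto)
      then show ?thesis by simp
    qed
    have pow: "nrm ((T h ^^ n) u - (res h ^^ n) u) \<le> real n * c ^ n * d" for n
    proof (induction n)
      case 0
      then show ?case using m by simp
    next
      case (Suc n)
      have Tn: "(T h ^^ n) u \<in> H" using semigroup_funpow[OF T h m(1)] by blast
      have "nrm (T h ((T h ^^ n) u) - T h ((res h ^^ n) u)) \<le> c * nrm ((T h ^^ n) u - (res h ^^ n) u)"
        by (rule semigroup_lipschitz[OF T h Tn _ c(3)]) (use Jn m in auto)
      also have "\<dots> \<le> c * (real n * c ^ n * d)" using Suc c by (intro mult_left_mono) auto
      finally have "nrm ((T h ^^ Suc n) u - (res h ^^ Suc n) u) \<le> c * (real n * c ^ n * d) + d"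
        using nrm_add_close[of "T h ((T h ^^ n) u)" "T h ((res h ^^ n) u)" "res h ((res h ^^ n) u)"] step[of n]
          Tn Jn[OF m(1), of n] mem h by simp
      moreover have "d \<le> c ^ Suc n * d" using mult_right_mono[OF one_le_power[OF c(1), of "Suc n"] d0] by simp
      moreover have "c * (real n * c ^ n * d) + c ^ Suc n * d = real (Suc n) * c ^ Suc n * d"
        by (simp add: algebra_simps)
      ultimately show ?case by linarith
    qed
    obtain n where n: "2 ^ k = Suc n" using not0_implies_Suc[of "2 ^ k"] by auto
    have nh: "real (2 ^ k) * h = t" by (simp add: h_def)
    have Tp: "nrm (T t u - (T h ^^ (2 ^ k)) u) \<le> 0"
      using semigroup_funpow[OF T h m(1), of n] nh unfolding n[symmetric] by simp
    have "nrm (T t u - approx k t u) \<le> 0 + real (2 ^ k) * c ^ (2 ^ k) * d"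
      unfolding approx_def h_def[symmetric]
      by (rule nrm_add_close[OF _ _ _ Tp pow]) (use semigroup_funpow[OF T h m(1)] Jn m mem t in auto)
    also have "\<dots> \<le> real (2 ^ k) * C * (h * q h)"
      unfolding c(2) using d C by (simp add: mult_left_mono)
    also have "\<dots> = C * t * q h" using nh by (simp add: algebra_simps)
    finally show ?thesis unfolding h_def .
  qed
  have q: "(q \<longlongrightarrow> 0) (at_right 0)"
    unfolding q_def using tendsto_add[OF iffD1[OF semigroup_gen[OF T m] g] res_tendsto[OF m(2)]] by simp
  have hk: "filterlim (\<lambda>k. t / 2 ^ k) (at_right 0) sequentially"
  proof -
    have "(\<lambda>k. t * (1 / 2) ^ k) \<longlonglongrightarrow> t * 0" by (intro tendsto_intros LIMSEQ_power_zero) simp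
    then show ?thesis
      unfolding filterlim_at using t by (auto simp: power_one_over field_simps)
  qed
  have "(\<lambda>k. nrm (approx k t u - T t u)) \<longlonglongrightarrow> 0"
  proof (rule Lim_null_comparison)
    show "(\<lambda>k. C * t * q (t / 2 ^ k)) \<longlonglongrightarrow> 0"
      using tendsto_mult_right_zero[OF filterlim_compose[OF q hk]] by simp
    show "\<forall>\<^sub>F k in sequentially. norm (nrm (approx k t u - T t u)) \<le> C * t * q (t / 2 ^ k)"
      using bound nrm_minus_commute[of "T t u" "approx _ t u"] m mem t by (auto intro!: always_eventually)
  qed
  then show ?thesis
    using nrm_limit_unique[OF _ _ _ _ _ sg_limit[OF t m(1)]] m mem t by simp
qed

theorem semigroup_eq_sg:
  assumes T: "semigroup_of_form T" and t: "0 < t" and f: "f \<in> H"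
  shows "nrm (T t f - sg t f) = 0"
proof -
  note mem = semigroup_mem[OF T t]
  obtain C where C: "\<And>f. f \<in> H \<Longrightarrow> nrm (T t f) \<le> C * nrm f" using semigroup_bounded[OF T t] by blast
  show ?thesis
  proof (rule null_if_small)
    fix e :: real assume e: "0 < e"
    obtain u g where u: "gen u g" "nrm (f - u) < e" using gen_dense[OF f e] by blast
    note m = gen_mem[OF u(1)]
    have "nrm (T t f - T t u) \<le> C * nrm (f - u)" using semigroup_lipschitz[OF T t f m(1) C] .
    also have "\<dots> \<le> \<bar>C\<bar> * e" using u(2) f m by (intro mult_mono) auto
    finally have 1: "nrm (T t f - T t u) \<le> \<bar>C\<bar> * e" .
    have 2: "nrm (sg t u - sg t f) \<le> e"
      using sg_lipschitz[OF t m(1) f] u(2) nrm_minus_commute[OF f m(1)] by simp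
    have "nrm (T t f - sg t f) \<le> \<bar>C\<bar> * e + (0 + e)"
      by (rule nrm_add_close[OF _ _ _ 1 nrm_add_close[OF _ _ _ _ 2]])
        (use semigroup_eq_sg_gen[OF T t u(1)] mem m f t in auto)
    then show "nrm (T t f - sg t f) \<le> (\<bar>C\<bar> + 1) * e" by (simp add: algebra_simps)
  qed (use mem f t in auto)
qed

theorem semigroup_of_form_sg: "semigroup_of_form sg"
  unfolding semigroup_of_form_def
proof (intro conjI allI ballI impI)
  fix t :: real assume "0 < t"
  then show "\<exists>C. \<forall>f\<in>H. nrm (sg t f) \<le> C * nrm f"
    using lin_contr_le[OF sg_lin_contr] by (intro exI[of _ 1]) simp
next
  fix f g assume "f \<in> H" "g \<in> H"
  then show "gen f g = ((\<lambda>t. nrm ((1 / t) *\<^sub>R (f - sg t f) - g)) \<longlongrightarrow> 0) (at_right 0)"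
    using gen_imp_sg_derivative sg_derivative_imp_gen by blast
qed (use lin_contr_add[OF sg_lin_contr] lin_contr_scale[OF sg_lin_contr] sg_sym sg_add sg_tendsto in auto)

end

section \<open>The space of square integrable functions\<close>

instantiation "fun" :: (type, real_vector) real_vector
begin

definition scaleR_fun_def: "r *\<^sub>R f = (\<lambda>x. r *\<^sub>R f x)"

instance
  by standard (auto simp: scaleR_fun_def fun_eq_iff algebra_simps)

end

lemma scaleR_fun_apply [simp]: "(r *\<^sub>R f) x = r *\<^sub>R f x"
  by (simp add: scaleR_fun_def)

lemma plus_fun_eq: "f + g = (\<lambda>x. f x + g x)" for f g :: "'a \<Rightarrow> real"
  by (simp add: fun_eq_iff)

lemma minus_fun_eq: "f - g = (\<lambda>x. f x - g x)" for f g :: "'a \<Rightarrow> real"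
  by (simp add: fun_eq_iff)

lemma scaleR_fun_eq: "c *\<^sub>R f = (\<lambda>x. c * f x)" for f :: "'a \<Rightarrow> real"
  by (simp add: fun_eq_iff)

lemmas fun_vector_eqs = plus_fun_eq minus_fun_eq scaleR_fun_eq

lemma L2_measurable [measurable_dest]: "f \<in> L2 M \<Longrightarrow> f \<in> borel_measurable M"
  by (simp add: L2_def)

lemma L2_square_integrable: "f \<in> L2 M \<Longrightarrow> integrable M (\<lambda>x. (f x)\<^sup>2)"
  by (simp add: L2_def)

lemma L2_mult_integrable:
  assumes f: "f \<in> L2 M" and g: "g \<in> L2 M"
  shows "integrable M (\<lambda>x. f x * g x)"
proof (rule Bochner_Integration.integrable_bound)
  show "integrable M (\<lambda>x. (f x)\<^sup>2 + (g x)\<^sup>2)"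
    using L2_square_integrable[OF f] L2_square_integrable[OF g] by simp
  show "(\<lambda>x. f x * g x) \<in> borel_measurable M"
    using f g by (auto dest: L2_measurable)
  have "\<bar>a * b\<bar> \<le> a\<^sup>2 + b\<^sup>2" for a b :: real
  proof -
    have "0 \<le> (\<bar>a\<bar> - \<bar>b\<bar>)\<^sup>2" by simp
    then have "2 * (\<bar>a\<bar> * \<bar>b\<bar>) \<le> a\<^sup>2 + b\<^sup>2" by (simp add: power2_diff)
    moreover have "0 \<le> \<bar>a\<bar> * \<bar>b\<bar>" by simp
    ultimately show ?thesis unfolding abs_mult by linarith
  qed
  then show "AE x in M. norm (f x * g x) \<le> norm ((f x)\<^sup>2 + (g x)\<^sup>2)" by simp
qed

lemma L2_bounded:
  assumes g: "g \<in> L2 M" and f: "f \<in> borel_measurable M" and le: "AE x in M. \<bar>f x\<bar> \<le> \<bar>g x\<bar>"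
  shows "f \<in> L2 M"
proof -
  have "integrable M (\<lambda>x. (f x)\<^sup>2)"
    by (rule Bochner_Integration.integrable_bound[OF L2_square_integrable[OF g]])
      (use f le in \<open>auto simp: abs_le_square_iff elim!: eventually_mono\<close>)
  then show ?thesis using f by (simp add: L2_def)
qed

lemma L2_add: "f \<in> L2 M \<Longrightarrow> g \<in> L2 M \<Longrightarrow> (\<lambda>x. f x + g x) \<in> L2 M"
  unfolding L2_def using L2_mult_integrable[of f M g]
  by (auto simp: power2_sum L2_def mult.assoc)

lemma L2_scale: "f \<in> L2 M \<Longrightarrow> (\<lambda>x. c * f x) \<in> L2 M"
  by (auto simp: L2_def power_mult_distrib)

lemma L2_abs: "f \<in> L2 M \<Longrightarrow> (\<lambda>x. \<bar>f x\<bar>) \<in> L2 M"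
  by (rule L2_bounded) auto

lemma L2_zero: "(\<lambda>x. 0) \<in> L2 M"
  by (simp add: L2_def)

lemma semi_inner_space_L2: "semi_inner_space (L2 M) (inner2 M)"
proof
  show "subspace (L2 M)"
    unfolding subspace_def by (auto simp: fun_vector_eqs zero_fun_def L2_zero L2_add L2_scale)
next
  fix u v w :: "'a \<Rightarrow> real" assume "u \<in> L2 M" "v \<in> L2 M" "w \<in> L2 M"
  then show "inner2 M (u + v) w = inner2 M u w + inner2 M v w"
    unfolding inner2_def by (simp add: distrib_right L2_mult_integrable)
next
  fix u w :: "'a \<Rightarrow> real" and c assume "u \<in> L2 M" "w \<in> L2 M"
  then show "inner2 M (c *\<^sub>R u) w = c * inner2 M u w"
    unfolding inner2_def by (simp add: mult.assoc L2_mult_integrable)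
qed (auto simp: inner2_def mult.commute)

interpretation L2: semi_inner_space "L2 M" "inner2 M" for M
  by (rule semi_inner_space_L2)

lemma L2_nrm_eq [simp]: "L2.nrm M = norm2 M"
  by (rule ext) (simp add: L2.nrm_def norm2_def)

lemmas L2_diff = L2.mem_diff[unfolded minus_fun_eq]

lemma norm2_square_nn_integral:
  assumes "f \<in> L2 M"
  shows "(\<integral>\<^sup>+x. ennreal ((f x)\<^sup>2) \<partial>M) = ennreal ((norm2 M f)\<^sup>2)"
  using nn_integral_eq_integral[OF L2_square_integrable[OF assms]] assms
  by (simp add: norm2_def inner2_def power2_eq_square)

lemma norm2_eq_0_iff:
  assumes "f \<in> L2 M"
  shows "norm2 M f = 0 \<longleftrightarrow> (AE x in M. f x = 0)"
  using integral_nonneg_eq_0_iff_AE[OF L2_square_integrable[OF assms]]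
  by (simp add: norm2_def inner2_def power2_eq_square[symmetric])

lemma norm2_diff_eq_0_iff:
  assumes "f \<in> L2 M" "g \<in> L2 M"
  shows "norm2 M (f - g) = 0 \<longleftrightarrow> (AE x in M. f x = g x)"
  using norm2_eq_0_iff[OF L2.mem_diff[OF assms]] by simp

lemma norm2_leI:
  assumes f: "f \<in> borel_measurable M" and c: "0 \<le> c" and le: "(\<integral>\<^sup>+x. ennreal ((f x)\<^sup>2) \<partial>M) \<le> ennreal (c\<^sup>2)"
  shows "f \<in> L2 M" "norm2 M f \<le> c"
proof -
  have "integrable M (\<lambda>x. (f x)\<^sup>2)"
    by (rule integrableI_bounded) (use f le in \<open>auto simp: less_top[symmetric] top_unique\<close>)
  then show *: "f \<in> L2 M" using f by (simp add: L2_def)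
  have "(norm2 M f)\<^sup>2 \<le> c\<^sup>2"
    using le unfolding norm2_square_nn_integral[OF *] by simp
  then show "norm2 M f \<le> c" using c by (rule power2_le_imp_le)
qed

text \<open>Riesz--Fischer. Along a subsequence with consecutive distances below \<open>2 ^ - k\<close> the weighted series
  \<open>\<Sum>k. 2 ^ k * \<bar>U (r (Suc k)) x - U (r k) x\<bar>\<^sup>2\<close> has a finite integral, so it converges almost everywhere,
  and hence the subsequence does.\<close>

lemma L2_complete:
  fixes U :: "nat \<Rightarrow> 'a \<Rightarrow> real"
  assumes U: "\<And>n. U n \<in> L2 M"
    and C: "\<And>\<epsilon>. 0 < \<epsilon> \<Longrightarrow> \<exists>N. \<forall>m\<ge>N. \<forall>n\<ge>N. norm2 M (U m - U n) < \<epsilon>"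
  shows "\<exists>u\<in>L2 M. (\<lambda>n. norm2 M (U n - u)) \<longlonglongrightarrow> 0"
proof -
  have "\<forall>k. \<exists>N. \<forall>m\<ge>N. \<forall>n\<ge>N. norm2 M (U m - U n) < (1/2) ^ k" using C by simp
  then obtain N where N: "\<And>k m n. m \<ge> N k \<Longrightarrow> n \<ge> N k \<Longrightarrow> norm2 M (U m - U n) < (1/2) ^ k" by metis
  define r where "r k = (\<Sum>i\<le>k. N i) + k" for k
  have rN: "N k \<le> r k" "N k \<le> r (Suc k)" "k \<le> r k" for k
    by (auto simp: r_def intro: order_trans[OF member_le_sum[of k "{..k}" N]])
  define d where "d k x = U (r (Suc k)) x - U (r k) x" for k x
  have d_L2: "d k \<in> L2 M" for k unfolding d_def using L2_diff U by blast
  note [measurable] = L2_measurable[OF U] L2_measurable[OF d_L2]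
  have d_le: "(\<integral>\<^sup>+x. ennreal ((d k x)\<^sup>2) \<partial>M) \<le> ennreal ((1/4) ^ k)" for k
  proof -
    have "norm2 M (d k) \<le> (1/2) ^ k"
      using N[of k "r (Suc k)" "r k"] rN[of k] unfolding d_def minus_fun_eq by simp
    then have "(norm2 M (d k))\<^sup>2 \<le> ((1/2) ^ k)\<^sup>2"
      using L2.nrm_nonneg[OF d_L2, unfolded L2_nrm_eq] by (rule power_mono)
    also have "((1/2) ^ k)\<^sup>2 = (1/4 :: real) ^ k" by (simp add: power_mult[symmetric] mult.commute power2_eq_square power_mult_distrib[symmetric])
    finally show ?thesis using norm2_square_nn_integral[OF d_L2] by simp
  qed
  have "(\<integral>\<^sup>+x. (\<Sum>k. ennreal (2 ^ k * (d k x)\<^sup>2)) \<partial>M) = (\<Sum>k. \<integral>\<^sup>+x. ennreal (2 ^ k * (d k x)\<^sup>2) \<partial>M)"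
    by (rule nn_integral_suminf) measurable
  also have "\<dots> \<le> (\<Sum>k. ennreal ((1/2) ^ k))"
  proof (rule suminf_le)
    fix k
    have "(\<integral>\<^sup>+x. ennreal (2 ^ k * (d k x)\<^sup>2) \<partial>M) = ennreal (2 ^ k) * (\<integral>\<^sup>+x. ennreal ((d k x)\<^sup>2) \<partial>M)"
      by (subst nn_integral_cmult[symmetric]) (auto simp: ennreal_mult)
    also have "\<dots> \<le> ennreal (2 ^ k) * ennreal ((1/4) ^ k)" by (intro mult_left_mono d_le) simp
    also have "\<dots> = ennreal ((1/2) ^ k)"
      by (simp add: ennreal_mult[symmetric] power_mult_distrib[symmetric])
    finally show "(\<integral>\<^sup>+x. ennreal (2 ^ k * (d k x)\<^sup>2) \<partial>M) \<le> ennreal ((1/2) ^ k)" .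
  qed auto
  also have "\<dots> < \<infinity>"
    by (subst suminf_ennreal2) (auto intro: summable_geometric)
  finally have "AE x in M. (\<Sum>k. ennreal (2 ^ k * (d k x)\<^sup>2)) \<noteq> \<infinity>"
    by (intro nn_integral_PInf_AE) auto
  then have conv: "AE x in M. convergent (\<lambda>k. U (r k) x)"
  proof eventually_elim
    case (elim x)
    have "summable (\<lambda>k. 2 ^ k * (d k x)\<^sup>2)"
      by (rule summable_suminf_not_top) (use elim in auto)
    then obtain B where B: "\<And>k. 2 ^ k * (d k x)\<^sup>2 \<le> B"
      using Bseq_def[of "\<lambda>k. 2 ^ k * (d k x)\<^sup>2"] summable_LIMSEQ_zero convergentI convergent_imp_Bseq
      by (fastforce simp: abs_mult)
    have B0: "0 \<le> B" using B[of 0] by (rule order_trans[rotated]) simp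
    have "\<bar>d k x\<bar> \<le> sqrt B * sqrt (1/2) ^ k" for k
    proof (rule power2_le_imp_le)
      have "(d k x)\<^sup>2 \<le> B * (1/2) ^ k" using B[of k] by (simp add: field_simps power_one_over)
      then show "\<bar>d k x\<bar>\<^sup>2 \<le> (sqrt B * sqrt (1/2) ^ k)\<^sup>2"
        using B0 by (simp add: power_mult_distrib power_mult[symmetric] mult.commute[of k] power_mult real_sqrt_pow2 power_divide)
    qed (use B0 in simp)
    moreover have "summable (\<lambda>k. sqrt B * sqrt (1/2) ^ k)"
      by (intro summable_mult summable_geometric) (simp add: real_sqrt_divide)
    ultimately have "summable (\<lambda>k. d k x)"
      by (rule_tac summable_comparison_test'[where N = 0 and g = "\<lambda>k. sqrt B * sqrt (1/2) ^ k"]) auto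
    then have "convergent (\<lambda>n. \<Sum>k<n. d k x)" by (simp add: summable_iff_convergent)
    moreover have "(\<Sum>k<n. d k x) = U (r n) x - U (r 0) x" for n
      unfolding d_def by (rule sum_lessThan_telescope)
    ultimately have "convergent (\<lambda>n. (U (r n) x - U (r 0) x) + U (r 0) x)"
      by (intro convergent_add convergent_const) simp
    then show ?case by simp
  qed
  define u where "u x = lim (\<lambda>k. U (r k) x)" for x
  have [measurable]: "u \<in> borel_measurable M" unfolding u_def by measurable
  have lim: "AE x in M. (\<lambda>k. U (r k) x) \<longlonglongrightarrow> u x"
    using conv unfolding u_def by (auto simp: convergent_LIMSEQ_iff)
  have close: "U n - u \<in> L2 M \<and> norm2 M (U n - u) \<le> \<epsilon>"
    if \<epsilon>: "0 < \<epsilon>" and n: "\<forall>m\<ge>N. norm2 M (U n - U m) < \<epsilon>" for \<epsilon> n N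
  proof -
    have "(\<integral>\<^sup>+x. ennreal (((U n - u) x)\<^sup>2) \<partial>M) = (\<integral>\<^sup>+x. liminf (\<lambda>k. ennreal ((U n x - U (r k) x)\<^sup>2)) \<partial>M)"
    proof (rule nn_integral_cong_AE)
      show "AE x in M. ennreal (((U n - u) x)\<^sup>2) = liminf (\<lambda>k. ennreal ((U n x - U (r k) x)\<^sup>2))"
        using lim
      proof eventually_elim
        case (elim x)
        have "(\<lambda>k. ennreal ((U n x - U (r k) x)\<^sup>2)) \<longlonglongrightarrow> ennreal ((U n x - u x)\<^sup>2)"
          by (intro tendsto_intros elim)
        then show ?case using lim_imp_Liminf[OF trivial_limit_sequentially] by fastforce
      qed
    qed
    also have "\<dots> \<le> liminf (\<lambda>k. \<integral>\<^sup>+x. ennreal ((U n x - U (r k) x)\<^sup>2) \<partial>M)"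
      by (rule nn_integral_liminf) measurable
    also have "\<dots> \<le> ennreal (\<epsilon>\<^sup>2)"
    proof (rule Liminf_le)
      show "\<forall>\<^sub>F k in sequentially. (\<integral>\<^sup>+x. ennreal ((U n x - U (r k) x)\<^sup>2) \<partial>M) \<le> ennreal (\<epsilon>\<^sup>2)"
        using eventually_ge_at_top[of N]
      proof eventually_elim
        case (elim k)
        have "norm2 M (U n - U (r k)) < \<epsilon>" using n rN(3)[of k] elim by auto
        then have "(norm2 M (U n - U (r k)))\<^sup>2 \<le> \<epsilon>\<^sup>2"
          using L2.nrm_nonneg[OF L2.mem_diff[OF U U], unfolded L2_nrm_eq] by (intro power_mono) auto
        then show ?case using norm2_square_nn_integral[OF L2.mem_diff[OF U[of n] U[of "r k"]]] by simp
      qed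
    qed simp
    finally show ?thesis using norm2_leI[of "U n - u" M \<epsilon>] \<epsilon> by (simp add: minus_fun_eq)
  qed
  have "u \<in> L2 M"
  proof -
    obtain N where "\<forall>m\<ge>N. \<forall>n\<ge>N. norm2 M (U m - U n) < 1" using C[of 1] by auto
    then have "U N - u \<in> L2 M" using close[of 1 N N] by auto
    then have "U N - (U N - u) \<in> L2 M" using U L2.mem_diff by blast
    then show ?thesis by simp
  qed
  moreover have "(\<lambda>n. norm2 M (U n - u)) \<longlonglongrightarrow> 0"
  proof (rule LIMSEQ_I)
    fix e :: real assume e: "0 < e"
    obtain N where N: "\<forall>m\<ge>N. \<forall>n\<ge>N. norm2 M (U m - U n) < e / 2" using C[of "e/2"] e by auto
    have "norm (norm2 M (U n - u) - 0) < e" if "n \<ge> N" for n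
      using close[of "e/2" N n] N that e L2.nrm_nonneg[of "U n - u" M] by auto
    then show "\<exists>N. \<forall>n\<ge>N. norm (norm2 M (U n - u) - 0) < e" by blast
  qed
  ultimately show ?thesis by blast
qed

text \<open>The square of the positive part of \<open>f - g\<close> is bounded by \<open>(F k - f)\<^sup>2\<close>, whose integral tends to \<open>0\<close>.\<close>

lemma L2_limit_le:
  fixes f :: "'a \<Rightarrow> real"
  assumes F: "\<And>k. F k \<in> L2 M" and f: "f \<in> L2 M" and lim: "(\<lambda>k. norm2 M (F k - f)) \<longlonglongrightarrow> 0"
    and g: "g \<in> borel_measurable M" and le: "\<And>k. AE x in M. F k x \<le> g x"
  shows "AE x in M. f x \<le> g x"
proof -
  note [measurable] = L2_measurable[OF F] L2_measurable[OF f] g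
  let ?I = "\<integral>\<^sup>+x. ennreal ((max (f x - g x) 0)\<^sup>2) \<partial>M"
  have "?I \<le> ennreal ((norm2 M (F k - f))\<^sup>2)" for k
  proof -
    have "?I \<le> (\<integral>\<^sup>+x. ennreal (((F k - f) x)\<^sup>2) \<partial>M)"
    proof (rule nn_integral_mono_AE)
      show "AE x in M. ennreal ((max (f x - g x) 0)\<^sup>2) \<le> ennreal (((F k - f) x)\<^sup>2)"
        using le[of k]
      proof eventually_elim
        case (elim x)
        have "\<bar>max (f x - g x) 0\<bar> \<le> \<bar>F k x - f x\<bar>" using elim by auto
        then show ?case by (intro ennreal_leI) (simp only: abs_le_square_iff minus_apply)
      qed
    qed
    then show ?thesis using norm2_square_nn_integral[OF L2.mem_diff[OF F f]] by simp
  qed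
  moreover have "(\<lambda>k. ennreal ((norm2 M (F k - f))\<^sup>2)) \<longlonglongrightarrow> ennreal (0\<^sup>2)"
    by (intro tendsto_intros lim)
  ultimately have "?I \<le> ennreal (0\<^sup>2)" using LIMSEQ_le_const by blast
  then have "?I = 0" by simp
  then have "AE x in M. ennreal ((max (f x - g x) 0)\<^sup>2) = 0" by (subst (asm) nn_integral_0_iff_AE) auto
  then show ?thesis by eventually_elim (auto simp: max_def split: if_splits)
qed

lemma L2_limit_ge:
  fixes f :: "'a \<Rightarrow> real"
  assumes F: "\<And>k. F k \<in> L2 M" and f: "f \<in> L2 M" and lim: "(\<lambda>k. norm2 M (F k - f)) \<longlonglongrightarrow> 0"
    and g: "g \<in> borel_measurable M" and le: "\<And>k. AE x in M. g x \<le> F k x"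
  shows "AE x in M. g x \<le> f x"
proof -
  have "AE x in M. (- f) x \<le> - g x"
  proof (rule L2_limit_le[of "\<lambda>k. - F k"])
    have "norm2 M (- F k - - f) = norm2 M (F k - f)" for k
      using L2.nrm_minus_commute[OF F f, of k] by (simp add: algebra_simps)
    then show "(\<lambda>k. norm2 M (- F k - - f)) \<longlonglongrightarrow> 0" using lim by simp
    show "AE x in M. (- F k) x \<le> - g x" for k using le[of k] by simp
  qed (use L2.mem_uminus[OF F] L2.mem_uminus[OF f] g in \<open>auto simp: fun_Compl_def\<close>)
  then show ?thesis by simp
qed

lemma L2_dominated_convergence:
  fixes f :: "'a \<Rightarrow> real"
  assumes F: "\<And>k. F k \<in> borel_measurable M" and f: "f \<in> borel_measurable M" and g: "g \<in> L2 M"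
    and bd: "\<And>k. AE x in M. \<bar>F k x - f x\<bar> \<le> g x" and lim: "AE x in M. (\<lambda>k. F k x) \<longlonglongrightarrow> f x"
  shows "(\<lambda>k. norm2 M (F k - f)) \<longlonglongrightarrow> 0"
proof -
  have "(\<lambda>k. \<integral>x. (F k x - f x)\<^sup>2 \<partial>M) \<longlonglongrightarrow> (\<integral>x. 0 \<partial>M)"
  proof (rule integral_dominated_convergence)
    show "integrable M (\<lambda>x. (g x)\<^sup>2)" using L2_square_integrable[OF g] .
    show "AE x in M. (\<lambda>k. (F k x - f x)\<^sup>2) \<longlonglongrightarrow> 0"
      using lim
    proof eventually_elim
      case (elim x)
      have "(\<lambda>k. (F k x - f x)\<^sup>2) \<longlonglongrightarrow> (f x - f x)\<^sup>2" by (intro tendsto_intros elim)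
      then show ?case by simp
    qed
    show "AE x in M. norm ((F k x - f x)\<^sup>2) \<le> (g x)\<^sup>2" for k
      using bd[of k] by eventually_elim (auto simp: abs_le_square_iff[symmetric])
  qed (use F f in auto)
  then have "(\<lambda>k. sqrt (\<integral>x. (F k x - f x)\<^sup>2 \<partial>M)) \<longlonglongrightarrow> sqrt 0" by (intro tendsto_real_sqrt) simp
  then show ?thesis by (simp add: norm2_def inner2_def power2_eq_square)
qed

section \<open>Dirichlet forms as closed forms\<close>

sublocale dirichlet_form \<subseteq> closed_form "L2 M" "inner2 M" D E
proof
  obtain u0 where u0: "u0 \<in> D" using dom_dense[of "\<lambda>_. 0" 1] by (auto simp: L2_zero)
  have "(0 :: 'a \<Rightarrow> real) = (\<lambda>x. 0 * u0 x)" by (simp add: fun_eq_iff)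
  then have "0 \<in> D" using dom_scale[OF u0, of 0] by simp
  then show "subspace D"
    unfolding subspace_def using dom_add dom_scale by (auto simp: plus_fun_eq scaleR_fun_eq)
  show "D \<subseteq> L2 M" by (rule dom_L2)
next
  fix U :: "nat \<Rightarrow> 'a \<Rightarrow> real"
  assume "\<And>n. U n \<in> L2 M"
    and "\<And>\<epsilon>. 0 < \<epsilon> \<Longrightarrow> \<exists>N. \<forall>m\<ge>N. \<forall>n\<ge>N. L2.nrm M (U m - U n) < \<epsilon>"
  then show "\<exists>u\<in>L2 M. (\<lambda>n. L2.nrm M (U n - u)) \<longlonglongrightarrow> 0"
    using L2_complete[of U M] by simp
next
  fix U :: "nat \<Rightarrow> 'a \<Rightarrow> real" and u
  assume "\<And>n. U n \<in> D" "u \<in> L2 M" "(\<lambda>n. L2.nrm M (U n - u)) \<longlonglongrightarrow> 0"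
    and "\<And>\<epsilon>. 0 < \<epsilon> \<Longrightarrow> \<exists>N. \<forall>m\<ge>N. \<forall>n\<ge>N. E (U m - U n) (U m - U n) < \<epsilon>"
  then show "u \<in> D \<and> (\<lambda>n. E (U n - u) (U n - u)) \<longlonglongrightarrow> 0"
    using form_closed[of U u] by (simp add: minus_fun_eq)
next
  fix f and \<epsilon> :: real assume "f \<in> L2 M" "0 < \<epsilon>"
  then show "\<exists>u\<in>D. L2.nrm M (f - u) < \<epsilon>" using dom_dense by (simp add: minus_fun_eq)
qed (use form_add form_scale form_sym form_nonneg in \<open>auto simp: plus_fun_eq scaleR_fun_eq\<close>)

context dirichlet_form
begin

lemma form_operator_eq: "form_operator M D E u g \<longleftrightarrow> gen u g"
  by (simp add: form_operator_def gen_def)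

text \<open>Almost everywhere equality of square integrable functions is equality up to a null vector of the
  seminorm \<open>norm2 M\<close>.\<close>

lemma is_form_semigroup_iff: "is_form_semigroup M D E T \<longleftrightarrow> semigroup_of_form T"
  unfolding is_form_semigroup_def semigroup_of_form_def form_operator_eq L2_nrm_eq
  apply (rule conj_cong[OF refl])
  subgoal premises mem
  proof -
    have ae: "(norm2 M (f - g) = 0) = (AE x in M. f x = g x)" if "f \<in> L2 M" "g \<in> L2 M" for f g
      using norm2_diff_eq_0_iff that .
    have q: "norm2 M (\<lambda>x. (f x - T t f x) / t - g x) = norm2 M ((1 / t) *\<^sub>R (f - T t f) - g)" for f g t
      by (simp add: fun_vector_eqs)
    show ?thesis
      using mem unfolding q by (simp add: ae cong: conj_cong ball_cong) (simp add: fun_vector_eqs)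
  qed
  done

text \<open>The choice in the definition of the semigroup is not void, because the limit \<open>sg\<close> of the Euler scheme
  qualifies. By uniqueness, the chosen semigroup agrees with \<open>sg\<close> up to null sets.\<close>

lemma form_semigroup: "semigroup_of_form (form_semigroup M D E)"
  unfolding form_semigroup_def is_form_semigroup_iff[symmetric]
  by (rule someI[of _ sg]) (simp add: is_form_semigroup_iff semigroup_of_form_sg)

end

section \<open>The Markov property\<close>

lemma norm2_nonneg [simp]: "0 \<le> norm2 M f"
  by (simp add: norm2_def inner2_def)

lemma AE_eq_if_norm2_zero: "f \<in> L2 M \<Longrightarrow> g \<in> L2 M \<Longrightarrow> norm2 M (f - g) = 0 \<Longrightarrow> AE x in M. f x = g x"
  and norm2_zero_if_AE_eq: "f \<in> L2 M \<Longrightarrow> g \<in> L2 M \<Longrightarrow> AE x in M. f x = g x \<Longrightarrow> norm2 M (f - g) = 0"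
  using norm2_diff_eq_0_iff by blast+

lemma incseq_app: "incseq (\<lambda>k. p k x) \<Longrightarrow> p k x \<le> p (Suc k) x"
  by (rule incseq_SucD)

locale sigma_finite_dirichlet_form = dirichlet_form M D E + sigma_finite_measure M
  for M :: "'a measure" and D E
begin

abbreviation T :: "real \<Rightarrow> ('a \<Rightarrow> real) \<Rightarrow> 'a \<Rightarrow> real" where
  "T \<equiv> form_semigroup M D E"

abbreviation \<phi> :: "nat \<Rightarrow> 'a \<Rightarrow> real" where
  "\<phi> \<equiv> cutoff M"

text \<open>The resolvent minimises \<open>h * E v v + (norm2 (v - f))\<^sup>2\<close>. If \<open>f\<close> takes its values in the unit interval,
  truncating the minimiser to the unit interval increases neither term, so the minimiser equals its truncation.\<close>

lemma res_unit:
  assumes h: "0 < h" and f: "f \<in> L2 M" and unit: "AE x in M. 0 \<le> f x \<and> f x \<le> 1"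
  shows "AE x in M. 0 \<le> res h f x \<and> res h f x \<le> 1"
proof -
  define u where "u = res h f"
  define v where "v = (\<lambda>x. min (max (u x) 0) 1)"
  have u: "u \<in> D" using h f by (simp add: u_def)
  have v: "v \<in> D" "E v v \<le> E u u" using form_markov[OF u] by (simp_all add: v_def)
  have m: "u \<in> L2 M" "v \<in> L2 M" using u v D_subset by auto
  have closer: "(norm2 M (v - f))\<^sup>2 \<le> (norm2 M (u - f))\<^sup>2"
  proof -
    have "(\<integral>\<^sup>+x. ennreal (((v - f) x)\<^sup>2) \<partial>M) \<le> (\<integral>\<^sup>+x. ennreal (((u - f) x)\<^sup>2) \<partial>M)"
    proof (rule nn_integral_mono_AE)
      show "AE x in M. ennreal (((v - f) x)\<^sup>2) \<le> ennreal (((u - f) x)\<^sup>2)"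
        using unit
      proof eventually_elim
        case (elim x)
        then have "\<bar>v x - f x\<bar> \<le> \<bar>u x - f x\<bar>" by (auto simp: v_def)
        then show ?case by (intro ennreal_leI) (simp only: abs_le_square_iff minus_apply)
      qed
    qed
    then show ?thesis using norm2_square_nn_integral[OF mem_diff[OF m(2) f]] norm2_square_nn_integral[OF mem_diff[OF m(1) f]]
      by simp
  qed
  have "h * E u (v - u) + inner2 M u (v - u) = inner2 M f (v - u)"
    using res_eq[OF h f, of "v - u"] u v by (simp add: u_def)
  then have "h * E v v + inner2 M (v - f) (v - f)
      = h * E u u + inner2 M (u - f) (u - f) + h * E (v - u) (v - u) + inner2 M (v - u) (v - u)"
    using u v m f
    by (simp add: ip_simps form.ip_simps form.ip_sym[of v u] ip_sym[of v u] ip_sym[of v f] ip_sym[of u f] algebra_simps)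
  moreover have "inner2 M (v - f) (v - f) \<le> inner2 M (u - f) (u - f)"
    using closer nrm_square[OF mem_diff[OF m(2) f]] nrm_square[OF mem_diff[OF m(1) f]] by (simp only: L2_nrm_eq)
  moreover have "h * E v v \<le> h * E u u" using v(2) h by simp
  moreover have "0 \<le> h * E (v - u) (v - u)" using form.ip_nonneg[of "v - u"] u v h by simp
  ultimately have "inner2 M (v - u) (v - u) \<le> 0" by linarith
  then have "(norm2 M (v - u))\<^sup>2 \<le> 0" using nrm_square[of "v - u"] m by simp
  then have "norm2 M (v - u) = 0" by simp
  then have "AE x in M. v x = u x" by (rule AE_eq_if_norm2_zero[OF m(2) m(1)])
  then show ?thesis unfolding u_def[symmetric] by eventually_elim (auto simp: v_def min_def max_def split: if_splits)
qed

lemma T_mem [simp]: "0 < t \<Longrightarrow> f \<in> L2 M \<Longrightarrow> T t f \<in> L2 M"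
  using semigroup_mem[OF form_semigroup] .

lemma T_measurable: "0 < t \<Longrightarrow> f \<in> L2 M \<Longrightarrow> T t f \<in> borel_measurable M"
  using L2_measurable T_mem by blast

lemma T_lin_contr:
  assumes t: "0 < t"
  shows "lin_contr (T t)"
  unfolding lin_contr_def
proof (intro conjI ballI allI)
  fix f assume f: "f \<in> L2 M"
  then have "nrm (T t f) \<le> nrm (T t f - sg t f) + nrm (sg t f)"
    by (intro nrm_triangle_sub) (use t in auto)
  also have "\<dots> \<le> 0 + nrm f"
    using semigroup_eq_sg[OF form_semigroup t f] lin_contr_le[OF sg_lin_contr[OF t] f] by linarith
  finally show "nrm (T t f) \<le> nrm f" by simp
qed (use semigroup_plus[OF form_semigroup t] semigroup_scale[OF form_semigroup t] t in auto)

lemma T_limit: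
  assumes "0 < t" "f \<in> L2 M"
  shows "(\<lambda>k. norm2 M (approx k t f - T t f)) \<longlonglongrightarrow> 0"
proof (rule Lim_null_comparison)
  have "norm2 M (approx k t f - T t f) \<le> norm2 M (approx k t f - sg t f) + 0" for k
    using nrm_add_close[of "approx k t f" "sg t f" "T t f" _ 0] assms
      null_sym[OF _ _ semigroup_eq_sg[OF form_semigroup assms]] by simp
  then show "\<forall>\<^sub>F k in sequentially. norm (norm2 M (approx k t f - T t f)) \<le> norm2 M (approx k t f - sg t f)"
    by (auto intro!: always_eventually)
  show "(\<lambda>k. norm2 M (approx k t f - sg t f)) \<longlonglongrightarrow> 0" using sg_limit[OF assms] by simp
qed

lemma T_cong:
  assumes "0 < t" "f \<in> L2 M" "g \<in> L2 M" "AE x in M. f x = g x"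
  shows "AE x in M. T t f x = T t g x"
  using lin_contr_null[OF T_lin_contr[OF assms(1)] assms(2,3)] norm2_zero_if_AE_eq[OF assms(2-4)]
    AE_eq_if_norm2_zero[OF T_mem[OF assms(1,2)] T_mem[OF assms(1,3)]] by simp

lemma T_add:
  assumes "0 < t" "f \<in> L2 M" "g \<in> L2 M"
  shows "AE x in M. T t (\<lambda>y. f y + g y) x = T t f x + T t g x"
proof -
  have "AE x in M. T t (f + g) x = (T t f + T t g) x"
    by (rule AE_eq_if_norm2_zero[of "T t (f + g)" M "T t f + T t g"])
      (use lin_contr_add[OF T_lin_contr[OF assms(1)] assms(2,3)] assms in simp_all)
  then show ?thesis by (simp add: plus_fun_eq)
qed

lemma T_scale:
  assumes "0 < t" "f \<in> L2 M"
  shows "AE x in M. T t (\<lambda>y. c * f y) x = c * T t f x"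
proof -
  have "AE x in M. T t (c *\<^sub>R f) x = (c *\<^sub>R T t f) x"
    by (rule AE_eq_if_norm2_zero[of "T t (c *\<^sub>R f)" M "c *\<^sub>R T t f"])
      (use lin_contr_scale[OF T_lin_contr[OF assms(1)] assms(2)] assms in simp_all)
  then show ?thesis by (simp add: scaleR_fun_eq)
qed

lemma T_diff:
  assumes "0 < t" "f \<in> L2 M" "g \<in> L2 M"
  shows "AE x in M. T t (\<lambda>y. f y - g y) x = T t f x - T t g x"
  using semigroup_diff[OF form_semigroup assms] assms
    norm2_diff_eq_0_iff[of "T t (f - g)" M "T t f - T t g"] by (simp add: minus_fun_eq L2_diff)

lemma T_sym: "0 < t \<Longrightarrow> f \<in> L2 M \<Longrightarrow> g \<in> L2 M \<Longrightarrow> inner2 M (T t f) g = inner2 M f (T t g)"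
  using semigroup_sym[OF form_semigroup] .

lemma T_semigroup:
  assumes "0 < s" "0 < t" "f \<in> L2 M"
  shows "AE x in M. T (s + t) f x = T s (T t f) x"
  by (rule AE_eq_if_norm2_zero) (use semigroup_add[OF form_semigroup assms] assms in simp_all)

lemma T_norm_limit:
  assumes t: "0 < t" and F: "\<And>k. F k \<in> L2 M" "f \<in> L2 M" and lim: "(\<lambda>k. norm2 M (F k - f)) \<longlonglongrightarrow> 0"
  shows "(\<lambda>k. norm2 M (T t (F k) - T t f)) \<longlonglongrightarrow> 0"
proof (rule Lim_null_comparison[OF _ lim])
  show "\<forall>\<^sub>F k in sequentially. norm (norm2 M (T t (F k) - T t f)) \<le> norm2 M (F k - f)"
    using lin_contr_lipschitz[OF T_lin_contr[OF t] F(1) F(2)] by (auto intro!: always_eventually)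
qed

text \<open>The unit interval bounds pass from the resolvents to the Euler scheme, and then to its limit.\<close>

lemma T_unit:
  assumes t: "0 < t" and f: "f \<in> L2 M" and unit: "AE x in M. 0 \<le> f x \<and> f x \<le> 1"
  shows "AE x in M. 0 \<le> T t f x" "AE x in M. T t f x \<le> 1"
proof -
  have res: "(res h ^^ n) f \<in> L2 M \<and> (AE x in M. 0 \<le> (res h ^^ n) f x \<and> (res h ^^ n) f x \<le> 1)" if h: "0 < h" for h n
    by (induction n) (use f unit h res_unit in auto)
  have approx: "AE x in M. 0 \<le> approx k t f x \<and> approx k t f x \<le> 1" for k
    unfolding approx_def using res[of "t / 2 ^ k" "2 ^ k"] t by simp
  have pos: "AE x in M. 0 \<le> approx k t f x" and le: "AE x in M. approx k t f x \<le> 1" for k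
    using approx[of k] by auto
  have m: "approx k t f \<in> L2 M" for k using t f by simp
  show "AE x in M. 0 \<le> T t f x"
    using L2_limit_ge[OF m T_mem[OF t f] T_limit[OF t f], of "\<lambda>_. 0"] pos by simp
  show "AE x in M. T t f x \<le> 1"
    using L2_limit_le[OF m T_mem[OF t f] T_limit[OF t f], of "\<lambda>_. 1"] le by simp
qed

text \<open>Apply the bounds to \<open>min f (n + 1) / (n + 1)\<close>, which takes its values in the unit interval.\<close>

lemma T_nonneg:
  assumes t: "0 < t" and f: "f \<in> L2 M" and nonneg: "AE x in M. 0 \<le> f x"
  shows "AE x in M. 0 \<le> T t f x"
proof -
  define F where "F n x = min (f x) (real (Suc n))" for n x
  have [measurable]: "f \<in> borel_measurable M" using f by (rule L2_measurable)
  have [measurable]: "F n \<in> borel_measurable M" for n unfolding F_def by measurable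
  have F: "F n \<in> L2 M" for n
    by (rule L2_bounded[OF f]) (use nonneg in \<open>auto simp: F_def elim!: eventually_mono\<close>)
  have TF: "AE x in M. 0 \<le> T t (F n) x" for n
  proof -
    let ?c = "1 / real (Suc n)"
    have "AE x in M. 0 \<le> T t (\<lambda>y. ?c * F n y) x"
      by (rule T_unit(1)[OF t L2_scale[OF F]])
        (use nonneg in \<open>eventually_elim, auto simp: F_def field_simps min_def\<close>)
    with T_scale[OF t F, of ?c n] show ?thesis
      by eventually_elim (auto simp: zero_le_divide_iff)
  qed
  have "(\<lambda>n. norm2 M (F n - f)) \<longlonglongrightarrow> 0"
  proof (rule L2_dominated_convergence[OF _ _ L2_abs[OF f]])
    show "AE x in M. \<bar>F k x - f x\<bar> \<le> \<bar>f x\<bar>" for k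
      using nonneg by eventually_elim (auto simp: F_def min_def)
    have "\<forall>\<^sub>F n in sequentially. F n x = f x" for x
    proof -
      obtain N :: nat where "f x \<le> real N" using real_arch_simple by blast
      then show ?thesis unfolding F_def eventually_sequentially by (intro exI[of _ N]) auto
    qed
    then show "AE x in M. (\<lambda>n. F n x) \<longlonglongrightarrow> f x" by (auto intro: tendsto_eventually)
  qed measurable
  then have "(\<lambda>n. norm2 M (T t (F n) - T t f)) \<longlonglongrightarrow> 0" by (rule T_norm_limit[OF t F f])
  then show ?thesis using L2_limit_ge[of "\<lambda>n. T t (F n)" M "T t f" "\<lambda>_. 0"] TF F f t by simp
qed

lemma T_mono:
  assumes t: "0 < t" and f: "f \<in> L2 M" and g: "g \<in> L2 M" and le: "AE x in M. f x \<le> g x"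
  shows "AE x in M. T t f x \<le> T t g x"
proof -
  have "AE x in M. 0 \<le> T t (\<lambda>y. g y - f y) x"
    by (rule T_nonneg[OF t]) (use f g le L2_diff in auto)
  with T_diff[OF t g f] show ?thesis by eventually_elim simp
qed

text \<open>The monotone pointwise limit of \<open>T t (p k)\<close> lies below \<open>T t q\<close> by positivity, and above it because
  \<open>T t (p k)\<close> converges to \<open>T t q\<close> in \<open>L\<^sup>2\<close>.\<close>

lemma T_monotone_convergence:
  assumes t: "0 < t" and p: "\<And>k. p k \<in> L2 M" and q: "q \<in> L2 M"
    and inc: "AE x in M. incseq (\<lambda>k. p k x)" and lim: "AE x in M. (\<lambda>k. p k x) \<longlonglongrightarrow> q x"
  shows "AE x in M. (\<lambda>k. T t (p k) x) \<longlonglongrightarrow> T t q x"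
proof -
  note [measurable] = L2_measurable[OF p] L2_measurable[OF q] T_measurable[OF t p]
  have le: "AE x in M. p k x \<le> q x" for k
    using inc lim by eventually_elim (rule incseq_le)
  have Tle: "AE x in M. \<forall>k. T t (p k) x \<le> T t q x"
    unfolding AE_all_countable using T_mono[OF t p q le] by blast
  have "AE x in M. p k x \<le> p (Suc k) x" for k
    using inc by eventually_elim (rule incseq_app)
  then have "AE x in M. \<forall>k. T t (p k) x \<le> T t (p (Suc k)) x"
    unfolding AE_all_countable using T_mono[OF t p p] by blast
  then have Tinc: "AE x in M. incseq (\<lambda>k. T t (p k) x)"
    by eventually_elim (rule incseq_SucI, blast)
  define L where "L x = lim (\<lambda>k. T t (p k) x)" for x
  have [measurable]: "L \<in> borel_measurable M" unfolding L_def by measurable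
  have L: "AE x in M. (\<lambda>k. T t (p k) x) \<longlonglongrightarrow> L x"
    using Tle Tinc
  proof eventually_elim
    case (elim x)
    then obtain l where "(\<lambda>k. T t (p k) x) \<longlonglongrightarrow> l" using incseq_convergent[of _ "T t q x"] by metis
    then show ?case unfolding L_def by (simp add: limI)
  qed
  have "AE x in M. T t (p k) x \<le> L x" for k
    using Tinc L by eventually_elim (rule incseq_le)
  moreover have "(\<lambda>k. norm2 M (p k - q)) \<longlonglongrightarrow> 0"
  proof (rule L2_dominated_convergence[OF _ _ L2_diff[OF q p[of 0]]])
    show "AE x in M. \<bar>p k x - q x\<bar> \<le> q x - p 0 x" for k
      using inc le[of k] by eventually_elim (auto simp: incseq_def)
  qed (use lim in auto)
  then have "(\<lambda>k. norm2 M (T t (p k) - T t q)) \<longlonglongrightarrow> 0" by (rule T_norm_limit[OF t p q])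
  ultimately have "AE x in M. T t q x \<le> L x"
    using L2_limit_le[of "\<lambda>k. T t (p k)" M "T t q" L] p q t by simp
  moreover have "AE x in M. L x \<le> T t q x"
    using Tle L by eventually_elim (rule LIMSEQ_le_const2, auto)
  ultimately show ?thesis using L by eventually_elim simp
qed

section \<open>The semigroup on nonnegative functions\<close>

lemma is_cutoff_cutoff: "is_cutoff M \<phi>"
proof -
  obtain f :: "'a \<Rightarrow> real" where f: "f \<in> borel_measurable M" "\<And>x. f x > 0" "integrable M f"
    using obtain_positive_integrable_function by metis
  define \<psi> where "\<psi> k x = min 1 (real (Suc k) * f x)" for k x
  have [measurable]: "\<psi> k \<in> borel_measurable M" for k unfolding \<psi>_def using f(1) by measurable
  have "integrable M (\<psi> k)" for k
    by (rule Bochner_Integration.integrable_bound[OF integrable_mult_right[OF f(3), of "real (Suc k)"]])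
      (use f less_imp_le[OF f(2)] in \<open>auto simp: \<psi>_def min_def abs_mult\<close>)
  moreover have "0 < \<psi> k x \<and> \<psi> k x \<le> 1" for k x using f(2)[of x] by (auto simp: \<psi>_def)
  moreover have "incseq (\<lambda>k. \<psi> k x)" for x
    unfolding \<psi>_def using less_imp_le[OF f(2)[of x]]
    by (intro incseq_SucI min.mono order_refl mult_right_mono) auto
  moreover have "(\<lambda>k. \<psi> k x) \<longlonglongrightarrow> 1" for x
  proof (rule tendsto_eventually)
    obtain N :: nat where N: "1 / f x \<le> real N" using real_arch_simple by blast
    have "\<psi> k x = 1" if "k \<ge> N" for k
    proof -
      have "1 / f x \<le> real (Suc k)" using N that by simp
      then show ?thesis using f(2)[of x] by (simp add: \<psi>_def pos_divide_le_eq)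
    qed
    then show "\<forall>\<^sub>F k in sequentially. \<psi> k x = 1" unfolding eventually_sequentially by blast
  qed
  ultimately have "is_cutoff M \<psi>" by (simp add: is_cutoff_def L1_def)
  then show ?thesis unfolding cutoff_def by (rule someI[of "is_cutoff M"])
qed

lemma cutoff_integrable: "integrable M (\<phi> k)"
  and cutoff_AE: "AE x in M. (\<forall>k. 0 < \<phi> k x \<and> \<phi> k x \<le> 1) \<and> incseq (\<lambda>k. \<phi> k x) \<and> (\<lambda>k. \<phi> k x) \<longlonglongrightarrow> 1"
  using is_cutoff_cutoff by (auto simp: is_cutoff_def L1_def)

lemma L1_bounded_imp_L2:
  assumes f: "integrable M f" and bd: "AE x in M. \<bar>f x\<bar> \<le> c"
  shows "f \<in> L2 M"
proof -
  have "integrable M (\<lambda>x. (f x)\<^sup>2)"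
  proof (rule Bochner_Integration.integrable_bound[OF integrable_mult_right[OF integrable_abs[OF f], of c]])
    show "AE x in M. norm ((f x)\<^sup>2) \<le> norm (c * \<bar>f x\<bar>)"
      using bd
    proof eventually_elim
      case (elim x)
      have "\<bar>f x\<bar> * \<bar>f x\<bar> \<le> \<bar>c\<bar> * \<bar>f x\<bar>" using elim by (intro mult_right_mono) auto
      then show ?case by (simp add: power2_eq_square abs_mult)
    qed
  qed (use f in auto)
  then show ?thesis using f by (simp add: L2_def)
qed

lemma cutoff_L2 [simp]: "\<phi> k \<in> L2 M"
proof (rule L1_bounded_imp_L2[OF cutoff_integrable])
  show "AE x in M. \<bar>\<phi> k x\<bar> \<le> 1" using cutoff_AE by eventually_elim (simp add: less_imp_le)
qed

text \<open>The nonnegative measurable functions are the monotone limits of nonnegative square integrable ones, and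
  \<open>T t\<close> extends to them along such sequences. \<open>cut u\<close> is a concrete sequence for \<open>u\<close>.\<close>

definition exhausts :: "(nat \<Rightarrow> 'a \<Rightarrow> real) \<Rightarrow> ('a \<Rightarrow> ennreal) \<Rightarrow> bool" where
  "exhausts p u \<longleftrightarrow> (\<forall>k. p k \<in> L2 M) \<and>
     (AE x in M. (\<forall>k. 0 \<le> p k x) \<and> incseq (\<lambda>k. p k x) \<and> u x = (SUP k. ennreal (p k x)))"

definition cut :: "('a \<Rightarrow> ennreal) \<Rightarrow> nat \<Rightarrow> 'a \<Rightarrow> real" where
  "cut u k x = enn2real (min (u x) (ennreal (real k * \<phi> k x)))"

definition P :: "real \<Rightarrow> ('a \<Rightarrow> ennreal) \<Rightarrow> 'a \<Rightarrow> ennreal" where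
  "P t u x = (SUP k. ennreal (T t (cut u k) x))"

lemma exhausts_mem: "exhausts p u \<Longrightarrow> p k \<in> L2 M"
  by (simp add: exhausts_def)

lemma exhausts_AE:
  "exhausts p u \<Longrightarrow> AE x in M. (\<forall>k. 0 \<le> p k x) \<and> incseq (\<lambda>k. p k x) \<and> u x = (SUP k. ennreal (p k x))"
  by (simp add: exhausts_def)

lemma exhausts_cut:
  assumes [measurable]: "u \<in> borel_measurable M"
  shows "exhausts (cut u) u"
  unfolding exhausts_def
proof (intro conjI allI)
  fix k
  have [measurable]: "\<phi> k \<in> borel_measurable M" for k using L2_measurable[OF cutoff_L2] .
  show "cut u k \<in> L2 M"
  proof (rule L2_bounded[OF L2_scale[OF cutoff_L2]])
    show "AE x in M. \<bar>cut u k x\<bar> \<le> \<bar>real k * \<phi> k x\<bar>"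
      using cutoff_AE
    proof eventually_elim
      case (elim x)
      have "cut u k x \<le> enn2real (ennreal (real k * \<phi> k x))"
        unfolding cut_def by (intro enn2real_mono) auto
      moreover have "0 \<le> cut u k x" by (simp add: cut_def)
      ultimately show ?case using elim by (simp add: less_imp_le)
    qed
  qed (unfold cut_def, measurable)
next
  show "AE x in M. (\<forall>k. 0 \<le> cut u k x) \<and> incseq (\<lambda>k. cut u k x) \<and> u x = (SUP k. ennreal (cut u k x))"
    using cutoff_AE
  proof eventually_elim
    case (elim x)
    let ?a = "\<lambda>k. real k * \<phi> k x"
    have eq: "ennreal (cut u k x) = min (u x) (ennreal (?a k))" for k
      unfolding cut_def by (rule ennreal_enn2real) (simp add: min.strict_coboundedI2)
    have inc: "incseq ?a"
      using elim by (auto simp: incseq_def less_imp_le intro!: mult_mono)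
    have "(SUP k. ennreal (?a k)) = top"
    proof (rule ennreal_SUP_eq_top)
      fix n :: nat
      have "\<forall>\<^sub>F k in sequentially. 1 / 2 < \<phi> k x"
        using elim order_tendstoD(1)[of "\<lambda>k. \<phi> k x" 1 sequentially "1/2"] by simp
      then obtain N where N: "\<And>k. k \<ge> N \<Longrightarrow> 1 / 2 < \<phi> k x" unfolding eventually_sequentially by blast
      let ?k = "max N (2 * n)"
      have "real n = real (2 * n) * (1 / 2)" by simp
      also have "\<dots> \<le> ?a ?k" using N[of ?k] by (intro mult_mono) auto
      finally have "of_nat n \<le> ennreal (?a ?k)" by (simp add: ennreal_of_nat_eq_real_of_nat ennreal_leI)
      then show "\<exists>i\<in>UNIV. of_nat n \<le> ennreal (?a i)" by blast
    qed
    then have "(SUP k. ennreal (cut u k x)) = u x"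
      unfolding eq inf_min[symmetric] inf_SUP[symmetric] by (simp only: inf_top_right)
    moreover have "incseq (\<lambda>k. cut u k x)"
      unfolding incseq_def
    proof (intro allI impI)
      fix m n :: nat assume "m \<le> n"
      then have "ennreal (cut u m x) \<le> ennreal (cut u n x)"
        unfolding eq using inc by (intro min.mono order_refl ennreal_leI) (simp add: incseq_def)
      then show "cut u m x \<le> cut u n x" by (simp add: cut_def ennreal_le_iff)
    qed
    ultimately show ?case by (simp add: cut_def)
  qed
qed

lemma T_exhausts:
  assumes t: "0 < t" and p: "exhausts p u"
  shows "AE x in M. (\<forall>k. 0 \<le> T t (p k) x) \<and> incseq (\<lambda>k. T t (p k) x)"
proof -
  note m = exhausts_mem[OF p] and ae = exhausts_AE[OF p]
  have "AE x in M. 0 \<le> p k x" for k using ae by eventually_elim simp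
  then have "AE x in M. \<forall>k. 0 \<le> T t (p k) x"
    unfolding AE_all_countable using T_nonneg[OF t m] by blast
  moreover have "AE x in M. p k x \<le> p (Suc k) x" for k
    using ae by eventually_elim (intro incseq_app, blast)
  then have "AE x in M. \<forall>k. T t (p k) x \<le> T t (p (Suc k)) x"
    unfolding AE_all_countable using T_mono[OF t m m] by blast
  ultimately show ?thesis by eventually_elim (auto intro: incseq_SucI)
qed

text \<open>For fixed \<open>j\<close>, \<open>min (p j) (q k)\<close> increases to \<open>p j\<close> with \<open>k\<close>. So \<open>T t (p j)\<close> is the limit of
  \<open>T t (min (p j) (q k)) \<le> T t (q k)\<close>.\<close>

lemma exhausting_unique_le:
  assumes t: "0 < t" and p: "exhausts p u" and q: "exhausts q u"
  shows "AE x in M. (SUP k. ennreal (T t (p k) x)) \<le> (SUP k. ennreal (T t (q k) x))"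
proof -
  note mp = exhausts_mem[OF p] and mq = exhausts_mem[OF q]
  note [measurable] = L2_measurable[OF mp] L2_measurable[OF mq]
  have "AE x in M. ennreal (T t (p j) x) \<le> (SUP k. ennreal (T t (q k) x))" for j
  proof -
    define r where "r k x = min (p j x) (q k x)" for k x
    have [measurable]: "r k \<in> borel_measurable M" for k unfolding r_def by measurable
    have r: "r k \<in> L2 M" for k
      by (rule L2_bounded[OF mp[of j]])
        (use exhausts_AE[OF p] exhausts_AE[OF q] in \<open>auto simp: r_def elim!: eventually_elim2\<close>)
    have "AE x in M. (\<lambda>k. T t (r k) x) \<longlonglongrightarrow> T t (p j) x"
    proof (rule T_monotone_convergence[OF t r mp])
      show "AE x in M. incseq (\<lambda>k. r k x)"
        using exhausts_AE[OF q] by eventually_elim (auto simp: r_def incseq_def intro: min.coboundedI2)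
      show "AE x in M. (\<lambda>k. r k x) \<longlonglongrightarrow> p j x"
        using exhausts_AE[OF p] exhausts_AE[OF q]
      proof eventually_elim
        case (elim x)
        have inc: "incseq (\<lambda>k. ennreal (r k x))"
          using elim unfolding r_def incseq_def by (intro allI impI ennreal_leI min.mono order_refl) blast
        have "(SUP k. ennreal (r k x)) = (SUP k. inf (ennreal (p j x)) (ennreal (q k x)))"
          using elim by (simp add: r_def inf_min min_ennreal)
        also have "\<dots> = inf (ennreal (p j x)) (u x)" using elim by (simp add: inf_SUP[symmetric])
        also have "\<dots> = ennreal (p j x)"
          using elim by (simp add: inf_absorb1) (metis SUP_upper UNIV_I inf_absorb1)
        finally have "(\<lambda>k. ennreal (r k x)) \<longlonglongrightarrow> ennreal (p j x)" using LIMSEQ_SUP[OF inc] by simp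
        then show ?case using elim by (subst (asm) tendsto_ennreal_iff) (auto simp: r_def)
      qed
    qed
    moreover have "AE x in M. \<forall>k. T t (r k) x \<le> T t (q k) x"
      unfolding AE_all_countable using T_mono[OF t r mq] by (simp add: r_def)
    ultimately show ?thesis
    proof eventually_elim
      case (elim x)
      show ?case
      proof (rule LIMSEQ_le_const2)
        show "(\<lambda>k. ennreal (T t (r k) x)) \<longlonglongrightarrow> ennreal (T t (p j) x)" by (intro tendsto_ennrealI elim)
        have "ennreal (T t (r k) x) \<le> (SUP k. ennreal (T t (q k) x))" for k
          using elim by (intro SUP_upper2[of k]) (auto intro: ennreal_leI)
        then show "\<exists>N. \<forall>n\<ge>N. ennreal (T t (r n) x) \<le> (SUP k. ennreal (T t (q k) x))" by blast
      qed
    qed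
  qed
  then have "AE x in M. \<forall>j. ennreal (T t (p j) x) \<le> (SUP k. ennreal (T t (q k) x))"
    unfolding AE_all_countable by blast
  then show ?thesis by eventually_elim (auto intro: SUP_least)
qed

lemma P_measurable [measurable]:
  assumes t: "0 < t" and u: "u \<in> borel_measurable M"
  shows "P t u \<in> borel_measurable M"
proof -
  have [measurable]: "T t (cut u k) \<in> borel_measurable M" for k
    using T_measurable[OF t exhausts_mem[OF exhausts_cut[OF u]]] .
  show ?thesis unfolding P_def by measurable
qed

lemma P_exhausts:
  assumes t: "0 < t" and u: "u \<in> borel_measurable M" and p: "exhausts p u"
  shows "AE x in M. P t u x = (SUP k. ennreal (T t (p k) x))"
  using exhausting_unique_le[OF t exhausts_cut[OF u] p] exhausting_unique_le[OF t p exhausts_cut[OF u]]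
  unfolding P_def by eventually_elim (rule order_antisym)

lemma exhausts_cong: "exhausts p u \<Longrightarrow> AE x in M. u x = v x \<Longrightarrow> exhausts p v"
  unfolding exhausts_def by (auto elim!: eventually_elim2)

lemma P_cong:
  assumes t: "0 < t" and u: "u \<in> borel_measurable M" and v: "v \<in> borel_measurable M" and eq: "AE x in M. u x = v x"
  shows "AE x in M. P t u x = P t v x"
proof -
  have "exhausts (cut u) v" using exhausts_cong[OF exhausts_cut[OF u] eq] .
  from P_exhausts[OF t v this] show ?thesis by eventually_elim (simp add: P_def)
qed

lemma P_L2:
  assumes t: "0 < t" and f: "f \<in> L2 M" and nonneg: "AE x in M. 0 \<le> f x"
  shows "AE x in M. P t (\<lambda>x. ennreal (f x)) x = ennreal (T t f x)"
proof -
  have "exhausts (\<lambda>k. f) (\<lambda>x. ennreal (f x))" using f nonneg by (auto simp: exhausts_def incseq_def)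
  from P_exhausts[OF t _ this] show ?thesis using L2_measurable[OF f] by simp
qed

lemma exhausts_T:
  assumes t: "0 < t" and u: "u \<in> borel_measurable M" and p: "exhausts p u"
  shows "exhausts (\<lambda>k. T t (p k)) (P t u)"
  unfolding exhausts_def
proof (intro conjI allI)
  show "T t (p k) \<in> L2 M" for k using t exhausts_mem[OF p] by simp
  show "AE x in M. (\<forall>k. 0 \<le> T t (p k) x) \<and> incseq (\<lambda>k. T t (p k) x) \<and> P t u x = (SUP k. ennreal (T t (p k) x))"
    using T_exhausts[OF t p] P_exhausts[OF t u p] by eventually_elim simp
qed

lemma P_semigroup:
  assumes s: "0 < s" and t: "0 < t" and u: "u \<in> borel_measurable M"
  shows "AE x in M. P (s + t) u x = P s (P t u) x"
proof -
  note c = exhausts_cut[OF u]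
  have "AE x in M. \<forall>k. T (s + t) (cut u k) x = T s (T t (cut u k)) x"
    unfolding AE_all_countable using T_semigroup[OF s t exhausts_mem[OF c]] by blast
  with P_exhausts[OF s P_measurable[OF t u] exhausts_T[OF t u c]] show ?thesis
    by eventually_elim (simp add: P_def)
qed

lemma nn_integral_exhausts:
  assumes p: "exhausts p u" and w: "w \<in> borel_measurable M"
  shows "(\<integral>\<^sup>+x. u x * w x \<partial>M) = (SUP k. \<integral>\<^sup>+x. ennreal (p k x) * w x \<partial>M)"
proof -
  note [measurable] = L2_measurable[OF exhausts_mem[OF p]] w
  have "(\<integral>\<^sup>+x. u x * w x \<partial>M) = (\<integral>\<^sup>+x. (SUP k. ennreal (p k x) * w x) \<partial>M)"
    by (rule nn_integral_cong_AE) (use exhausts_AE[OF p] in \<open>eventually_elim, simp only: SUP_mult_right_ennreal\<close>)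
  also have "\<dots> = (SUP k. \<integral>\<^sup>+x. ennreal (p k x) * w x \<partial>M)"
  proof (rule nn_integral_monotone_convergence_SUP_AE)
    show "AE x in M. ennreal (p k x) * w x \<le> ennreal (p (Suc k) x) * w x" for k
      using exhausts_AE[OF p] by eventually_elim (intro mult_right_mono ennreal_leI incseq_app; blast?; simp)
  qed measurable
  finally show ?thesis .
qed

lemma nn_integral_inner2:
  assumes f: "f \<in> L2 M" "AE x in M. 0 \<le> f x" and g: "g \<in> L2 M" "AE x in M. 0 \<le> g x"
  shows "(\<integral>\<^sup>+x. ennreal (f x) * ennreal (g x) \<partial>M) = ennreal (inner2 M f g)"
proof -
  have "(\<integral>\<^sup>+x. ennreal (f x) * ennreal (g x) \<partial>M) = (\<integral>\<^sup>+x. ennreal (f x * g x) \<partial>M)"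
    by (rule nn_integral_cong_AE) (use f(2) g(2) in \<open>eventually_elim, simp add: ennreal_mult\<close>)
  also have "\<dots> = ennreal (\<integral>x. f x * g x \<partial>M)"
    by (rule nn_integral_eq_integral[OF L2_mult_integrable[OF f(1) g(1)]])
      (use f(2) g(2) in \<open>eventually_elim, simp\<close>)
  finally show ?thesis by (simp add: inner2_def)
qed

lemma P_sym:
  assumes t: "0 < t" and u: "u \<in> borel_measurable M" and v: "v \<in> borel_measurable M"
  shows "(\<integral>\<^sup>+x. P t u x * v x \<partial>M) = (\<integral>\<^sup>+x. u x * P t v x \<partial>M)"
proof -
  let ?p = "cut u" and ?q = "cut v"
  note p = exhausts_cut[OF u] and q = exhausts_cut[OF v]
  note [measurable] = L2_measurable[OF exhausts_mem[OF p]] L2_measurable[OF exhausts_mem[OF q]]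
    T_measurable[OF t exhausts_mem[OF p]] T_measurable[OF t exhausts_mem[OF q]]
  have p0: "AE x in M. 0 \<le> ?p k x" "AE x in M. 0 \<le> T t (?p k) x" for k
    using exhausts_AE[OF p] T_exhausts[OF t p] by (auto elim: eventually_mono)
  have q0: "AE x in M. 0 \<le> ?q k x" "AE x in M. 0 \<le> T t (?q k) x" for k
    using exhausts_AE[OF q] T_exhausts[OF t q] by (auto elim: eventually_mono)
  have "(\<integral>\<^sup>+x. P t u x * v x \<partial>M) = (SUP k. \<integral>\<^sup>+x. v x * ennreal (T t (?p k) x) \<partial>M)"
    using nn_integral_exhausts[OF exhausts_T[OF t u p] v] by (simp add: mult.commute)
  also have "\<dots> = (SUP k. SUP j. \<integral>\<^sup>+x. ennreal (?q j x) * ennreal (T t (?p k) x) \<partial>M)"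
    by (intro SUP_cong refl nn_integral_exhausts[OF q]) measurable
  also have "\<dots> = (SUP k. SUP j. \<integral>\<^sup>+x. ennreal (T t (?q j) x) * ennreal (?p k x) \<partial>M)"
  proof -
    have "(\<integral>\<^sup>+x. ennreal (?q j x) * ennreal (T t (?p k) x) \<partial>M) = (\<integral>\<^sup>+x. ennreal (T t (?q j) x) * ennreal (?p k x) \<partial>M)" for j k
      using nn_integral_inner2[OF exhausts_mem[OF q] q0(1) T_mem[OF t exhausts_mem[OF p]] p0(2)]
        nn_integral_inner2[OF T_mem[OF t exhausts_mem[OF q]] q0(2) exhausts_mem[OF p] p0(1)]
        T_sym[OF t exhausts_mem[OF q] exhausts_mem[OF p]] by simp
    then show ?thesis by simp
  qed
  also have "\<dots> = (SUP k. \<integral>\<^sup>+x. P t v x * ennreal (?p k x) \<partial>M)"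
    by (intro SUP_cong refl nn_integral_exhausts[OF exhausts_T[OF t v q], symmetric]) measurable
  also have "\<dots> = (\<integral>\<^sup>+x. u x * P t v x \<partial>M)"
    using nn_integral_exhausts[OF p P_measurable[OF t v]] by (simp add: mult.commute)
  finally show ?thesis .
qed

text \<open>Since \<open>P t\<close> is symmetric, its additivity, homogeneity and monotone continuity are those of the integral, tested
  against all nonnegative functions.\<close>

lemma AE_eq_by_duality:
  fixes F G :: "'a \<Rightarrow> ennreal"
  assumes [measurable]: "F \<in> borel_measurable M" "G \<in> borel_measurable M"
    and eq: "\<And>v. v \<in> borel_measurable M \<Longrightarrow> (\<integral>\<^sup>+x. F x * v x \<partial>M) = (\<integral>\<^sup>+x. G x * v x \<partial>M)"
  shows "AE x in M. F x = G x"
  by (rule density_unique2) (auto intro!: eq)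

lemma P_add:
  assumes t: "0 < t" and [measurable]: "u \<in> borel_measurable M" "v \<in> borel_measurable M"
  shows "AE x in M. P t (\<lambda>x. u x + v x) x = P t u x + P t v x"
proof (rule AE_eq_by_duality)
  note [measurable] = P_measurable[OF t]
  fix w :: "'a \<Rightarrow> ennreal" assume w [measurable]: "w \<in> borel_measurable M"
  show "(\<integral>\<^sup>+x. P t (\<lambda>x. u x + v x) x * w x \<partial>M) = (\<integral>\<^sup>+x. (P t u x + P t v x) * w x \<partial>M)"
    by (simp add: P_sym[OF t] distrib_right nn_integral_add)
qed (use t in measurable)

lemma P_cmult:
  assumes t: "0 < t" and [measurable]: "u \<in> borel_measurable M"
  shows "AE x in M. P t (\<lambda>x. c * u x) x = c * P t u x"
proof (rule AE_eq_by_duality)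
  note [measurable] = P_measurable[OF t]
  fix w :: "'a \<Rightarrow> ennreal" assume w [measurable]: "w \<in> borel_measurable M"
  show "(\<integral>\<^sup>+x. P t (\<lambda>x. c * u x) x * w x \<partial>M) = (\<integral>\<^sup>+x. (c * P t u x) * w x \<partial>M)"
    by (simp add: P_sym[OF t] mult.assoc nn_integral_cmult)
qed (use t in measurable)

lemma P_SUP:
  assumes t: "0 < t" and u: "\<And>k. u k \<in> borel_measurable M"
    and inc: "AE x in M. incseq (\<lambda>k. u k x)"
  shows "AE x in M. P t (\<lambda>x. SUP k. u k x) x = (SUP k. P t (u k) x)"
proof (rule AE_eq_by_duality)
  note [measurable] = P_measurable[OF t] u
  fix w :: "'a \<Rightarrow> ennreal" assume w [measurable]: "w \<in> borel_measurable M"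
  have le: "AE x in M. u k x \<le> u (Suc k) x" for k using inc by eventually_elim (rule incseq_app)
  have "(\<integral>\<^sup>+x. P t (\<lambda>x. SUP k. u k x) x * w x \<partial>M) = (\<integral>\<^sup>+x. (SUP k. u k x * P t w x) \<partial>M)"
    by (simp add: P_sym[OF t] SUP_mult_right_ennreal)
  also have "\<dots> = (SUP k. \<integral>\<^sup>+x. u k x * P t w x \<partial>M)"
  proof (rule nn_integral_monotone_convergence_SUP_AE)
    show "AE x in M. u k x * P t w x \<le> u (Suc k) x * P t w x" for k
      using le[of k] by eventually_elim (rule mult_right_mono, auto)
  qed measurable
  also have "\<dots> = (SUP k. \<integral>\<^sup>+x. P t (u k) x * w x \<partial>M)" by (simp add: P_sym[OF t])
  also have "\<dots> = (\<integral>\<^sup>+x. (SUP k. P t (u k) x * w x) \<partial>M)"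
  proof (rule nn_integral_monotone_convergence_SUP_AE[symmetric])
    fix k
    have "AE x in M. u (Suc k) x = u k x + (u (Suc k) x - u k x)"
      using le[of k] by eventually_elim (simp add: add_diff_inverse_ennreal)
    with P_cong[OF t _ _ this] P_add[OF t, of "u k" "\<lambda>x. u (Suc k) x - u k x"]
    show "AE x in M. P t (u k) x * w x \<le> P t (u (Suc k)) x * w x"
      by (auto elim!: eventually_elim2 intro!: mult_right_mono)
  qed measurable
  finally show "(\<integral>\<^sup>+x. P t (\<lambda>x. SUP k. u k x) x * w x \<partial>M) = (\<integral>\<^sup>+x. (SUP k. P t (u k) x) * w x \<partial>M)"
    by (simp add: SUP_mult_right_ennreal)
qed (use t u in measurable)

lemma P_mono:
  assumes t: "0 < t" and [measurable]: "u \<in> borel_measurable M" "v \<in> borel_measurable M"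
    and le: "AE x in M. u x \<le> v x"
  shows "AE x in M. P t u x \<le> P t v x"
proof -
  have "AE x in M. v x = u x + (v x - u x)"
    using le by eventually_elim (simp add: add_diff_inverse_ennreal)
  with P_cong[OF t _ _ this] P_add[OF t, of u "\<lambda>x. v x - u x"] show ?thesis
    by (auto elim!: eventually_elim2)
qed

lemma P_one_le:
  assumes t: "0 < t"
  shows "AE x in M. P t (\<lambda>_. 1) x \<le> 1"
proof -
  note c = exhausts_cut[of "\<lambda>_. 1"]
  have "AE x in M. T t (cut (\<lambda>_. 1) k) x \<le> 1" for k
  proof (rule T_unit(2)[OF t])
    have "cut (\<lambda>_. 1) k x \<le> enn2real 1" for x unfolding cut_def by (intro enn2real_mono) auto
    then show "AE x in M. 0 \<le> cut (\<lambda>_. 1) k x \<and> cut (\<lambda>_. 1) k x \<le> 1" by (simp add: cut_def)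
  qed (use exhausts_mem[OF c] in simp)
  then have "AE x in M. \<forall>k. T t (cut (\<lambda>_. 1) k) x \<le> 1" unfolding AE_all_countable by blast
  then show ?thesis unfolding P_def by eventually_elim (auto intro!: SUP_least simp: ennreal_le_1)
qed

lemma P_le_const:
  assumes t: "0 < t" and u: "u \<in> borel_measurable M" and le: "AE x in M. u x \<le> c"
  shows "AE x in M. P t u x \<le> c"
proof -
  have "AE x in M. P t u x \<le> P t (\<lambda>x. c * 1) x" by (rule P_mono[OF t u]) (use le in auto)
  moreover have "AE x in M. P t (\<lambda>x. c * 1) x = c * P t (\<lambda>_. 1) x" by (rule P_cmult[OF t]) simp
  ultimately show ?thesis using P_one_le[OF t]
  proof eventually_elim
    case (elim x)
    have "c * P t (\<lambda>_. 1) x \<le> c * 1" using elim by (intro mult_left_mono) auto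
    then show ?case using elim by simp
  qed
qed

lemma exhausts_cutoff: "exhausts \<phi> (\<lambda>_. 1)"
  unfolding exhausts_def
proof (intro conjI allI)
  show "AE x in M. (\<forall>k. 0 \<le> \<phi> k x) \<and> incseq (\<lambda>k. \<phi> k x) \<and> 1 = (SUP k. ennreal (\<phi> k x))"
    using cutoff_AE
  proof eventually_elim
    case (elim x)
    have "incseq (\<lambda>k. ennreal (\<phi> k x))" using elim by (auto simp: incseq_def intro: ennreal_leI)
    from LIMSEQ_SUP[OF this] have "(SUP k. ennreal (\<phi> k x)) = ennreal 1"
      using elim LIMSEQ_unique tendsto_ennrealI by blast
    then show ?case using elim by (simp add: less_imp_le)
  qed
qed simp

lemma semigroup_Linf_one:
  assumes t: "0 < t"
  shows "AE x in M. semigroup_Linf M D E t (\<lambda>_. 1) x = enn2real (P t (\<lambda>_. 1) x)"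
proof -
  note ex = exhausts_cutoff
  have zero: "AE x in M. T t (\<lambda>y. 0) x = 0" using T_scale[OF t L2_zero, of 0] by simp
  have Peq: "AE x in M. P t (\<lambda>_. 1) x = (SUP k. ennreal (T t (\<phi> k) x))" by (rule P_exhausts[OF t _ ex]) simp
  from T_exhausts[OF t ex] Peq P_one_le[OF t] zero show ?thesis
  proof eventually_elim
    case (elim x)
    have inc: "incseq (\<lambda>k. ennreal (T t (\<phi> k) x))" using elim by (auto simp: incseq_def intro: ennreal_leI)
    have fin: "P t (\<lambda>_. 1) x = ennreal (enn2real (P t (\<lambda>_. 1) x))"
      using elim by (metis ennreal_enn2real ennreal_one_less_top le_less_trans)
    have "(\<lambda>k. ennreal (T t (\<phi> k) x)) \<longlonglongrightarrow> ennreal (enn2real (P t (\<lambda>_. 1) x))"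
      using LIMSEQ_SUP[OF inc] elim fin by simp
    then have "(\<lambda>k. T t (\<phi> k) x) \<longlonglongrightarrow> enn2real (P t (\<lambda>_. 1) x)"
      using elim by (subst (asm) tendsto_ennreal_iff) auto
    then have "lim (\<lambda>k. T t (\<phi> k) x) = enn2real (P t (\<lambda>_. 1) x)" by (rule limI)
    then show ?case using elim by (simp add: semigroup_Linf_def semigroup_Linf_pos_def)
  qed
qed

end

section \<open>Time integrals of the semigroup\<close>

context sigma_finite_dirichlet_form
begin

abbreviation S :: "real \<Rightarrow> ('a \<Rightarrow> real) \<Rightarrow> 'a \<Rightarrow> real" where
  "S \<equiv> S2 M D E"

lemma T_tendsto:
  assumes "f \<in> L2 M"
  shows "((\<lambda>t. norm2 M (T t f - f)) \<longlongrightarrow> 0) (at_right 0)"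
  using form_semigroup assms unfolding semigroup_of_form_def by simp

text \<open>\<open>T s f - T r f = T r (T (s - r) f - f)\<close>.\<close>

lemma T_increment:
  assumes "0 < r" "r < s" "f \<in> L2 M"
  shows "norm2 M (T s f - T r f) \<le> norm2 M (T (s - r) f - f)"
proof -
  have h: "0 < s - r" using assms by simp
  have "AE x in M. T s f x = T r (T (s - r) f) x" using T_semigroup[OF assms(1) h assms(3)] by simp
  then have "norm2 M (T s f - T r (T (s - r) f)) = 0"
    by (rule norm2_zero_if_AE_eq[rotated 2]) (use assms h in simp_all)
  then have "nrm (T s f - T r (T (s - r) f)) \<le> 0" by simp
  then have "nrm (T s f - T r f) \<le> 0 + nrm (T (s - r) f - f)"
    by (rule nrm_add_close[rotated 3])
      (use lin_contr_lipschitz[OF T_lin_contr[OF assms(1)], of "T (s - r) f" f] assms h in simp_all)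
  then show ?thesis by simp
qed

lemma T_weakly_continuous:
  assumes f: "f \<in> L2 M" and g: "g \<in> L2 M"
  shows "continuous_on {0<..} (\<lambda>s. inner2 M (T s f) g)"
proof (rule continuous_onI)
  fix s e :: real assume s: "s \<in> {0<..}" and e: "0 < e"
  define c where "c = norm2 M g + 1"
  have c: "0 < c" unfolding c_def by (simp add: add_nonneg_pos)
  have "\<forall>\<^sub>F h in at_right 0. dist (norm2 M (T h f - f)) 0 < e / c"
    using tendstoD[OF T_tendsto[OF f], of "e / c"] e c by simp
  then obtain d where d: "0 < d" "\<And>h. 0 < h \<Longrightarrow> h < d \<Longrightarrow> norm2 M (T h f - f) < e / c"
    unfolding eventually_at_right_field by auto
  have close: "\<bar>inner2 M (T b f) g - inner2 M (T a f) g\<bar> \<le> e" if ab: "0 < a" "a < b" "b - a < d" for a b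
  proof -
    have "norm2 M (T b f - T a f) \<le> e / c" using T_increment[OF ab(1,2) f] d(2)[of "b - a"] ab by simp
    then have "norm2 M (T b f - T a f) * norm2 M g \<le> e / c * c"
      using e c by (intro mult_mono) (auto simp: c_def)
    moreover have "\<bar>inner2 M (T b f - T a f) g\<bar> \<le> norm2 M (T b f - T a f) * norm2 M g"
      using Cauchy_Schwarz[of "T b f - T a f" g] f g ab by simp
    moreover have "inner2 M (T b f - T a f) g = inner2 M (T b f) g - inner2 M (T a f) g"
      using f g ab by (simp add: ip_simps)
    ultimately show ?thesis using c by simp
  qed
  have "dist (inner2 M (T s' f) g) (inner2 M (T s f) g) \<le> e" if s': "s' \<in> {0<..}" "dist s' s < d" for s'
    using close[of s' s] close[of s s'] s s' e
    by (cases s' s rule: linorder_cases) (auto simp: dist_real_def abs_minus_commute)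
  then show "\<exists>d>0. \<forall>s'\<in>{0<..}. dist s' s < d \<longrightarrow> dist (inner2 M (T s' f) g) (inner2 M (T s f) g) \<le> e"
    using d(1) by blast
qed

lemma T_inner2_bound:
  assumes "0 < s" "f \<in> L2 M" "g \<in> L2 M"
  shows "\<bar>inner2 M (T s f) g\<bar> \<le> norm2 M f * norm2 M g"
proof -
  have "\<bar>inner2 M (T s f) g\<bar> \<le> norm2 M (T s f) * norm2 M g" using Cauchy_Schwarz[of "T s f" g] assms by simp
  also have "\<dots> \<le> norm2 M f * norm2 M g"
    using lin_contr_le[OF T_lin_contr[OF assms(1)] assms(2)] by (intro mult_right_mono) auto
  finally show ?thesis .
qed

lemma T_inner2_set_integrable:
  assumes f: "f \<in> L2 M" and g: "g \<in> L2 M" and a: "0 \<le> a"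
  shows "set_integrable lborel {a<..b} (\<lambda>s. inner2 M (T s f) g)"
  unfolding set_integrable_def
proof (rule integrableI_bounded_set[where A = "{a<..b}" and B = "norm2 M f * norm2 M g"])
  have "continuous_on {a<..b} (\<lambda>s. inner2 M (T s f) g)"
    by (rule continuous_on_subset[OF T_weakly_continuous[OF f g]]) (use a in auto)
  then have "(\<lambda>s. indicator {a<..b} s *\<^sub>R inner2 M (T s f) g) \<in> borel_measurable borel"
    by (intro borel_measurable_continuous_on_indicator) auto
  then show "(\<lambda>s. indicator {a<..b} s *\<^sub>R inner2 M (T s f) g) \<in> borel_measurable lborel" by simp
  show "emeasure lborel {a<..b} < \<infinity>" by (cases "a \<le> b") auto
  show "AE s\<in>{a<..b} in lborel. norm (indicator {a<..b} s *\<^sub>R inner2 M (T s f) g) \<le> norm2 M f * norm2 M g"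
    using T_inner2_bound[OF _ f g] a by (auto intro!: AE_I2)
qed auto

text \<open>The weak integral exists by the Riesz representation theorem: \<open>s \<mapsto> inner2 M (T s f) h\<close> is continuous and
  bounded by \<open>norm2 M f * norm2 M h\<close>.\<close>

lemma S_props:
  assumes t: "0 < t" and f: "f \<in> L2 M"
  shows S_mem [simp]: "S t f \<in> L2 M"
    and S_inner2: "h \<in> L2 M \<Longrightarrow> inner2 M (S t f) h = (LINT s:{0<..t}|lborel. inner2 M (T s f) h)"
proof -
  let ?\<Phi> = "\<lambda>h. LINT s:{0<..t}|lborel. inner2 M (T s f) h"
  have "\<exists>g\<in>L2 M. \<forall>h\<in>L2 M. inner2 M g h = ?\<Phi> h"
  proof (rule Riesz_representation)
    fix u v assume uv: "u \<in> L2 M" "v \<in> L2 M"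
    have "?\<Phi> (u + v) = (LINT s:{0<..t}|lborel. inner2 M (T s f) u + inner2 M (T s f) v)"
      by (rule set_lebesgue_integral_cong) (use f uv ip_simps in auto)
    also have "\<dots> = ?\<Phi> u + ?\<Phi> v"
      by (rule set_integral_add) (use T_inner2_set_integrable f uv in auto)
    finally show "?\<Phi> (u + v) = ?\<Phi> u + ?\<Phi> v" .
  next
    fix u c assume u: "u \<in> L2 M"
    have "?\<Phi> (c *\<^sub>R u) = (LINT s:{0<..t}|lborel. c * inner2 M (T s f) u)"
      by (rule set_lebesgue_integral_cong) (use f u ip_simps in auto)
    then show "?\<Phi> (c *\<^sub>R u) = c * ?\<Phi> u" by simp
  next
    fix u assume u: "u \<in> L2 M"
    have "\<bar>?\<Phi> u\<bar> \<le> (LINT s:{0<..t}|lborel. norm2 M f * norm2 M u)"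
      unfolding set_lebesgue_integral_def real_norm_def[symmetric]
    proof (rule Bochner_Integration.integral_norm_bound_integral)
      show "integrable lborel (\<lambda>s. indicator {0<..t} s *\<^sub>R inner2 M (T s f) u)"
        using T_inner2_set_integrable[OF f u, of 0 t] by (simp add: set_integrable_def)
      show "integrable lborel (\<lambda>s. indicator {0<..t} s *\<^sub>R (norm2 M f * norm2 M u))"
        using t by (intro integrable_real_mult_indicator integrable_scaleR_left) auto
      show "norm (indicator {0<..t} s *\<^sub>R inner2 M (T s f) u) \<le> indicator {0<..t} s *\<^sub>R (norm2 M f * norm2 M u)" for s
        using T_inner2_bound[of s, OF _ f u] by (auto simp: indicator_def)
    qed
    moreover have "(LINT s:{0<..t}|lborel. norm2 M f * norm2 M u) = t * (norm2 M f * norm2 M u)"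
      using t by (subst set_integral_const) auto
    ultimately show "\<bar>?\<Phi> u\<bar> \<le> (t * norm2 M f) * nrm u" unfolding L2_nrm_eq by linarith
  qed
  then have "\<exists>g. g \<in> L2 M \<and> (\<forall>h\<in>L2 M. inner2 M g h = ?\<Phi> h)" by blast
  from someI_ex[OF this] show "S t f \<in> L2 M" "h \<in> L2 M \<Longrightarrow> inner2 M (S t f) h = ?\<Phi> h"
    unfolding S2_def by blast+
qed

lemma S_measurable: "0 < t \<Longrightarrow> f \<in> L2 M \<Longrightarrow> S t f \<in> borel_measurable M"
  using L2_measurable S_mem by blast

lemma AE_eq_if_inner2_eq:
  assumes f: "f \<in> L2 M" and g: "g \<in> L2 M" and eq: "\<And>h. h \<in> L2 M \<Longrightarrow> inner2 M f h = inner2 M g h"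
  shows "AE x in M. f x = g x"
proof (rule AE_eq_if_norm2_zero[OF f g])
  have "(norm2 M (f - g))\<^sup>2 = inner2 M f (f - g) - inner2 M g (f - g)"
    using nrm_square[of "f - g"] f g by (simp add: ip_diff_left)
  then show "norm2 M (f - g) = 0" using eq[of "f - g"] f g by simp
qed

lemma S_add:
  assumes t: "0 < t" and f: "f \<in> L2 M" and g: "g \<in> L2 M"
  shows "AE x in M. S t (\<lambda>y. f y + g y) x = S t f x + S t g x"
proof -
  have "AE x in M. S t (f + g) x = (S t f + S t g) x"
  proof (rule AE_eq_if_inner2_eq[of "S t (f + g)" "S t f + S t g"])
    fix h assume h: "h \<in> L2 M"
    have "inner2 M (S t (f + g)) h = (LINT s:{0<..t}|lborel. inner2 M (T s f) h + inner2 M (T s g) h)"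
      unfolding S_inner2[OF t mem_add[OF f g] h]
    proof (rule set_lebesgue_integral_cong)
      show "\<forall>s. s \<in> {0<..t} \<longrightarrow> inner2 M (T s (f + g)) h = inner2 M (T s f) h + inner2 M (T s g) h"
        using ip_null_left[OF _ _ h lin_contr_add[OF T_lin_contr f g]] f g h by (simp add: ip_simps)
    qed simp
    also have "\<dots> = inner2 M (S t f) h + inner2 M (S t g) h"
      unfolding S_inner2[OF t f h] S_inner2[OF t g h]
      by (rule set_integral_add) (use T_inner2_set_integrable f g h in auto)
    finally show "inner2 M (S t (f + g)) h = inner2 M (S t f + S t g) h"
      using t f g h by (simp add: ip_simps)
  qed (use t f g in simp_all)
  then show ?thesis by (simp add: plus_fun_eq)
qed

text \<open>Test the weak integral with its own negative part.\<close>

lemma S_nonneg: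
  assumes t: "0 < t" and f: "f \<in> L2 M" and nonneg: "AE x in M. 0 \<le> f x"
  shows "AE x in M. 0 \<le> S t f x"
proof -
  note [measurable] = S_measurable[OF t f]
  define h where "h x = max (- S t f x) 0" for x
  have h: "h \<in> L2 M" unfolding h_def by (rule L2_bounded[OF S_mem[OF t f]]) auto
  have "0 \<le> inner2 M (T s f) h" if "0 < s" for s
    unfolding inner2_def
    by (rule integral_nonneg_AE) (use T_nonneg[OF that f nonneg] in \<open>auto simp: h_def elim!: eventually_mono\<close>)
  then have "0 \<le> inner2 M (S t f) h"
    unfolding S_inner2[OF t f h] set_lebesgue_integral_def
    by (intro Bochner_Integration.integral_nonneg) (auto simp: indicator_def)
  moreover have "S t f x * h x = - (h x * h x)" for x by (auto simp: h_def max_def)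
  then have "inner2 M (S t f) h = - (norm2 M h)\<^sup>2"
    using nrm_square[OF h] by (simp add: inner2_def)
  ultimately have "norm2 M h = 0" by simp
  then have "AE x in M. h x = 0" using norm2_eq_0_iff[OF h] by simp
  then show ?thesis by eventually_elim (auto simp: h_def max_def split: if_splits)
qed

lemma S_mono:
  assumes t: "0 < t" and f: "f \<in> L2 M" and g: "g \<in> L2 M" and le: "AE x in M. f x \<le> g x"
  shows "AE x in M. S t f x \<le> S t g x"
proof -
  have d: "(\<lambda>x. g x - f x) \<in> L2 M" using L2_diff f g by blast
  have "AE x in M. 0 \<le> S t (\<lambda>x. g x - f x) x" by (rule S_nonneg[OF t d]) (use le in auto)
  with S_add[OF t d f] show ?thesis by eventually_elim simp
qed

lemma S_abs_diff_le:
  assumes t: "0 < t" and f: "f \<in> L2 M" and g: "g \<in> L2 M"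
  shows "AE x in M. \<bar>S t f x - S t g x\<bar> \<le> S t (\<lambda>y. \<bar>f y - g y\<bar>) x"
proof -
  have d: "(\<lambda>y. \<bar>f y - g y\<bar>) \<in> L2 M" using L2_abs L2_diff f g by blast
  have "AE x in M. S t f x \<le> S t (\<lambda>y. g y + \<bar>f y - g y\<bar>) x"
    by (rule S_mono[OF t f L2_add[OF g d]]) auto
  moreover have "AE x in M. S t g x \<le> S t (\<lambda>y. f y + \<bar>f y - g y\<bar>) x"
    by (rule S_mono[OF t g L2_add[OF f d]]) auto
  ultimately show ?thesis using S_add[OF t g d] S_add[OF t f d] by eventually_elim auto
qed

text \<open>Test with the cutoff functions: \<open>inner2 M (T s f) (\<phi> k) = inner2 M f (T s (\<phi> k)) \<le> \<integral> f\<close>, since \<open>T s (\<phi> k) \<le> 1\<close>.\<close>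

lemma S_L1:
  assumes t: "0 < t" and f: "f \<in> L2 M" and nonneg: "AE x in M. 0 \<le> f x" and int: "integrable M f"
  shows "(\<integral>\<^sup>+x. ennreal (S t f x) \<partial>M) \<le> ennreal t * (\<integral>\<^sup>+x. ennreal (f x) \<partial>M)"
proof -
  note [measurable] = S_measurable[OF t f]
  have \<phi>0: "AE x in M. 0 \<le> \<phi> k x" and \<phi>1: "AE x in M. 0 \<le> \<phi> k x \<and> \<phi> k x \<le> 1" for k
    using cutoff_AE by (auto elim!: eventually_mono simp: less_imp_le)
  have "inner2 M (S t f) (\<phi> k) \<le> t * (\<integral>x. f x \<partial>M)" for k
  proof -
    have "inner2 M (T s f) (\<phi> k) \<le> (\<integral>x. f x \<partial>M)" if s: "0 < s" for s
      unfolding T_sym[OF s f cutoff_L2]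
    proof (unfold inner2_def, rule integral_mono_AE[OF L2_mult_integrable[OF f T_mem[OF s cutoff_L2]] int])
      show "AE x in M. f x * T s (\<phi> k) x \<le> f x"
        using T_unit(2)[OF s cutoff_L2 \<phi>1, of k] nonneg by eventually_elim (simp add: mult_left_le)
    qed
    then have "inner2 M (S t f) (\<phi> k) \<le> (LINT s:{0<..t}|lborel. (\<integral>x. f x \<partial>M))"
      unfolding S_inner2[OF t f cutoff_L2]
      using t by (intro set_integral_mono T_inner2_set_integrable f)
        (auto simp: set_integrable_def intro!: integrable_mult_left)
    also have "\<dots> = t * (\<integral>x. f x \<partial>M)" using t by (subst set_integral_const) auto
    finally show ?thesis .
  qed
  then have le: "ennreal (inner2 M (S t f) (\<phi> k)) \<le> ennreal t * ennreal (\<integral>x. f x \<partial>M)" for k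
    using t integral_nonneg_AE[OF nonneg] by (simp add: ennreal_mult[symmetric] ennreal_leI)
  have "(\<integral>\<^sup>+x. ennreal (S t f x) \<partial>M) = (SUP k. \<integral>\<^sup>+x. ennreal (\<phi> k x) * ennreal (S t f x) \<partial>M)"
    using nn_integral_exhausts[OF exhausts_cutoff, of "\<lambda>x. ennreal (S t f x)"] by simp
  also have "\<dots> = (SUP k. ennreal (inner2 M (S t f) (\<phi> k)))"
    using nn_integral_inner2[OF S_mem[OF t f] S_nonneg[OF t f nonneg] cutoff_L2 \<phi>0] by (simp add: mult.commute)
  also have "\<dots> \<le> ennreal t * ennreal (\<integral>x. f x \<partial>M)" using le by (intro SUP_least)
  also have "ennreal (\<integral>x. f x \<partial>M) = (\<integral>\<^sup>+x. ennreal (f x) \<partial>M)"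
    using nn_integral_eq_integral[OF int nonneg] by simp
  finally show ?thesis .
qed

text \<open>Split the interval of integration at \<open>t\<close> and move \<open>T t\<close> to the test function in the second part.\<close>

lemma S_semigroup:
  assumes s: "0 < s" and t: "0 < t" and f: "f \<in> L2 M"
  shows "AE x in M. S (t + s) f x = S t f x + T t (S s f) x"
proof -
  have st: "0 < t + s" using s t by simp
  have "AE x in M. S (t + s) f x = (S t f + T t (S s f)) x"
  proof (rule AE_eq_if_inner2_eq[of "S (t + s) f" "S t f + T t (S s f)"])
    fix h assume h: "h \<in> L2 M"
    let ?F = "\<lambda>r. inner2 M (T r f) h"
    have "inner2 M (T t (S s f)) h = inner2 M (S s f) (T t h)" using T_sym t s f h by simp
    also have "\<dots> = (LINT r:{0<..s}|lborel. ?F (t + r))"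
      unfolding S_inner2[OF s f T_mem[OF t h]]
    proof (rule set_lebesgue_integral_cong)
      show "\<forall>r. r \<in> {0<..s} \<longrightarrow> inner2 M (T r f) (T t h) = ?F (t + r)"
      proof (intro allI impI)
        fix r assume "r \<in> {0<..s}"
        then have r: "0 < r" by simp
        have "inner2 M (T r f) (T t h) = inner2 M (T t (T r f)) h" using T_sym[OF t T_mem[OF r f] h] by simp
        also have "\<dots> = ?F (t + r)"
          using ip_null_left[OF _ _ h null_sym[OF _ _ semigroup_add[OF form_semigroup t r f]]] t r f by simp
        finally show "inner2 M (T r f) (T t h) = ?F (t + r)" .
      qed
    qed simp
    also have "\<dots> = (LINT r:{t<..t + s}|lborel. ?F r)"
    proof -
      have "(\<integral>r. indicator {t<..t + s} r *\<^sub>R ?F r \<partial>lborel) = (\<integral>r. indicator {t<..t + s} (t + r) *\<^sub>R ?F (t + r) \<partial>lborel)"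
        using lborel_integral_real_affine[of 1 "\<lambda>r. indicator {t<..t + s} r *\<^sub>R ?F r" t] by simp
      also have "\<dots> = (\<integral>r. indicator {0<..s} r *\<^sub>R ?F (t + r) \<partial>lborel)"
        by (rule Bochner_Integration.integral_cong) (auto simp: indicator_def)
      finally show ?thesis by (simp add: set_lebesgue_integral_def)
    qed
    finally have 1: "inner2 M (T t (S s f)) h = (LINT r:{t<..t + s}|lborel. ?F r)" .
    have un: "{0<..t + s} = {0<..t} \<union> {t<..t + s}" using s t by auto
    have "inner2 M (S (t + s) f) h = (LINT r:{0<..t}|lborel. ?F r) + (LINT r:{t<..t + s}|lborel. ?F r)"
      unfolding S_inner2[OF st f h] un
      by (rule set_integral_Un) (use T_inner2_set_integrable[OF f h] t in auto)
    then show "inner2 M (S (t + s) f) h = inner2 M (S t f + T t (S s f)) h"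
      using 1 S_inner2[OF t f h] s t f h by (simp add: ip_simps)
  qed (use s t st f in simp_all)
  then show ?thesis by simp
qed

definition Q :: "real \<Rightarrow> ('a \<Rightarrow> ennreal) \<Rightarrow> 'a \<Rightarrow> ennreal" where
  "Q t u x = (SUP k. ennreal (S t (cut u k) x))"

lemma exhausts_S:
  assumes t: "0 < t" and u: "u \<in> borel_measurable M"
  shows "exhausts (\<lambda>k. S t (cut u k)) (Q t u)"
proof -
  note m = exhausts_mem[OF exhausts_cut[OF u]] and ae = exhausts_AE[OF exhausts_cut[OF u]]
  have "AE x in M. 0 \<le> cut u k x" for k using ae by eventually_elim simp
  then have "AE x in M. \<forall>k. 0 \<le> S t (cut u k) x"
    unfolding AE_all_countable using S_nonneg[OF t m] by blast
  moreover have "AE x in M. cut u k x \<le> cut u (Suc k) x" for k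
    using ae by eventually_elim (intro incseq_app, blast)
  then have "AE x in M. \<forall>k. S t (cut u k) x \<le> S t (cut u (Suc k)) x"
    unfolding AE_all_countable using S_mono[OF t m m] by blast
  ultimately have "AE x in M. (\<forall>k. 0 \<le> S t (cut u k) x) \<and> incseq (\<lambda>k. S t (cut u k) x)"
    by eventually_elim (auto intro: incseq_SucI)
  then show ?thesis using t m by (simp add: exhausts_def Q_def)
qed

lemma Q_measurable [measurable]:
  assumes t: "0 < t" and u: "u \<in> borel_measurable M"
  shows "Q t u \<in> borel_measurable M"
proof -
  have [measurable]: "S t (cut u k) \<in> borel_measurable M" for k
    using S_measurable[OF t exhausts_mem[OF exhausts_cut[OF u]]] .
  show ?thesis unfolding Q_def by measurable
qed

lemma Q_semigroup:
  assumes s: "0 < s" and t: "0 < t" and u: "u \<in> borel_measurable M"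
  shows "AE x in M. Q (t + s) u x = Q t u x + P t (Q s u) x"
proof -
  note ex = exhausts_S[OF s u]
  have "AE x in M. \<forall>k. S (t + s) (cut u k) x = S t (cut u k) x + T t (S s (cut u k)) x"
    unfolding AE_all_countable using S_semigroup[OF s t exhausts_mem[OF exhausts_cut[OF u]]] by blast
  then show ?thesis
    using exhausts_AE[OF exhausts_S[OF t u]] exhausts_AE[OF exhausts_T[OF t Q_measurable[OF s u] ex]]
  proof eventually_elim
    case (elim x)
    have inc: "incseq (\<lambda>k. ennreal (S t (cut u k) x))" "incseq (\<lambda>k. ennreal (T t (S s (cut u k)) x))"
      using elim by (auto simp: incseq_def intro: ennreal_leI)
    have "Q (t + s) u x = (SUP k. ennreal (S t (cut u k) x) + ennreal (T t (S s (cut u k)) x))"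
      unfolding Q_def using elim by (simp add: ennreal_plus)
    also have "\<dots> = (SUP k. ennreal (S t (cut u k) x)) + (SUP k. ennreal (T t (S s (cut u k)) x))"
      using inc by (intro ennreal_SUP_add)
    finally show ?case using elim by simp
  qed
qed

lemma cut_le: "ennreal (cut u k x) \<le> u x"
proof -
  have "ennreal (cut u k x) = min (u x) (ennreal (real k * \<phi> k x))"
    unfolding cut_def by (rule ennreal_enn2real) (simp add: min.strict_coboundedI2)
  then show ?thesis by simp
qed

lemma cut_nonneg [simp]: "0 \<le> cut u k x"
  by (simp add: cut_def)

lemma cut_integrable:
  assumes u: "u \<in> borel_measurable M" and int: "(\<integral>\<^sup>+x. u x \<partial>M) < \<infinity>"
  shows "integrable M (cut u k)"
proof (rule integrableI_bounded)
  show "cut u k \<in> borel_measurable M" using L2_measurable[OF exhausts_mem[OF exhausts_cut[OF u]]] .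
  have "(\<integral>\<^sup>+x. ennreal (norm (cut u k x)) \<partial>M) \<le> (\<integral>\<^sup>+x. u x \<partial>M)"
    by (intro nn_integral_mono) (simp add: cut_le)
  then show "(\<integral>\<^sup>+x. ennreal (norm (cut u k x)) \<partial>M) < \<infinity>" using int by simp
qed

lemma Q_L1:
  assumes t: "0 < t" and u: "u \<in> borel_measurable M" and int: "(\<integral>\<^sup>+x. u x \<partial>M) < \<infinity>"
  shows "(\<integral>\<^sup>+x. Q t u x \<partial>M) < \<infinity>"
proof -
  have "(\<integral>\<^sup>+x. Q t u x * 1 \<partial>M) = (SUP k. \<integral>\<^sup>+x. ennreal (S t (cut u k) x) * 1 \<partial>M)"
    by (rule nn_integral_exhausts[OF exhausts_S[OF t u]]) simp
  also have "\<dots> \<le> ennreal t * (\<integral>\<^sup>+x. u x \<partial>M)"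
  proof (rule SUP_least)
    fix k
    have "(\<integral>\<^sup>+x. ennreal (S t (cut u k) x) \<partial>M) \<le> ennreal t * (\<integral>\<^sup>+x. ennreal (cut u k x) \<partial>M)"
      by (rule S_L1[OF t exhausts_mem[OF exhausts_cut[OF u]] _ cut_integrable[OF u int]]) simp
    also have "\<dots> \<le> ennreal t * (\<integral>\<^sup>+x. u x \<partial>M)"
      by (intro mult_left_mono nn_integral_mono cut_le) simp
    finally show "(\<integral>\<^sup>+x. ennreal (S t (cut u k) x) * 1 \<partial>M) \<le> ennreal t * (\<integral>\<^sup>+x. u x \<partial>M)" by simp
  qed
  also have "\<dots> < \<infinity>" using int by (simp add: ennreal_mult_less_top)
  finally show ?thesis by simp
qed

section \<open>The potential operator\<close>

lemma dist1_sym: "dist1 M f g = dist1 M g f"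
  by (simp add: dist1_def abs_minus_commute)

lemma dist1_triangle:
  assumes [measurable]: "f \<in> borel_measurable M" "g \<in> borel_measurable M" "h \<in> borel_measurable M"
  shows "dist1 M f h \<le> dist1 M f g + dist1 M g h"
proof -
  have "dist1 M f h \<le> (\<integral>\<^sup>+x. ennreal \<bar>f x - g x\<bar> + ennreal \<bar>g x - h x\<bar> \<partial>M)"
    unfolding dist1_def by (intro nn_integral_mono) (simp add: ennreal_plus[symmetric] ennreal_leI del: ennreal_plus)
  also have "\<dots> = dist1 M f g + dist1 M g h"
    unfolding dist1_def by (rule nn_integral_add) measurable
  finally show ?thesis .
qed

lemma dist1_S_le:
  assumes t: "0 < t" and f: "f \<in> L1 M \<inter> L2 M" and g: "g \<in> L1 M \<inter> L2 M"
  shows "dist1 M (S t f) (S t g) \<le> ennreal t * dist1 M f g"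
proof -
  have d: "(\<lambda>y. \<bar>f y - g y\<bar>) \<in> L2 M" using L2_abs L2_diff f g by blast
  have "dist1 M (S t f) (S t g) \<le> (\<integral>\<^sup>+x. ennreal (S t (\<lambda>y. \<bar>f y - g y\<bar>) x) \<partial>M)"
    unfolding dist1_def using S_abs_diff_le[OF t, of f g] f g
    by (intro nn_integral_mono_AE) (auto elim!: eventually_mono intro: ennreal_leI)
  also have "\<dots> \<le> ennreal t * dist1 M f g"
    unfolding dist1_def by (rule S_L1[OF t d]) (use f g in \<open>auto simp: L1_def\<close>)
  finally show ?thesis .
qed

lemma dist1_exhausts_tendsto:
  assumes p: "exhausts p u" and fin: "(\<integral>\<^sup>+x. u x \<partial>M) < \<infinity>" and u: "u \<in> borel_measurable M"
    and f: "f \<in> borel_measurable M" "AE x in M. u x = ennreal (f x) \<and> 0 \<le> f x"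
  shows "(\<lambda>k. dist1 M (p k) f) \<longlonglongrightarrow> 0"
proof -
  note [measurable] = L2_measurable[OF exhausts_mem[OF p]] f(1) u
  have "(\<lambda>k. \<integral>\<^sup>+x. ennreal \<bar>p k x - f x\<bar> \<partial>M) \<longlonglongrightarrow> (\<integral>\<^sup>+x. 0 \<partial>M)"
  proof (rule nn_integral_dominated_convergence[where w = u])
    have *: "AE x in M. (\<forall>k. 0 \<le> p k x \<and> p k x \<le> f x) \<and> (\<lambda>k. p k x) \<longlonglongrightarrow> f x"
      using exhausts_AE[OF p] f(2)
    proof eventually_elim
      case (elim x)
      have inc: "incseq (\<lambda>k. ennreal (p k x))" using elim by (auto simp: incseq_def intro: ennreal_leI)
      have "(\<lambda>k. ennreal (p k x)) \<longlonglongrightarrow> ennreal (f x)" using LIMSEQ_SUP[OF inc] elim by metis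
      then have lim: "(\<lambda>k. p k x) \<longlonglongrightarrow> f x" using elim by (subst (asm) tendsto_ennreal_iff) auto
      moreover have "p k x \<le> f x" for k using incseq_le[OF _ lim] elim by blast
      ultimately show ?case using elim by blast
    qed
    show "AE x in M. ennreal \<bar>p k x - f x\<bar> \<le> u x" for k
      using * f(2) by eventually_elim (auto intro!: ennreal_leI)
    show "AE x in M. (\<lambda>k. ennreal \<bar>p k x - f x\<bar>) \<longlonglongrightarrow> 0"
      using *
    proof eventually_elim
      case (elim x)
      then have "(\<lambda>k. ennreal \<bar>p k x - f x\<bar>) \<longlonglongrightarrow> ennreal \<bar>f x - f x\<bar>" by (intro tendsto_intros) auto
      then show ?case by simp
    qed
  qed (use fin in auto)
  then show ?thesis by (simp add: dist1_def)
qed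

lemma L1_pos_nn_integral: "f \<in> L1_pos M \<Longrightarrow> (\<integral>\<^sup>+x. ennreal (f x) \<partial>M) < \<infinity>"
  by (auto simp: L1_pos_def L1_def nn_integral_eq_integral)

lemma L1_pos_measurable: "f \<in> L1_pos M \<Longrightarrow> f \<in> borel_measurable M"
  by (auto simp: L1_pos_def L1_def)

text \<open>By monotone convergence \<open>S t (cut f k)\<close> converges to \<open>Q t f\<close> in \<open>L\<^sup>1\<close>. As \<open>S t\<close> is Lipschitz continuous with
  respect to \<open>dist1\<close>, the images of every other sequence that converges to \<open>f\<close> have the same limit. So the condition
  in the definition of \<open>S1\<close> can be satisfied, and only by \<open>Q t f\<close>.\<close>

lemma S1_eq_Q:
  assumes t: "0 < t" and f: "f \<in> L1_pos M"
  shows "AE x in M. ennreal (S1 M D E t f x) = Q t (\<lambda>y. ennreal (f y)) x"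
    and "f \<in> L2 M \<Longrightarrow> AE x in M. S1 M D E t f x = S t f x"
proof -
  note [measurable] = L1_pos_measurable[OF f]
  let ?u = "\<lambda>y. ennreal (f y)"
  have u: "?u \<in> borel_measurable M" by measurable
  note fin = L1_pos_nn_integral[OF f] and Qm [measurable] = Q_measurable[OF t u]
  note Qfin = Q_L1[OF t u fin]
  define g where "g x = enn2real (Q t ?u x)" for x
  have [measurable]: "g \<in> borel_measurable M" unfolding g_def by measurable
  have "AE x in M. Q t ?u x \<noteq> \<infinity>" by (rule nn_integral_PInf_AE) (use Qfin in auto)
  then have gQ: "AE x in M. Q t ?u x = ennreal (g x) \<and> 0 \<le> g x"
    by eventually_elim (auto simp: g_def less_top)
  have "(\<integral>\<^sup>+x. ennreal (norm (g x)) \<partial>M) = (\<integral>\<^sup>+x. Q t ?u x \<partial>M)"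
    by (rule nn_integral_cong_AE) (use gQ in \<open>eventually_elim, simp\<close>)
  then have g1: "g \<in> L1 M" unfolding L1_def using Qfin by (auto intro!: integrableI_bounded)
  have cut1: "cut ?u k \<in> L1 M \<inter> L2 M" for k
    using cut_integrable[OF u fin] exhausts_mem[OF exhausts_cut[OF u]] by (simp add: L1_def)
  have lim_cut: "(\<lambda>k. dist1 M (cut ?u k) f) \<longlonglongrightarrow> 0"
    by (rule dist1_exhausts_tendsto[OF exhausts_cut[OF u] fin u]) (use f in \<open>auto simp: L1_pos_def L1_def\<close>)
  have lim_S: "(\<lambda>k. dist1 M (S t (cut ?u k)) g) \<longlonglongrightarrow> 0"
    by (rule dist1_exhausts_tendsto[OF exhausts_S[OF t u] Qfin Qm _ gQ]) measurable
  let ?prop = "\<lambda>g. g \<in> L1 M \<and> (\<forall>F. (\<forall>n. F n \<in> L1 M \<inter> L2 M) \<longrightarrow> (\<lambda>n. dist1 M (F n) f) \<longlonglongrightarrow> 0 \<longrightarrow>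
        (\<lambda>n. dist1 M (S t (F n)) g) \<longlonglongrightarrow> 0)"
  have "?prop g"
  proof (intro conjI allI impI g1)
    fix F assume F: "\<forall>n. F n \<in> L1 M \<inter> L2 M" and lim: "(\<lambda>n. dist1 M (F n) f) \<longlonglongrightarrow> 0"
    have [measurable]: "F n \<in> borel_measurable M" "cut ?u n \<in> borel_measurable M"
      "S t (F n) \<in> borel_measurable M" "S t (cut ?u n) \<in> borel_measurable M" for n
      using F cut1 S_measurable[OF t] by (auto intro: L2_measurable)
    have "(\<lambda>n. ennreal t * (dist1 M (F n) f + dist1 M (cut ?u n) f) + dist1 M (S t (cut ?u n)) g) \<longlonglongrightarrow> ennreal t * (0 + 0) + 0"
      by (intro tendsto_intros ennreal_tendsto_cmult lim lim_cut lim_S) auto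
    then have "(\<lambda>n. ennreal t * (dist1 M (F n) f + dist1 M (cut ?u n) f) + dist1 M (S t (cut ?u n)) g) \<longlonglongrightarrow> 0" by simp
    then show "(\<lambda>n. dist1 M (S t (F n)) g) \<longlonglongrightarrow> 0"
    proof (rule tendsto_sandwich[OF _ _ tendsto_const, rotated 2])
      have "dist1 M (S t (F n)) g \<le> ennreal t * (dist1 M (F n) f + dist1 M (cut ?u n) f) + dist1 M (S t (cut ?u n)) g" for n
      proof -
        have "dist1 M (S t (F n)) g \<le> dist1 M (S t (F n)) (S t (cut ?u n)) + dist1 M (S t (cut ?u n)) g"
          by (rule dist1_triangle) measurable
        also have "dist1 M (S t (F n)) (S t (cut ?u n)) \<le> ennreal t * dist1 M (F n) (cut ?u n)"
          using dist1_S_le[OF t] F cut1 by blast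
        also have "dist1 M (F n) (cut ?u n) \<le> dist1 M (F n) f + dist1 M f (cut ?u n)"
          by (rule dist1_triangle) measurable
        finally show ?thesis by (simp add: dist1_sym[of f] mult_left_mono add_mono)
      qed
      then show "\<forall>\<^sub>F n in sequentially. dist1 M (S t (F n)) g \<le> ennreal t * (dist1 M (F n) f + dist1 M (cut ?u n) f) + dist1 M (S t (cut ?u n)) g"
        by simp
    qed simp
  qed
  then have limits: "?prop (S1 M D E t f)"
    unfolding S1_def by (rule someI[of ?prop])
  then have "S1 M D E t f \<in> L1 M" by blast
  then have [measurable]: "S1 M D E t f \<in> borel_measurable M" by (simp add: L1_def)
  have dist1_0: "AE x in M. h x = k x"
    if "dist1 M h k = 0" and [measurable]: "h \<in> borel_measurable M" "k \<in> borel_measurable M" for h k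
  proof -
    have "AE x in M. ennreal \<bar>h x - k x\<bar> = 0"
      using that(1) unfolding dist1_def by (subst (asm) nn_integral_0_iff_AE) auto
    then show ?thesis by eventually_elim auto
  qed
  {
    assume f2: "f \<in> L2 M"
    then have fm: "f \<in> L1 M \<inter> L2 M" using f by (simp add: L1_pos_def)
    moreover have "dist1 M f f = 0" by (simp add: dist1_def)
    ultimately have "(\<lambda>n::nat. dist1 M (S t f) (S1 M D E t f)) \<longlonglongrightarrow> 0"
      using conjunct2[OF limits] by (elim allE[of _ "\<lambda>_. f"]) auto
    then have "dist1 M (S1 M D E t f) (S t f) = 0" by (simp add: LIMSEQ_const_iff dist1_sym)
    then show "AE x in M. S1 M D E t f x = S t f x" by (rule dist1_0) (use S_measurable[OF t f2] in auto)
  }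
  have lim1: "(\<lambda>k. dist1 M (S t (cut ?u k)) (S1 M D E t f)) \<longlonglongrightarrow> 0"
    using limits cut1 lim_cut by blast
  have [measurable]: "S t (cut ?u n) \<in> borel_measurable M" for n
    using cut1 S_measurable[OF t] by (auto intro: L2_measurable)
  have "dist1 M (S1 M D E t f) g \<le> dist1 M (S t (cut ?u k)) (S1 M D E t f) + dist1 M (S t (cut ?u k)) g" for k
    using dist1_triangle[of "S1 M D E t f" "S t (cut ?u k)" g] by (simp add: dist1_sym)
  moreover have "(\<lambda>k. dist1 M (S t (cut ?u k)) (S1 M D E t f) + dist1 M (S t (cut ?u k)) g) \<longlonglongrightarrow> 0 + 0"
    by (intro tendsto_add lim1 lim_S)
  ultimately have "dist1 M (S1 M D E t f) g \<le> 0 + 0" using LIMSEQ_le_const by blast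
  then have "AE x in M. S1 M D E t f x = g x" by (intro dist1_0) auto
  with gQ show "AE x in M. ennreal (S1 M D E t f x) = Q t ?u x" by eventually_elim auto
qed

lemma Q_eq_S:
  assumes t: "0 < t" and f: "f \<in> L1_pos M" "f \<in> L2 M"
  shows "AE x in M. Q t (\<lambda>y. ennreal (f y)) x = ennreal (S t f x)"
  using S1_eq_Q(1)[OF t f(1)] S1_eq_Q(2)[OF t f] by eventually_elim simp

text \<open>The indices start at \<open>1\<close>, because \<open>Q\<close> is only considered for positive times. The sequence increases, so this
  does not affect its limit \<open>K\<close>.\<close>

definition potential :: "('a \<Rightarrow> ennreal) \<Rightarrow> 'a \<Rightarrow> ennreal" where
  "potential u x = (SUP n. Q (real (Suc n)) u x)"

lemma potential_measurable [measurable]: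
  "u \<in> borel_measurable M \<Longrightarrow> potential u \<in> borel_measurable M"
  unfolding potential_def by measurable

lemma Q_le:
  assumes s: "0 < s" and st: "s \<le> t" and u: "u \<in> borel_measurable M"
  shows "AE x in M. Q s u x \<le> Q t u x"
proof (cases "s = t")
  case False
  then have "0 < t - s" using st by simp
  from Q_semigroup[OF this s u] show ?thesis by eventually_elim simp
qed simp

lemma Q_incseq:
  assumes u: "u \<in> borel_measurable M"
  shows "AE x in M. incseq (\<lambda>n. Q (real (Suc n)) u x)"
proof -
  have "AE x in M. \<forall>n. Q (real (Suc n)) u x \<le> Q (real (Suc (Suc n))) u x"
    unfolding AE_all_countable using Q_le u by simp
  then show ?thesis by eventually_elim (auto intro: incseq_SucI)
qed

lemma Q_le_potential:
  assumes t: "0 < t" and u: "u \<in> borel_measurable M"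
  shows "AE x in M. Q t u x \<le> potential u x"
proof -
  obtain n :: nat where "t \<le> real n" using real_arch_simple by blast
  then have "AE x in M. Q t u x \<le> Q (real (Suc n)) u x" using Q_le[OF t _ u] by simp
  then show ?thesis unfolding potential_def by eventually_elim (auto intro: SUP_upper2)
qed

lemma K_eq_potential:
  assumes f: "f \<in> L1_pos M"
  shows "AE x in M. K M D E f x = potential (\<lambda>y. ennreal (f y)) x"
proof -
  let ?u = "\<lambda>y. ennreal (f y)"
  have u: "?u \<in> borel_measurable M" using L1_pos_measurable[OF f] by simp
  have "AE x in M. \<forall>n. ennreal (S1 M D E (real (Suc n)) f x) = Q (real (Suc n)) ?u x"
    unfolding AE_all_countable using S1_eq_Q(1)[OF _ f] by simp
  with Q_incseq[OF u] show ?thesis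
  proof eventually_elim
    case (elim x)
    have "(\<lambda>n. ennreal (S1 M D E (real (Suc n)) f x)) \<longlonglongrightarrow> potential ?u x"
      using LIMSEQ_SUP[OF elim(1)] elim(2) by (simp add: potential_def)
    then have "(\<lambda>n. ennreal (S1 M D E (real n) f x)) \<longlonglongrightarrow> potential ?u x"
      by (rule LIMSEQ_imp_Suc[of "\<lambda>n. ennreal (S1 M D E (real n) f x)"])
    then show ?case unfolding K_def by (rule limI)
  qed
qed

end

section \<open>Invariant sets, recurrence and conservativeness\<close>

context sigma_finite_dirichlet_form
begin


lemma potential_ge:
  assumes t: "0 < t" and u: "u \<in> borel_measurable M"
  shows "AE x in M. Q t u x + P t (potential u) x \<le> potential u x"
proof -
  have m: "Q (real (Suc n)) u \<in> borel_measurable M" for n by (rule Q_measurable[OF _ u]) simp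
  have "AE x in M. Q t u x + P t (Q (real (Suc n)) u) x \<le> potential u x" for n
    using Q_semigroup[OF _ t u, of "real (Suc n)"] Q_le_potential[OF _ u, of "t + real (Suc n)"] t
    by (auto elim!: eventually_elim2)
  then have "AE x in M. \<forall>n. Q t u x + P t (Q (real (Suc n)) u) x \<le> potential u x"
    unfolding AE_all_countable by blast
  with P_SUP[OF t m Q_incseq[OF u]] show ?thesis
    unfolding potential_def[abs_def]
  proof eventually_elim
    case (elim x)
    have "Q t u x + (SUP n. P t (Q (real (Suc n)) u) x) = (SUP n. Q t u x + P t (Q (real (Suc n)) u) x)"
      by (simp add: ennreal_SUP_add_right)
    then show ?case using elim by (auto intro!: SUP_least)
  qed
qed

lemma P_potential_le:
  assumes t: "0 < t" and u: "u \<in> borel_measurable M"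
  shows "AE x in M. P t (potential u) x \<le> potential u x"
  using potential_ge[OF assms] by eventually_elim (erule order_trans[rotated], simp)

text \<open>The key step towards recurrence. For \<open>h = min (potential u) c\<close> and every \<open>m\<close>, symmetry gives
  \<open>\<integral> (h - P t h) * Q m g = \<integral> h * (Q m g - P t (Q m g)) \<le> \<integral> h * Q t g \<le> c * \<integral> Q t g\<close>. Letting \<open>m\<close> tend to
  infinity, \<open>(h - P t h) * potential g\<close> has a finite integral, so \<open>h = P t h\<close> wherever \<open>potential g\<close> is
  infinite.\<close>

lemma truncated_potential_invariant:
  assumes t: "0 < t" and u: "u \<in> borel_measurable M"
    and g: "g \<in> borel_measurable M" "(\<integral>\<^sup>+x. g x \<partial>M) < \<infinity>"
  shows "AE x in M. potential g x = \<infinity> \<longrightarrow> min (potential u x) (of_nat c) \<le> P t (potential u) x"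
proof -
  note [measurable] = u g(1) P_measurable[OF t] Q_measurable[OF t]
  define h where "h x = min (potential u x) (of_nat c)" for x
  have hm [measurable]: "h \<in> borel_measurable M" unfolding h_def by measurable
  have Phm [measurable]: "P t h \<in> borel_measurable M" by measurable
  have Ph_pot: "AE x in M. P t h x \<le> P t (potential u) x" by (rule P_mono[OF t]) (auto simp: h_def)
  have Ph: "AE x in M. P t h x \<le> h x"
  proof -
    have "AE x in M. P t h x \<le> of_nat c" by (rule P_le_const[OF t hm]) (simp add: h_def)
    with Ph_pot P_potential_le[OF t u] show ?thesis by eventually_elim (auto simp: h_def)
  qed
  let ?C = "\<integral>\<^sup>+x. h x * Q t g x \<partial>M"
  have fin: "(\<integral>\<^sup>+x. h x * Q s g x \<partial>M) < \<infinity>" if s: "0 < s" for s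
  proof -
    note [measurable] = Q_measurable[OF s g(1)]
    have "(\<integral>\<^sup>+x. h x * Q s g x \<partial>M) \<le> (\<integral>\<^sup>+x. of_nat c * Q s g x \<partial>M)"
      by (intro nn_integral_mono mult_right_mono) (auto simp: h_def)
    also have "\<dots> = of_nat c * (\<integral>\<^sup>+x. Q s g x \<partial>M)" by (rule nn_integral_cmult) measurable
    also have "\<dots> < \<infinity>" using Q_L1[OF s g] by (simp add: ennreal_mult_less_top of_nat_less_top)
    finally show ?thesis .
  qed
  have bound: "(\<integral>\<^sup>+x. (h x - P t h x) * Q (real (Suc m)) g x \<partial>M) \<le> ?C" for m
  proof -
    let ?m = "real (Suc m)"
    have m: "0 < ?m" by simp
    note [measurable] = Q_measurable[OF m g(1)]
    let ?B = "\<integral>\<^sup>+x. P t h x * Q ?m g x \<partial>M"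
    have "(\<integral>\<^sup>+x. (h x - P t h x) * Q ?m g x \<partial>M) + ?B
        = (\<integral>\<^sup>+x. (h x - P t h x) * Q ?m g x + P t h x * Q ?m g x \<partial>M)"
      by (rule nn_integral_add[symmetric]) measurable
    also have "\<dots> = (\<integral>\<^sup>+x. h x * Q ?m g x \<partial>M)"
    proof (rule nn_integral_cong_AE)
      show "AE x in M. (h x - P t h x) * Q ?m g x + P t h x * Q ?m g x = h x * Q ?m g x"
        using Ph by eventually_elim (simp add: distrib_right[symmetric] diff_add_cancel_ennreal)
    qed
    also have "\<dots> \<le> (\<integral>\<^sup>+x. h x * Q t g x + h x * P t (Q ?m g) x \<partial>M)"
    proof (rule nn_integral_mono_AE)
      show "AE x in M. h x * Q ?m g x \<le> h x * Q t g x + h x * P t (Q ?m g) x"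
        using Q_semigroup[OF m t g(1)] Q_le[OF m _ g(1), of "t + ?m"] t
        by (auto elim!: eventually_elim2 simp: distrib_left[symmetric] intro!: mult_left_mono)
    qed
    also have "\<dots> = ?C + (\<integral>\<^sup>+x. h x * P t (Q ?m g) x \<partial>M)" by (rule nn_integral_add) measurable
    also have "(\<integral>\<^sup>+x. h x * P t (Q ?m g) x \<partial>M) = ?B" by (rule P_sym[OF t, symmetric]) measurable
    finally have le: "(\<integral>\<^sup>+x. (h x - P t h x) * Q ?m g x \<partial>M) + ?B \<le> ?C + ?B" .
    have "?B \<le> (\<integral>\<^sup>+x. h x * Q ?m g x \<partial>M)"
      using Ph by (intro nn_integral_mono_AE) (auto elim!: eventually_mono intro: mult_right_mono)
    then have "?B \<noteq> \<infinity>" using fin[OF m] by (auto simp: top_unique)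
    moreover have "?B + (\<integral>\<^sup>+x. (h x - P t h x) * Q ?m g x \<partial>M) \<le> ?B + ?C" using le by (simp only: add.commute)
    ultimately show ?thesis using iffD1[OF ennreal_add_left_cancel_le] by blast
  qed
  have "(\<integral>\<^sup>+x. (h x - P t h x) * potential g x \<partial>M) = (\<integral>\<^sup>+x. (SUP m. (h x - P t h x) * Q (real (Suc m)) g x) \<partial>M)"
    by (simp add: potential_def SUP_mult_left_ennreal)
  also have "\<dots> = (SUP m. \<integral>\<^sup>+x. (h x - P t h x) * Q (real (Suc m)) g x \<partial>M)"
  proof (rule nn_integral_monotone_convergence_SUP_AE)
    show "AE x in M. (h x - P t h x) * Q (real (Suc m)) g x \<le> (h x - P t h x) * Q (real (Suc (Suc m))) g x" for m
      using Q_incseq[OF g(1)] by eventually_elim (intro mult_left_mono incseq_app[of "\<lambda>m x. Q (real (Suc m)) g x"], auto)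
    show "(\<lambda>x. (h x - P t h x) * Q (real (Suc m)) g x) \<in> borel_measurable M" for m
      using Q_measurable[OF _ g(1), of "real (Suc m)"] by measurable
  qed
  also have "\<dots> \<le> ?C" using bound by (intro SUP_least)
  also have "\<dots> < \<infinity>" by (rule fin[OF t])
  finally have "AE x in M. (h x - P t h x) * potential g x \<noteq> \<infinity>"
    by (intro nn_integral_PInf_AE) auto
  then show ?thesis
    using Ph_pot
  proof eventually_elim
    case (elim x)
    show ?case
    proof
      assume "potential g x = \<infinity>"
      then have "h x - P t h x = 0" using elim(1) by (auto simp: ennreal_mult_eq_top_iff)
      moreover have "h x < \<infinity>" unfolding h_def by (simp add: min.strict_coboundedI2 of_nat_less_top)
      ultimately have "h x \<le> P t h x" by (simp add: diff_eq_0_iff_ennreal)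
      then show "min (potential u x) (of_nat c) \<le> P t (potential u) x" using elim(2) by (simp add: h_def)
    qed
  qed
qed

text \<open>Letting \<open>c\<close> tend to infinity in the preceding lemma, \<open>potential u \<le> P t (potential u)\<close> wherever
  \<open>potential g\<close> is infinite. As \<open>Q t u + P t (potential u) \<le> potential u\<close>, a finite value of \<open>potential u\<close> there
  forces \<open>Q t u = 0\<close> for all \<open>t\<close>.\<close>

lemma potential_dichotomy:
  assumes u: "u \<in> borel_measurable M" and g: "g \<in> borel_measurable M" "(\<integral>\<^sup>+x. g x \<partial>M) < \<infinity>"
  shows "AE x in M. potential g x = \<infinity> \<longrightarrow> potential u x \<in> {0, \<infinity>}"
proof -
  have "AE x in M. \<forall>n c. potential g x = \<infinity> \<longrightarrow> min (potential u x) (of_nat c) \<le> P (real (Suc n)) (potential u) x"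
    unfolding AE_all_countable using truncated_potential_invariant[OF _ u g] by simp
  moreover have "AE x in M. \<forall>n. Q (real (Suc n)) u x + P (real (Suc n)) (potential u) x \<le> potential u x"
    unfolding AE_all_countable using potential_ge[OF _ u] by simp
  ultimately show ?thesis
  proof eventually_elim
    case (elim x)
    have "potential u x = 0" if inf: "potential g x = \<infinity>" and fin: "potential u x \<noteq> \<infinity>"
    proof -
      obtain c :: nat where "potential u x \<le> of_nat c"
        using fin ennreal_Ex_less_of_nat[of "potential u x"] less_imp_le by (metis infinity_ennreal_def top.not_eq_extremum)
      then have c: "potential u x \<le> P (real (Suc n)) (potential u) x" for n
        using elim(1) inf by (metis min_absorb1)
      have "Q (real (Suc n)) u x = 0" for n
      proof -
        have "potential u x + Q (real (Suc n)) u x \<le> potential u x + 0"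
          using order_trans[OF add_left_mono[OF c[of n], of "Q (real (Suc n)) u x"] elim(2)[rule_format, of n]]
          by (simp add: add.commute)
        then show ?thesis using fin unfolding ennreal_add_left_cancel_le by simp
      qed
      then show ?thesis by (simp add: potential_def)
    qed
    then show ?case by auto
  qed
qed

text \<open>For \<open>g \<ge> 0\<close>, the function \<open>indicator A * g\<close> is bounded by \<open>top * indicator A\<close>, whose image under \<open>P t\<close> is
  \<open>top * 0 = 0\<close> on \<open>B\<close>.\<close>

lemma T_vanishes:
  assumes t: "0 < t" and A: "A \<in> sets M" and f: "f \<in> L2 M"
    and zero: "AE x in M. x \<in> B \<longrightarrow> P t (indicator A) x = 0"
  shows "AE x in M. x \<in> B \<longrightarrow> T t (\<lambda>y. indicator A y * f y) x = 0"
proof -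
  have pos: "AE x in M. x \<in> B \<longrightarrow> T t (\<lambda>y. indicator A y * g y) x = 0"
    if g: "g \<in> L2 M" and g0: "\<And>x. 0 \<le> g x" for g
  proof -
    note [measurable] = L2_measurable[OF g] A
    have Ag: "(\<lambda>y. indicator A y * g y) \<in> L2 M"
      by (rule L2_bounded[OF g]) (auto simp: indicator_def)
    have 1: "AE x in M. P t (\<lambda>x. ennreal (indicator A x * g x)) x = ennreal (T t (\<lambda>y. indicator A y * g y) x)"
      by (rule P_L2[OF t Ag]) (simp add: g0)
    have 2: "AE x in M. P t (\<lambda>x. ennreal (indicator A x * g x)) x \<le> P t (\<lambda>x. top * indicator A x) x"
      by (rule P_mono[OF t]) (auto simp: indicator_def)
    have 3: "AE x in M. P t (\<lambda>x. top * indicator A x) x = top * P t (indicator A) x"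
      by (rule P_cmult[OF t]) simp
    have 4: "AE x in M. 0 \<le> T t (\<lambda>y. indicator A y * g y) x"
      by (rule T_nonneg[OF t Ag]) (simp add: g0)
    from 1 2 3 4 zero show ?thesis by eventually_elim auto
  qed
  note [measurable] = L2_measurable[OF f] A
  have fp: "(\<lambda>x. max (f x) 0) \<in> L2 M" and fn: "(\<lambda>x. max (- f x) 0) \<in> L2 M"
    by (rule L2_bounded[OF f]; auto)+
  have Afp: "(\<lambda>x. indicator A x * max (f x) 0) \<in> L2 M" by (rule L2_bounded[OF fp]) (auto simp: indicator_def)
  have Afn: "(\<lambda>x. indicator A x * max (- f x) 0) \<in> L2 M" by (rule L2_bounded[OF fn]) (auto simp: indicator_def)
  have eq: "(\<lambda>y. indicator A y * f y) = (\<lambda>y. indicator A y * max (f y) 0 - indicator A y * max (- f y) 0)"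
    by (auto simp: fun_eq_iff indicator_def max_def)
  show ?thesis unfolding eq
    using pos[OF fp max.cobounded2] pos[OF fn max.cobounded2] T_diff[OF t Afp Afn] by eventually_elim auto
qed

lemma L2_indicator: "f \<in> L2 M \<Longrightarrow> Y \<in> sets M \<Longrightarrow> (\<lambda>y. indicator Y y * f y) \<in> L2 M"
  by (rule L2_bounded) (auto simp: indicator_def dest: L2_measurable)

text \<open>One direction suffices by symmetry: the integral of \<open>P t (indicator (space M - Y))\<close> over \<open>Y\<close> equals that of
  \<open>P t (indicator Y)\<close> over \<open>space M - Y\<close>.\<close>

lemma invariant_setI:
  assumes Y: "Y \<in> sets M" and zero: "\<And>t. 0 < t \<Longrightarrow> AE x in M. x \<notin> Y \<longrightarrow> P t (indicator Y) x = 0"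
  shows "invariant_set M D E Y"
  unfolding invariant_set_def
proof (intro conjI allI impI ballI Y)
  fix t :: real and u assume t: "0 < t" and u: "u \<in> L2 M"
  let ?Z = "space M - Y"
  note [measurable] = Y
  have Z: "?Z \<in> sets M" by measurable
  have "(\<integral>\<^sup>+x. P t (indicator ?Z) x * indicator Y x \<partial>M) = (\<integral>\<^sup>+x. indicator ?Z x * P t (indicator Y) x \<partial>M)"
    by (rule P_sym[OF t]) measurable
  also have "\<dots> = (\<integral>\<^sup>+x. 0 \<partial>M)"
    by (rule nn_integral_cong_AE) (use zero[OF t] in \<open>eventually_elim, auto simp: indicator_def\<close>)
  also have "\<dots> = 0" by simp
  finally have "AE x in M. P t (indicator ?Z) x * indicator Y x = 0"
    using P_measurable[OF t borel_measurable_indicator[OF Z]] by (subst (asm) nn_integral_0_iff_AE) auto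
  then have "AE x in M. x \<in> Y \<longrightarrow> P t (indicator ?Z) x = 0"
    by eventually_elim (auto simp: indicator_def)
  note vZ = T_vanishes[OF t Z u this]
  have vY: "AE x in M. x \<in> - Y \<longrightarrow> T t (\<lambda>y. indicator Y y * u y) x = 0"
    by (rule T_vanishes[OF t Y u]) (use zero[OF t] in simp)
  note YL = L2_indicator[OF u Y] and ZL = L2_indicator[OF u Z]
  have "AE x in M. u x = indicator Y x * u x + indicator ?Z x * u x"
    by (rule AE_I2) (auto simp: indicator_def)
  from T_cong[OF t u L2_add[OF YL ZL] this] T_add[OF t YL ZL] vY vZ
  show "AE x in M. T t (\<lambda>y. indicator Y y * u y) x = indicator Y x * T t u x"
    by eventually_elim (auto simp: indicator_def)
qed

text \<open>An excessive function \<open>u\<close> dominates \<open>top * indicator {u = \<infinity>}\<close>, and so \<open>u \<ge> P t u\<close> dominates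
  \<open>top * P t (indicator {u = \<infinity>})\<close>. Where \<open>u\<close> is finite, the last factor vanishes.\<close>

lemma infinity_set_invariant:
  assumes u: "u \<in> borel_measurable M" and excessive: "\<And>t. 0 < t \<Longrightarrow> AE x in M. P t u x \<le> u x"
  shows "invariant_set M D E {x \<in> space M. u x = \<infinity>}"
proof (rule invariant_setI)
  note [measurable] = u
  let ?Y = "{x \<in> space M. u x = \<infinity>}"
  show Y [measurable]: "?Y \<in> sets M" by measurable
  fix t :: real assume t: "0 < t"
  have 1: "AE x in M. P t (\<lambda>x. top * indicator ?Y x) x \<le> P t u x"
    by (rule P_mono[OF t]) (auto simp: indicator_def)
  have 2: "AE x in M. P t (\<lambda>x. top * indicator ?Y x) x = top * P t (indicator ?Y) x"
    by (rule P_cmult[OF t]) simp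
  show "AE x in M. x \<notin> ?Y \<longrightarrow> P t (indicator ?Y) x = 0"
    using 1 2 excessive[OF t] AE_space
  proof eventually_elim
    case (elim x)
    show ?case
    proof
      assume "x \<notin> ?Y"
      then have "u x \<noteq> top" using elim(4) by simp
      then have "top * P t (indicator ?Y) x \<noteq> top"
        using order_trans[OF elim(1) elim(3)] elim(2) by (auto simp: top_unique)
      then show "P t (indicator ?Y) x = 0" by (auto simp: ennreal_mult_eq_top_iff)
    qed
  qed
qed

lemma invariant_setD:
  "invariant_set M D E Y \<Longrightarrow> 0 < t \<Longrightarrow> u \<in> L2 M \<Longrightarrow>
    AE x in M. T t (\<lambda>y. indicator Y y * u y) x = indicator Y x * T t u x"
  and invariant_set_sets: "invariant_set M D E Y \<Longrightarrow> Y \<in> sets M"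
  by (auto simp: invariant_set_def)

lemma invariant_set_Compl:
  assumes Y: "invariant_set M D E Y"
  shows "invariant_set M D E (space M - Y)"
  unfolding invariant_set_def
proof (intro conjI allI impI ballI)
  note [measurable] = invariant_set_sets[OF Y]
  show Z: "space M - Y \<in> sets M" by measurable
  fix t :: real and u assume t: "0 < t" and u: "u \<in> L2 M"
  note YL = L2_indicator[OF u invariant_set_sets[OF Y]]
  have "AE x in M. indicator (space M - Y) x * u x = u x - indicator Y x * u x"
    by (rule AE_I2) (auto simp: indicator_def)
  from T_cong[OF t L2_indicator[OF u Z] L2_diff[OF u YL] this] T_diff[OF t u YL] invariant_setD[OF Y t u] AE_space
  show "AE x in M. T t (\<lambda>y. indicator (space M - Y) y * u y) x = indicator (space M - Y) x * T t u x"
    by eventually_elim (auto simp: indicator_def)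
qed

lemma invariant_set_Int:
  assumes Y: "invariant_set M D E Y" and Z: "invariant_set M D E Z"
  shows "invariant_set M D E (Y \<inter> Z)"
  unfolding invariant_set_def
proof (intro conjI allI impI ballI)
  show "Y \<inter> Z \<in> sets M" using invariant_set_sets[OF Y] invariant_set_sets[OF Z] by simp
  fix t :: real and u assume t: "0 < t" and u: "u \<in> L2 M"
  have eq: "(\<lambda>y. indicator (Y \<inter> Z) y * u y) = (\<lambda>y. indicator Y y * (indicator Z y * u y))"
    by (auto simp: fun_eq_iff indicator_def)
  show "AE x in M. T t (\<lambda>y. indicator (Y \<inter> Z) y * u y) x = indicator (Y \<inter> Z) x * T t u x"
    unfolding eq
    using invariant_setD[OF Y t L2_indicator[OF u invariant_set_sets[OF Z]]] invariant_setD[OF Z t u]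
    by eventually_elim (auto simp: indicator_def)
qed

lemma P_indicator:
  assumes Y: "invariant_set M D E Y" and t: "0 < t" and u: "u \<in> borel_measurable M"
  shows "AE x in M. P t (\<lambda>y. indicator Y y * u y) x = indicator Y x * P t u x"
proof -
  note [measurable] = u invariant_set_sets[OF Y]
  note ex = exhausts_cut[OF u]
  have "exhausts (\<lambda>k y. indicator Y y * cut u k y) (\<lambda>y. indicator Y y * u y)"
    unfolding exhausts_def
  proof (intro conjI allI)
    show "(\<lambda>y. indicator Y y * cut u k y) \<in> L2 M" for k
      using L2_indicator[OF exhausts_mem[OF ex]] by simp
    show "AE x in M. (\<forall>k. 0 \<le> indicator Y x * cut u k x) \<and> incseq (\<lambda>k. indicator Y x * cut u k x) \<and>
        indicator Y x * u x = (SUP k. ennreal (indicator Y x * cut u k x))"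
      using exhausts_AE[OF ex] by eventually_elim (auto simp: indicator_def incseq_def)
  qed
  from P_exhausts[OF t _ this]
  have "AE x in M. P t (\<lambda>y. indicator Y y * u y) x = (SUP k. ennreal (T t (\<lambda>y. indicator Y y * cut u k y) x))"
    by simp
  moreover have "AE x in M. \<forall>k. T t (\<lambda>y. indicator Y y * cut u k y) x = indicator Y x * T t (cut u k) x"
    unfolding AE_all_countable using invariant_setD[OF Y t exhausts_mem[OF ex]] by blast
  ultimately show ?thesis by eventually_elim (auto simp: P_def indicator_def)
qed

lemma P_one_mono:
  assumes s: "0 < s" and st: "s \<le> t"
  shows "AE x in M. P t (\<lambda>_. 1) x \<le> P s (\<lambda>_. 1) x"
proof (cases "s = t")
  case False
  then have d: "0 < t - s" using st by simp
  have "AE x in M. P t (\<lambda>_. 1) x = P s (P (t - s) (\<lambda>_. 1)) x" using P_semigroup[OF s d, of "\<lambda>_. 1"] by simp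
  moreover have "AE x in M. P s (P (t - s) (\<lambda>_. 1)) x \<le> P s (\<lambda>_. 1) x"
    by (rule P_mono[OF s P_measurable[OF d]]) (use P_one_le[OF d] in auto)
  ultimately show ?thesis by eventually_elim simp
qed simp

text \<open>The defect \<open>1 - P t 1\<close> increases with \<open>t\<close>, and its supremum is excessive because
  \<open>P t (1 - P s 1) = P t 1 - P (t + s) 1 \<le> 1 - P (t + s) 1\<close>. The set where mass is lost is the infinity set of
  its multiple by \<open>top\<close>.\<close>

lemma mass_loss_set_invariant:
  "invariant_set M D E {x \<in> space M. \<exists>n. P (real (Suc n)) (\<lambda>_. 1) x < 1}"
proof -
  define d where "d n x = 1 - P (real (Suc n)) (\<lambda>_. 1) x" for n x
  define e where "e x = (SUP n. d n x)" for x
  have Pm: "P (real (Suc n)) (\<lambda>_. 1) \<in> borel_measurable M" for n by (rule P_measurable) auto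
  have dm [measurable]: "d n \<in> borel_measurable M" for n unfolding d_def using Pm by measurable
  have em [measurable]: "e \<in> borel_measurable M" unfolding e_def by measurable
  have Pe: "AE x in M. P t e x \<le> e x" if t: "0 < t" for t
  proof -
    have "AE x in M. \<forall>n. P (real (Suc (Suc n))) (\<lambda>_. 1) x \<le> P (real (Suc n)) (\<lambda>_. 1) x"
      unfolding AE_all_countable using P_one_mono by simp
    then have inc: "AE x in M. incseq (\<lambda>n. d n x)"
      by eventually_elim (auto simp: d_def intro!: incseq_SucI ennreal_minus_mono)
    have "AE x in M. P t (d n) x \<le> e x" for n
    proof -
      let ?s = "real (Suc n)"
      have s: "0 < ?s" by simp
      obtain m :: nat where "t + ?s \<le> real m" using real_arch_simple by blast
      then have m: "t + ?s \<le> real (Suc m)" by simp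
      have "AE x in M. P t (\<lambda>_. 1) x = P t (\<lambda>x. d n x + P ?s (\<lambda>_. 1) x) x"
      proof (rule P_cong[OF t])
        show "AE x in M. 1 = d n x + P ?s (\<lambda>_. 1) x"
          using P_one_le[OF s] by eventually_elim (simp add: d_def diff_add_cancel_ennreal)
      qed (use Pm[of n] in auto)
      with P_add[OF t dm Pm, of n n] P_semigroup[OF t s borel_measurable_const[of 1]] P_one_le[OF t] P_one_le[OF add_pos_pos[OF t s]]
        P_one_mono[OF add_pos_pos[OF t s] m]
      have "AE x in M. P t (d n) x \<le> d m x"
      proof eventually_elim
        case (elim x)
        let ?a = "P (t + ?s) (\<lambda>_. 1) x"
        have le: "P t (d n) x + ?a \<le> 1" using elim by simp
        have "P t (d n) x = P t (d n) x + ?a - ?a"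
          using elim by (intro ennreal_add_diff_cancel_right[symmetric]) (auto simp: top_unique)
        also have "\<dots> \<le> 1 - ?a" using le by (intro ennreal_minus_mono) auto
        also have "\<dots> \<le> d m x" unfolding d_def using elim by (intro ennreal_minus_mono) auto
        finally show ?case .
      qed
      then show ?thesis unfolding e_def by eventually_elim (auto intro: SUP_upper2)
    qed
    then have "AE x in M. \<forall>n. P t (d n) x \<le> e x" unfolding AE_all_countable by blast
    with P_SUP[OF t dm inc] show ?thesis unfolding e_def by eventually_elim (auto intro: SUP_least)
  qed
  have "invariant_set M D E {x \<in> space M. top * e x = \<infinity>}"
  proof (rule infinity_set_invariant)
    fix t :: real assume t: "0 < t"
    from P_cmult[OF t em, of top] Pe[OF t] show "AE x in M. P t (\<lambda>x. top * e x) x \<le> top * e x"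
      by eventually_elim (auto intro: mult_left_mono)
  qed measurable
  moreover have "(top * e x = \<infinity>) = (\<exists>n. P (real (Suc n)) (\<lambda>_. 1) x < 1)" for x
  proof -
    have "(top * e x = \<infinity>) = (e x \<noteq> 0)" by (auto simp: ennreal_mult_eq_top_iff)
    also have "\<dots> = (\<exists>n. d n x \<noteq> 0)" using SUP_bot_conv(1)[of "\<lambda>n. d n x" UNIV] by (simp add: e_def bot_ennreal)
    also have "\<dots> = (\<exists>n. P (real (Suc n)) (\<lambda>_. 1) x < 1)"
      unfolding d_def by (simp add: diff_eq_0_iff_ennreal not_le)
    finally show ?thesis .
  qed
  ultimately show ?thesis by simp
qed

end

section \<open>Parts of a form on invariant sets\<close>

context closed_form
begin

lemma res_form_le:
  assumes h: "0 < h" and u: "u \<in> D"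
  shows "E (res h u) (res h u) \<le> E u u"
proof -
  let ?w = "res h u"
  have w: "?w \<in> D" using h u by simp
  have "h * E ?w (u - ?w) = ip (u - ?w) (u - ?w)"
    using res_eq[OF h, of u "u - ?w"] u w by (simp add: ip_simps)
  also have "\<dots> \<ge> 0" using ip_nonneg u w by simp
  finally have "0 \<le> E ?w (u - ?w)" using h by (simp add: zero_le_mult_iff)
  moreover have "0 \<le> E (u - ?w) (u - ?w)" using form.ip_nonneg u w by simp
  moreover have "E u u = E ?w ?w + 2 * E ?w (u - ?w) + E (u - ?w) (u - ?w)"
    using u w by (simp add: form.ip_simps form.ip_sym[of u ?w])
  ultimately show ?thesis by linarith
qed

text \<open>With \<open>d = res h u - res k u\<close> the claim amounts to \<open>E (res k u) d \<ge> 0\<close>. Testing both equations with \<open>d\<close> and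
  subtracting them gives \<open>(k - h) * E (res k u) d = h * E d d + ip d d\<close>.\<close>

lemma res_form_diff_le:
  assumes h: "0 < h" and hk: "h < k" and u: "u \<in> D"
  shows "E (res h u - res k u) (res h u - res k u) \<le> E (res h u) (res h u) - E (res k u) (res k u)"
proof -
  have k: "0 < k" using h hk by simp
  let ?a = "res h u" and ?b = "res k u"
  define d where "d = ?a - ?b"
  have a: "?a \<in> D" and b: "?b \<in> D" using h k u by simp_all
  have d: "d \<in> D" using a b by (simp add: d_def)
  have ea: "h * E ?a d = ip u d - ip ?a d" and eb: "k * E ?b d = ip u d - ip ?b d"
    using res_eq[OF h, of u d] res_eq[OF k, of u d] u d by simp_all
  have "h * E ?a d = k * E ?b d - ip d d"
    using ea eb a b d by (simp add: d_def ip_simps)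
  moreover have "0 \<le> h * E d d" using form.ip_nonneg[OF d] h by simp
  moreover have "E d d = E ?a d - E ?b d" using a b d by (simp add: d_def form.ip_simps)
  moreover have "0 \<le> ip d d" using ip_nonneg d by simp
  ultimately have "0 \<le> (k - h) * E ?b d" by (simp add: algebra_simps)
  then have "0 \<le> E ?b d" using hk by (simp add: zero_le_mult_iff)
  moreover have "?a = ?b + d" by (simp add: d_def)
  then have "E ?a ?a = E ?b ?b + 2 * E ?b d + E d d"
    using a b d by (simp add: form.ip_simps form.ip_sym[of d ?b])
  ultimately show ?thesis unfolding d_def by linarith
qed

text \<open>The energies \<open>E (res h u) (res h u)\<close> increase as \<open>h\<close> decreases and are bounded by \<open>E u u\<close>. So they converge,
  and by the preceding estimate \<open>res h u\<close> is Cauchy in the form norm.\<close>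

lemma form_core:
  assumes u: "u \<in> D"
  obtains U g where "\<And>n. gen (U n) (g n)" "(\<lambda>n. nrm (U n - u)) \<longlonglongrightarrow> 0"
    "\<And>\<epsilon>. 0 < \<epsilon> \<Longrightarrow> \<exists>N. \<forall>m\<ge>N. \<forall>n\<ge>N. E (U m - U n) (U m - U n) < \<epsilon>"
    "(\<lambda>n. E (U n - u) (U n - u)) \<longlonglongrightarrow> 0"
proof -
  define h where "h n = 1 / real (Suc n)" for n
  have h: "0 < h n" for n by (simp add: h_def)
  define U where "U n = res (h n) u" for n
  define e where "e n = E (U n) (U n)" for n
  have UD: "U n \<in> D" for n using h u by (simp add: U_def)
  have gen: "gen (U n) ((1 / h n) *\<^sub>R (u - U n))" for n
    unfolding U_def using gen_res[OF h, of u n] u by simp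
  have "filterlim h (at_right 0) sequentially"
    unfolding filterlim_at h_def using LIMSEQ_inverse_real_of_nat by (auto simp: inverse_eq_divide)
  then have lim: "(\<lambda>n. nrm (U n - u)) \<longlonglongrightarrow> 0"
    unfolding U_def by (rule filterlim_compose[OF res_tendsto[OF D_mem[OF u]]])
  have diff: "E (U m - U n) (U m - U n) \<le> e m - e n" if "n < m" for m n
    unfolding U_def e_def by (rule res_form_diff_le[OF h _ u]) (use that in \<open>simp add: h_def field_simps\<close>)
  have "mono e"
  proof (rule incseq_SucI)
    fix n show "e n \<le> e (Suc n)" using diff[of n "Suc n"] form.ip_nonneg[of "U (Suc n) - U n"] UD by simp
  qed
  moreover have "e n \<le> E u u" for n unfolding e_def U_def by (rule res_form_le[OF h u])
  ultimately have "convergent e" using incseq_convergent convergentI by metis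
  then have "Cauchy e" by (rule convergent_Cauchy)
  have Cauchy: "\<exists>N. \<forall>m\<ge>N. \<forall>n\<ge>N. E (U m - U n) (U m - U n) < \<epsilon>" if pos: "0 < \<epsilon>" for \<epsilon>
  proof -
    obtain N where N: "\<forall>m\<ge>N. \<forall>n\<ge>N. dist (e m) (e n) < \<epsilon>" using metric_CauchyD[OF \<open>Cauchy e\<close> pos] by blast
    have "E (U m - U n) (U m - U n) < \<epsilon>" if mn: "m \<ge> N" "n \<ge> N" for m n
    proof (cases m n rule: linorder_cases)
      case less
      have "E (U m - U n) (U m - U n) = E (U n - U m) (U n - U m)"
        using UD by (simp add: form.ip_simps)
      then show ?thesis using diff[OF less] N mn by (fastforce simp: dist_real_def)
    next
      case equal
      have "E 0 0 = 0" using form.ip_scale_left[of 0 0 0] by simp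
      then show ?thesis using equal \<open>0 < \<epsilon>\<close> by simp
    next
      case greater
      then show ?thesis using diff[OF greater] N mn by (fastforce simp: dist_real_def)
    qed
    then show ?thesis by blast
  qed
  show ?thesis
    using that[OF gen lim Cauchy] closed[OF UD _ lim Cauchy] u by simp
qed

end

context dirichlet_form
begin

lemma is_form_semigroup_unique:
  assumes "is_form_semigroup M D E T1" "is_form_semigroup M D E T2" "0 < t" "f \<in> L2 M"
  shows "AE x in M. T1 t f x = T2 t f x"
proof (rule AE_eq_if_norm2_zero)
  note T1 = assms(1)[unfolded is_form_semigroup_iff] and T2 = assms(2)[unfolded is_form_semigroup_iff]
  have m: "T1 t f \<in> L2 M" "T2 t f \<in> L2 M" "sg t f \<in> L2 M"
    using semigroup_mem[OF T1] semigroup_mem[OF T2] assms by auto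
  have "nrm (T1 t f - T2 t f) = 0"
    using null_trans[OF m(1,3,2) semigroup_eq_sg[OF T1 assms(3,4)] null_sym[OF m(2,3) semigroup_eq_sg[OF T2 assms(3,4)]]] .
  then show "norm2 M (T1 t f - T2 t f) = 0" by simp
  show "T1 t f \<in> L2 M" "T2 t f \<in> L2 M" using m by auto
qed

end

locale invariant_part = sigma_finite_dirichlet_form +
  fixes Y
  assumes invariant: "invariant_set M D E Y"
begin

abbreviation onY :: "('a \<Rightarrow> real) \<Rightarrow> 'a \<Rightarrow> real" where
  "onY f \<equiv> (\<lambda>x. indicator Y x * f x)"

abbreviation N :: "'a measure" where "N \<equiv> restrict_space M Y"
abbreviation DY :: "('a \<Rightarrow> real) set" where "DY \<equiv> part_dom M D Y"
abbreviation EY :: "('a \<Rightarrow> real) \<Rightarrow> ('a \<Rightarrow> real) \<Rightarrow> real" where "EY \<equiv> part_form E Y"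

lemma Y_sets [simp]: "Y \<in> sets M" "Y \<inter> space M \<in> sets M"
  using invariant_set_sets[OF invariant] by auto

lemma onY_L2 [simp]: "f \<in> L2 M \<Longrightarrow> onY f \<in> L2 M"
  by (rule L2_indicator) simp_all

lemma onY_idem [simp]: "onY (onY f) = onY f"
  by (auto simp: fun_eq_iff indicator_def)

lemma onY_linear: "onY (f + g) = onY f + onY g" "onY (f - g) = onY f - onY g" "onY (c *\<^sub>R f) = c *\<^sub>R onY f"
  by (auto simp: fun_eq_iff algebra_simps)

lemma inner2_onY: "inner2 M (onY f) g = inner2 M f (onY g)" "inner2 M (onY f) (onY g) = inner2 M (onY f) g"
  unfolding inner2_def by (rule Bochner_Integration.integral_cong, simp, simp add: indicator_def)+

lemma norm2_onY_le:
  assumes f: "f \<in> L2 M"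
  shows "norm2 M (onY f) \<le> norm2 M f"
proof -
  have "inner2 M (onY f) (onY f) \<le> inner2 M f f"
    unfolding inner2_def
    by (rule integral_mono[OF L2_mult_integrable[OF onY_L2[OF f] onY_L2[OF f]] L2_mult_integrable[OF f f]])
      (simp add: indicator_def)
  then show ?thesis by (simp add: norm2_def)
qed

text \<open>\<open>- L\<close> is the derivative of the semigroup at \<open>0\<close>, and the semigroup commutes with \<open>onY\<close>.\<close>

lemma gen_onY:
  assumes g: "gen u g"
  shows "gen (onY u) (onY g)"
proof (rule iffD2[OF semigroup_gen[OF form_semigroup]])
  note m = gen_mem[OF g]
  show "onY u \<in> L2 M" "onY g \<in> L2 M" using m by simp_all
  have lim: "((\<lambda>t. norm2 M ((1 / t) *\<^sub>R (u - T t u) - g)) \<longlongrightarrow> 0) (at_right 0)"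
    using semigroup_gen[OF form_semigroup m] g by simp
  show "((\<lambda>t. nrm ((1 / t) *\<^sub>R (onY u - T t (onY u)) - onY g)) \<longlongrightarrow> 0) (at_right 0)"
  proof (rule Lim_null_comparison[OF _ lim])
    have pos: "\<forall>\<^sub>F t in at_right (0::real). 0 < t" by (simp add: eventually_at_right_less)
    show "\<forall>\<^sub>F t in at_right 0. norm (nrm ((1 / t) *\<^sub>R (onY u - T t (onY u)) - onY g)) \<le> norm2 M ((1 / t) *\<^sub>R (u - T t u) - g)"
      using pos
    proof eventually_elim
      case (elim t)
      let ?w = "(1 / t) *\<^sub>R (u - T t u) - g" and ?v = "(1 / t) *\<^sub>R (onY u - T t (onY u)) - onY g"
      have w: "?w \<in> L2 M" and v: "?v \<in> L2 M" using m elim by simp_all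
      have "AE x in M. ?v x = onY ?w x"
        using invariant_setD[OF invariant elim m(1)] by eventually_elim (simp add: algebra_simps)
      then have "norm2 M (?v - onY ?w) = 0" by (rule norm2_zero_if_AE_eq[OF v onY_L2[OF w]])
      then have "norm2 M ?v \<le> norm2 M (onY ?w)"
        using nrm_triangle_sub[OF v onY_L2[OF w]] by simp
      then show ?case using norm2_onY_le[OF w] by simp
    qed
  qed
qed

lemma form_gen_onY:
  assumes g: "gen u g" and v: "v \<in> D" "onY v \<in> D"
  shows "E (onY u) (onY v) = E (onY u) v"
  using gen_onY[OF g] v by (simp add: gen_def inner2_onY(2))

lemma form_gen_onY_le:
  assumes g: "gen u g"
  shows "E (onY u) (onY u) \<le> E u u"
proof -
  have u: "u \<in> D" "onY u \<in> D" using g gen_onY[OF g] by (auto dest: gen_D)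
  have "0 \<le> E (u - onY u) (u - onY u)" using form.ip_nonneg u by simp
  then show ?thesis
    using u form_gen_onY[OF g u] form.ip_sym[of u "onY u"] by (simp add: form.ip_simps)
qed

text \<open>On the domain of \<open>L\<close>, \<open>onY\<close> does not increase the energy. It therefore maps the approximating sequence of
  the lemma \<open>form_core\<close> to a Cauchy sequence, and closedness applies.\<close>

lemma onY_D_limit:
  assumes u: "u \<in> D"
  obtains U g where "\<And>n. gen (U n) (g n)" "onY u \<in> D" "(\<lambda>n. E (onY (U n) - onY u) (onY (U n) - onY u)) \<longlonglongrightarrow> 0"
proof -
  obtain U g where U: "\<And>n. gen (U n) (g n)" "(\<lambda>n. nrm (U n - u)) \<longlonglongrightarrow> 0"
    "\<And>\<epsilon>. 0 < \<epsilon> \<Longrightarrow> \<exists>N. \<forall>m\<ge>N. \<forall>n\<ge>N. E (U m - U n) (U m - U n) < \<epsilon>"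
    by (rule form_core[OF u]) (rule that, assumption+)
  have UD: "U n \<in> D" "onY (U n) \<in> D" for n using U(1) gen_onY by (auto dest: gen_D)
  have "onY u \<in> D \<and> (\<lambda>n. E (onY (U n) - onY u) (onY (U n) - onY u)) \<longlonglongrightarrow> 0"
  proof (rule closed)
    show "onY (U n) \<in> D" for n by (rule UD)
    show "onY u \<in> L2 M" using u by simp
    show "(\<lambda>n. nrm (onY (U n) - onY u)) \<longlonglongrightarrow> 0"
    proof (rule Lim_null_comparison[OF _ U(2)])
      have "norm2 M (onY (U n) - onY u) \<le> norm2 M (U n - u)" for n
        unfolding onY_linear[symmetric] by (rule norm2_onY_le, rule mem_diff) (use UD(1) u in simp_all)
      then show "\<forall>\<^sub>F n in sequentially. norm (nrm (onY (U n) - onY u)) \<le> nrm (U n - u)" by simp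
    qed
    fix \<epsilon> :: real assume "0 < \<epsilon>"
    then obtain N where N: "\<forall>m\<ge>N. \<forall>n\<ge>N. E (U m - U n) (U m - U n) < \<epsilon>" using U(3) by blast
    have "E (onY (U m) - onY (U n)) (onY (U m) - onY (U n)) \<le> E (U m - U n) (U m - U n)" for m n
      using form_gen_onY_le[OF gen_diff[OF U(1)[of m] U(1)[of n]]] unfolding onY_linear .
    then show "\<exists>N. \<forall>m\<ge>N. \<forall>n\<ge>N. E (onY (U m) - onY (U n)) (onY (U m) - onY (U n)) < \<epsilon>"
      using N by (meson le_less_trans)
  qed
  then show ?thesis using that U(1) by blast
qed

lemma onY_D [simp]:
  assumes "u \<in> D"
  shows "onY u \<in> D"
  by (rule onY_D_limit[OF assms])

text \<open>Equivalently, \<open>E (onY u) (v - onY v) = 0\<close>: the form does not couple \<open>Y\<close> and its complement.\<close>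

lemma form_onY:
  assumes u: "u \<in> D" and v: "v \<in> D"
  shows "E (onY u) (onY v) = E (onY u) v"
proof -
  obtain U g where U: "\<And>n. gen (U n) (g n)" "(\<lambda>n. E (onY (U n) - onY u) (onY (U n) - onY u)) \<longlonglongrightarrow> 0"
    by (rule onY_D_limit[OF u]) (rule that, assumption+)
  have UD: "onY (U n) \<in> D" for n using gen_onY[OF U(1)] by (rule gen_D)
  have lim: "(\<lambda>n. form.nrm (onY (U n) - onY u)) \<longlonglongrightarrow> 0"
    using tendsto_real_sqrt[OF U(2)] by (simp add: form.nrm_def)
  have "(\<lambda>n. E (onY (U n)) v) \<longlonglongrightarrow> E (onY u) v"
    by (rule form.ip_tendsto_left[OF UD onY_D[OF u] v lim])
  moreover have "(\<lambda>n. E (onY (U n)) (onY v)) \<longlonglongrightarrow> E (onY u) (onY v)"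
    by (rule form.ip_tendsto_left[OF UD onY_D[OF u] onY_D[OF v] lim])
  ultimately show ?thesis
    using form_gen_onY[OF U(1) v onY_D[OF v]] LIMSEQ_unique by simp
qed

lemma AE_N_iff: "(AE x in N. R x) \<longleftrightarrow> (AE x in M. x \<in> Y \<longrightarrow> R x)"
  by (rule AE_restrict_space_iff) simp

lemma measurable_N_iff: "f \<in> borel_measurable N \<longleftrightarrow> onY f \<in> borel_measurable M" for f :: "'a \<Rightarrow> real"
  using borel_measurable_restrict_space_iff[of Y M f] by simp

lemma L2_N_iff: "f \<in> L2 N \<longleftrightarrow> onY f \<in> L2 M"
proof -
  have "integrable N (\<lambda>x. (f x)\<^sup>2) = integrable M (\<lambda>x. (onY f x)\<^sup>2)"
    using integrable_restrict_space[of Y M "\<lambda>x. (f x)\<^sup>2"]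
    by (simp add: power_mult_distrib) (simp add: power2_eq_square[of "indicator _ _"] indicator_inter_arith[symmetric])
  then show ?thesis by (simp add: L2_def measurable_N_iff)
qed

lemma L2_restrict [simp]: "f \<in> L2 M \<Longrightarrow> f \<in> L2 N"
  by (simp add: L2_N_iff)

lemma inner2_N: "inner2 N f g = inner2 M (onY f) (onY g)"
  unfolding inner2_def integral_restrict_space[OF Y_sets(2)]
  by (rule Bochner_Integration.integral_cong) (auto simp: indicator_def)

lemma norm2_N: "norm2 N f = norm2 M (onY f)"
  by (simp add: norm2_def inner2_N)

lemma part_dom_iff: "v \<in> DY \<longleftrightarrow> onY v \<in> D"
proof
  assume "v \<in> DY"
  then obtain u where v: "v \<in> borel_measurable N" and u: "u \<in> D" "AE x in N. v x = onY u x"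
    unfolding part_dom_def by blast
  have "AE x in M. onY u x = onY v x"
    using u(2) unfolding AE_N_iff by eventually_elim (auto simp: indicator_def)
  then show "onY v \<in> D" using dom_AE[OF onY_D[OF u(1)]] v measurable_N_iff by blast
next
  assume v: "onY v \<in> D"
  then have "v \<in> borel_measurable N" unfolding measurable_N_iff using D_mem L2_measurable by blast
  moreover have "AE x in N. v x = onY (onY v) x" unfolding AE_N_iff by simp
  ultimately show "v \<in> DY" unfolding part_dom_def mem_Collect_eq using v by (intro conjI bexI[of _ "onY v"])
qed

lemma part_form_eq: "EY u v = E (onY u) (onY v)"
  by (simp add: part_form_def)

lemma dirichlet_form_part: "dirichlet_form N DY EY"
proof
  show "DY \<subseteq> L2 N" using D_subset by (auto simp: part_dom_iff L2_N_iff)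
next
  fix u v assume u: "u \<in> DY" and v: "v \<in> borel_measurable N" and eq: "AE x in N. u x = v x"
  have "AE x in M. onY u x = onY v x"
    using eq unfolding AE_N_iff by eventually_elim (auto simp: indicator_def)
  then show "v \<in> DY" using dom_AE[of "onY u" "onY v"] u v by (simp add: part_dom_iff measurable_N_iff)
next
  fix u v assume "u \<in> DY" "v \<in> DY"
  then show "(\<lambda>x. u x + v x) \<in> DY" using dom_add[of "onY u" "onY v"] by (simp add: part_dom_iff distrib_left)
next
  fix u c assume "u \<in> DY"
  then show "(\<lambda>x. c * u x) \<in> DY" using dom_scale[of "onY u" c] by (simp add: part_dom_iff mult.left_commute)
next
  fix f and \<epsilon> :: real assume f: "f \<in> L2 N" and \<epsilon>: "0 < \<epsilon>"
  obtain u where u: "u \<in> D" "norm2 M (onY f - u) < \<epsilon>" using dense[of "onY f" \<epsilon>] f \<epsilon> by (auto simp: L2_N_iff)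
  have "norm2 N (\<lambda>x. f x - u x) = norm2 M (onY (onY f - u))"
    unfolding norm2_N by (rule arg_cong[of _ _ "norm2 M"]) (auto simp: fun_eq_iff indicator_def)
  also have "\<dots> \<le> norm2 M (onY f - u)" by (rule norm2_onY_le, rule mem_diff) (use f u in \<open>simp_all add: L2_N_iff\<close>)
  finally show "\<exists>u\<in>DY. norm2 N (\<lambda>x. f x - u x) < \<epsilon>" using u by (intro bexI[of _ u]) (auto simp: part_dom_iff)
next
  fix u u' w assume *: "u \<in> DY" "u' \<in> DY" "w \<in> DY" and eq: "AE x in N. u x = u' x"
  have "AE x in M. onY u x = onY u' x"
    using eq unfolding AE_N_iff by eventually_elim (auto simp: indicator_def)
  then show "EY u w = EY u' w" using form_AE[of "onY u" "onY u'" "onY w"] * by (simp add: part_dom_iff part_form_eq)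
next
  fix u v w assume "u \<in> DY" "v \<in> DY" "w \<in> DY"
  then show "EY (\<lambda>x. u x + v x) w = EY u w + EY v w"
    using form_add[of "onY u" "onY v" "onY w"] by (simp add: part_dom_iff part_form_eq distrib_left)
next
  fix u w c assume "u \<in> DY" "w \<in> DY"
  then show "EY (\<lambda>x. c * u x) w = c * EY u w"
    using form_scale[of "onY u" "onY w" c] by (simp add: part_dom_iff part_form_eq mult.left_commute)
next
  fix u v assume "u \<in> DY" "v \<in> DY"
  then show "EY u v = EY v u" using form_sym by (simp add: part_dom_iff part_form_eq)
next
  fix u assume "u \<in> DY"
  then show "0 \<le> EY u u" using form_nonneg by (simp add: part_dom_iff part_form_eq)
next
  fix U :: "nat \<Rightarrow> 'a \<Rightarrow> real" and u
  assume U: "\<And>n. U n \<in> DY" and u: "u \<in> L2 N" and lim: "(\<lambda>n. norm2 N (\<lambda>x. U n x - u x)) \<longlonglongrightarrow> 0"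
    and C: "\<And>\<epsilon>. 0 < \<epsilon> \<Longrightarrow> \<exists>N. \<forall>m\<ge>N. \<forall>n\<ge>N. EY (\<lambda>x. U m x - U n x) (\<lambda>x. U m x - U n x) < \<epsilon>"
  have eq: "onY (\<lambda>x. f x - g x) = (\<lambda>x. onY f x - onY g x)" for f g
    by (simp add: fun_eq_iff right_diff_distrib)
  show "u \<in> DY \<and> (\<lambda>n. EY (\<lambda>x. U n x - u x) (\<lambda>x. U n x - u x)) \<longlonglongrightarrow> 0"
    unfolding part_form_eq eq part_dom_iff
    by (rule form_closed) (use U u lim C in \<open>simp_all add: part_dom_iff L2_N_iff norm2_N part_form_eq eq\<close>)
next
  fix u assume u: "u \<in> DY"
  have eq: "onY (\<lambda>x. min (max (u x) 0) 1) = (\<lambda>x. min (max (onY u x) 0) 1)"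
    by (auto simp: fun_eq_iff indicator_def)
  show "(\<lambda>x. min (max (u x) 0) 1) \<in> DY \<and> EY (\<lambda>x. min (max (u x) 0) 1) (\<lambda>x. min (max (u x) 0) 1) \<le> EY u u"
    unfolding part_dom_iff part_form_eq eq using form_markov u by (simp add: part_dom_iff)
qed

sublocale part: sigma_finite_dirichlet_form N DY EY
  using dirichlet_form_part sigma_finite_measure_restrict_space[OF sigma_finite_measure_axioms Y_sets(1)]
  by (simp add: sigma_finite_dirichlet_form_def)

lemma T_onY: "0 < t \<Longrightarrow> f \<in> L2 M \<Longrightarrow> AE x in M. T t (onY f) x = onY (T t f) x"
  by (rule invariant_setD[OF invariant])

lemma onY_T_onY:
  assumes "0 < t" "f \<in> L2 N"
  shows "AE x in M. onY (T t (onY f)) x = T t (onY f) x"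
  using T_onY[of t "onY f"] assms unfolding L2_N_iff onY_idem by (auto elim: eventually_mono)

lemma form_operator_part: "form_operator N DY EY f g \<longleftrightarrow> gen (onY f) (onY g)"
proof
  assume fg: "form_operator N DY EY f g"
  then have f: "onY f \<in> D" and g: "onY g \<in> L2 M" and eq: "\<And>v. v \<in> DY \<Longrightarrow> EY f v = inner2 N g v"
    by (auto simp: form_operator_def part_dom_iff L2_N_iff)
  show "gen (onY f) (onY g)"
    unfolding gen_def
  proof (intro conjI ballI f g)
    fix v assume v: "v \<in> D"
    have "E (onY f) v = EY f v" using form_onY[OF f v] by (simp add: part_form_eq)
    also have "\<dots> = inner2 M (onY g) v" using eq[of v] v by (simp add: part_dom_iff inner2_N inner2_onY(2))
    finally show "E (onY f) v = inner2 M (onY g) v" .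
  qed
next
  assume "gen (onY f) (onY g)"
  then show "form_operator N DY EY f g"
    by (auto simp: gen_def form_operator_def part_dom_iff L2_N_iff part_form_eq inner2_N)
qed

lemma norm2_cong_AE:
  assumes "f \<in> L2 M" "g \<in> L2 M" "AE x in M. f x = g x"
  shows "norm2 M f = norm2 M g"
proof (rule order_antisym)
  have 0: "norm2 M (f - g) = 0" using norm2_zero_if_AE_eq[OF assms] .
  then show "norm2 M f \<le> norm2 M g" using nrm_triangle_sub[OF assms(1,2)] by simp
  show "norm2 M g \<le> norm2 M f"
    using nrm_triangle_sub[OF assms(2,1)] nrm_minus_commute[OF assms(1,2)] 0 by simp
qed

text \<open>By uniqueness of the semigroup, this identifies the semigroup of the part with the restriction of \<open>T t\<close>.\<close>

lemma is_form_semigroup_part: "is_form_semigroup N DY EY (\<lambda>t f. T t (onY f))"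
  unfolding is_form_semigroup_def
proof (intro conjI allI impI ballI)
  fix t :: real and f assume t: "0 < t" and f: "f \<in> L2 N"
  then have f': "onY f \<in> L2 M" by (simp add: L2_N_iff)
  show "T t (onY f) \<in> L2 N" using t f' by simp
  show "AE x in N. T t (onY (\<lambda>y. c * f y)) x = c * T t (onY f) x" for c
    using T_scale[OF t f', of c] unfolding AE_N_iff by (auto elim!: eventually_mono simp: mult.left_commute)
  fix g assume "g \<in> L2 N"
  then have g': "onY g \<in> L2 M" by (simp add: L2_N_iff)
  show "AE x in N. T t (onY (\<lambda>y. f y + g y)) x = T t (onY f) x + T t (onY g) x"
    using T_add[OF t f' g'] unfolding AE_N_iff by (auto elim!: eventually_mono simp: distrib_left)
  show "inner2 N (T t (onY f)) g = inner2 N f (T t (onY g))"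
    using T_sym[OF t f' g'] by (simp add: inner2_N inner2_onY(1))
next
  fix t :: real assume t: "0 < t"
  show "\<exists>C. \<forall>f\<in>L2 N. norm2 N (T t (onY f)) \<le> C * norm2 N f"
  proof (intro exI[of _ 1] ballI)
    fix f assume "f \<in> L2 N"
    then have f': "onY f \<in> L2 M" by (simp add: L2_N_iff)
    show "norm2 N (T t (onY f)) \<le> 1 * norm2 N f"
      using norm2_onY_le[OF T_mem[OF t f']] lin_contr_le[OF T_lin_contr[OF t] f'] by (simp add: norm2_N)
  qed
next
  fix s t :: real and f assume s: "0 < s" and t: "0 < t" and f: "f \<in> L2 N"
  then have f': "onY f \<in> L2 M" by (simp add: L2_N_iff)
  show "AE x in N. T (s + t) (onY f) x = T s (onY (T t (onY f))) x"
    using T_semigroup[OF s t f'] T_cong[OF s onY_L2[OF T_mem[OF t f']] T_mem[OF t f'] onY_T_onY[OF t f]]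
    unfolding AE_N_iff by eventually_elim simp
next
  fix f assume f: "f \<in> L2 N"
  then have f': "onY f \<in> L2 M" by (simp add: L2_N_iff)
  have pos: "\<forall>\<^sub>F t in at_right (0::real). 0 < t" by (simp add: eventually_at_right_less)
  show "((\<lambda>t. norm2 N (\<lambda>x. T t (onY f) x - f x)) \<longlongrightarrow> 0) (at_right 0)"
  proof (rule Lim_null_comparison[OF _ T_tendsto[OF f']])
    show "\<forall>\<^sub>F t in at_right 0. norm (norm2 N (\<lambda>x. T t (onY f) x - f x)) \<le> norm2 M (T t (onY f) - onY f)"
      using pos
    proof eventually_elim
      case (elim t)
      have "onY (\<lambda>x. T t (onY f) x - f x) = onY (T t (onY f) - onY f)"
        by (auto simp: fun_eq_iff indicator_def)
      then show ?case
        using norm2_onY_le[of "T t (onY f) - onY f"] elim f' by (simp add: norm2_N)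
    qed
  qed
  fix g assume g: "g \<in> L2 N"
  then have g': "onY g \<in> L2 M" by (simp add: L2_N_iff)
  have "\<forall>\<^sub>F t in at_right 0. norm2 N (\<lambda>x. (f x - T t (onY f) x) / t - g x)
      = norm2 M ((1 / t) *\<^sub>R (onY f - T t (onY f)) - onY g)"
    using pos
  proof eventually_elim
    case (elim t)
    have eq: "onY (\<lambda>x. (f x - T t (onY f) x) / t - g x) = (1 / t) *\<^sub>R (onY f - onY (T t (onY f))) - onY g"
      by (simp add: fun_eq_iff right_diff_distrib diff_divide_distrib)
    show ?case
      unfolding norm2_N eq
    proof (rule norm2_cong_AE)
      show "AE x in M. ((1 / t) *\<^sub>R (onY f - onY (T t (onY f))) - onY g) x = ((1 / t) *\<^sub>R (onY f - T t (onY f)) - onY g) x"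
        using onY_T_onY[OF elim f] by eventually_elim simp
    qed (use elim f' g' in simp_all)
  qed
  from tendsto_cong[OF this]
  show "form_operator N DY EY f g \<longleftrightarrow>
      ((\<lambda>t. norm2 N (\<lambda>x. (f x - T t (onY f) x) / t - g x)) \<longlongrightarrow> 0) (at_right 0)"
    using semigroup_gen[OF form_semigroup f' g'] by (simp add: form_operator_part)
qed

lemma part_T:
  assumes t: "0 < t" and f: "f \<in> L2 N"
  shows "AE x in N. part.T t f x = T t (onY f) x"
  using part.is_form_semigroup_unique[OF part.form_semigroup[folded part.is_form_semigroup_iff] is_form_semigroup_part t f] .

lemma part_S:
  assumes t: "0 < t" and f: "f \<in> L2 N"
  shows "AE x in N. part.S t f x = S t (onY f) x"
proof (rule part.AE_eq_if_inner2_eq)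
  have f': "onY f \<in> L2 M" using f by (simp add: L2_N_iff)
  show "part.S t f \<in> L2 N" "S t (onY f) \<in> L2 N" using t f f' by simp_all
  fix h assume h: "h \<in> L2 N"
  then have h': "onY h \<in> L2 M" by (simp add: L2_N_iff)
  have "inner2 N (part.S t f) h = (LINT s:{0<..t}|lborel. inner2 M (T s (onY f)) (onY h))"
    unfolding part.S_inner2[OF t f h]
  proof (rule set_lebesgue_integral_cong)
    show "\<forall>s. s \<in> {0<..t} \<longrightarrow> inner2 N (part.T s f) h = inner2 M (T s (onY f)) (onY h)"
    proof (intro allI impI)
      fix s assume "s \<in> {0<..t}"
      then have s: "0 < s" by simp
      have m: "part.T s f \<in> L2 N" "T s (onY f) \<in> L2 N" using s f f' by simp_all
      have "L2.nrm N (part.T s f - T s (onY f)) = 0"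
        using norm2_zero_if_AE_eq[OF m part_T[OF s f]] by simp
      then have "inner2 N (part.T s f) h = inner2 N (T s (onY f)) h" by (rule L2.ip_null_left[OF m h])
      then show "inner2 N (part.T s f) h = inner2 M (T s (onY f)) (onY h)" by (simp add: inner2_N inner2_onY(1))
    qed
  qed simp
  also have "\<dots> = inner2 N (S t (onY f)) h"
    using S_inner2[OF t f' h'] by (simp add: inner2_N inner2_onY(1))
  finally show "inner2 N (part.S t f) h = inner2 N (S t (onY f)) h" .
qed

lemma S_onY:
  assumes t: "0 < t" and f: "f \<in> L2 M"
  shows "AE x in M. S t (onY f) x = onY (S t f) x"
proof (rule AE_eq_if_inner2_eq)
  show "S t (onY f) \<in> L2 M" "onY (S t f) \<in> L2 M" using t f by simp_all
  fix h assume h: "h \<in> L2 M"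
  have "inner2 M (S t (onY f)) h = (LINT s:{0<..t}|lborel. inner2 M (T s f) (onY h))"
    unfolding S_inner2[OF t onY_L2[OF f] h]
  proof (rule set_lebesgue_integral_cong)
    show "\<forall>s. s \<in> {0<..t} \<longrightarrow> inner2 M (T s (onY f)) h = inner2 M (T s f) (onY h)"
    proof (intro allI impI)
      fix s assume "s \<in> {0<..t}"
      then have s: "0 < s" by simp
      have m: "T s (onY f) \<in> L2 M" "onY (T s f) \<in> L2 M" using s f by simp_all
      have "nrm (T s (onY f) - onY (T s f)) = 0" using norm2_zero_if_AE_eq[OF m T_onY[OF s f]] by simp
      then show "inner2 M (T s (onY f)) h = inner2 M (T s f) (onY h)"
        using ip_null_left[OF m h] by (simp add: inner2_onY(1))
    qed
  qed simp
  then show "inner2 M (S t (onY f)) h = inner2 M (onY (S t f)) h"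
    using S_inner2[OF t f onY_L2[OF h]] by (simp add: inner2_onY(1))
qed

lemma L1_pos_restrict:
  assumes f: "f \<in> L1_pos M"
  shows "f \<in> L1_pos N"
proof -
  have "integrable N f"
    unfolding integrable_restrict_space[OF Y_sets(2)] using f
    by (intro integrable_mult_indicator) (auto simp: L1_pos_def L1_def)
  then show ?thesis using f by (auto simp: L1_pos_def L1_def AE_N_iff)
qed

text \<open>For square integrable \<open>f\<close> the operators \<open>Q\<close> and \<open>S\<close> agree, and \<open>S\<close> is determined by duality. This avoids a
  comparison of the two sequences of cutoff functions.\<close>

lemma part_potential:
  assumes f: "f \<in> L1_pos M" "f \<in> L2 M"
  shows "AE x in N. part.potential (\<lambda>y. ennreal (f y)) x = potential (\<lambda>y. ennreal (f y)) x"
proof -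
  let ?u = "\<lambda>y. ennreal (f y)"
  have "AE x in N. part.Q (real (Suc n)) ?u x = Q (real (Suc n)) ?u x" for n
  proof -
    have t: "0 < real (Suc n)" by simp
    have "AE x in N. part.Q (real (Suc n)) ?u x = ennreal (S (real (Suc n)) (onY f) x)"
      using part.Q_eq_S[OF t L1_pos_restrict[OF f(1)] L2_restrict[OF f(2)]] part_S[OF t L2_restrict[OF f(2)]]
      by eventually_elim simp
    with Q_eq_S[OF t f] S_onY[OF t f(2)] show ?thesis
      unfolding AE_N_iff by eventually_elim (auto simp: indicator_def)
  qed
  then have "AE x in N. \<forall>n. part.Q (real (Suc n)) ?u x = Q (real (Suc n)) ?u x"
    unfolding AE_all_countable by blast
  then show ?thesis unfolding part.potential_def potential_def by eventually_elim simp
qed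

lemma part_P_one:
  assumes t: "0 < t"
  shows "AE x in N. part.P t (\<lambda>_. 1) x = P t (\<lambda>_. 1) x"
proof -
  let ?c = "part.cut (\<lambda>_. 1)"
  have ex: "part.exhausts ?c (\<lambda>_. 1)" by (rule part.exhausts_cut) simp
  have c: "?c k \<in> L2 N" for k by (rule part.exhausts_mem[OF ex])
  have "exhausts (\<lambda>k. onY (?c k)) (\<lambda>y. indicator Y y * 1)"
    unfolding exhausts_def
  proof (intro conjI allI)
    show "onY (?c k) \<in> L2 M" for k using c by (simp add: L2_N_iff)
    show "AE x in M. (\<forall>k. 0 \<le> onY (?c k) x) \<and> incseq (\<lambda>k. onY (?c k) x) \<and>
        indicator Y x * 1 = (SUP k. ennreal (onY (?c k) x))"
      using part.exhausts_AE[OF ex] unfolding AE_N_iff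
      by eventually_elim (auto simp: indicator_def incseq_def)
  qed
  then have "AE x in M. P t (\<lambda>y. indicator Y y * 1) x = (SUP k. ennreal (T t (onY (?c k)) x))"
    by (rule P_exhausts[OF t, rotated]) (simp add: borel_measurable_indicator)
  moreover have "AE x in N. \<forall>k. part.T t (?c k) x = T t (onY (?c k)) x"
    unfolding AE_all_countable using part_T[OF t c] by blast
  moreover have "AE x in M. P t (\<lambda>y. indicator Y y * 1) x = indicator Y x * P t (\<lambda>_. 1) x"
    by (rule P_indicator[OF invariant t]) simp
  ultimately show ?thesis
    unfolding AE_N_iff part.P_def by eventually_elim (auto simp: indicator_def)
qed

end

section \<open>The decomposition\<close>

context invariant_part
begin

lemma part_recurrent:
  assumes g: "g \<in> L1_pos M" "g \<in> L2 M" and inf: "\<And>x. x \<in> Y \<Longrightarrow> potential (\<lambda>y. ennreal (g y)) x = \<infinity>"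
  shows "recurrent N DY EY"
  unfolding recurrent_def
proof
  fix f assume f: "f \<in> L1_pos N"
  note gN = L1_pos_restrict[OF g(1)]
  have "AE x in N. part.potential (\<lambda>y. ennreal (g y)) x = \<infinity>"
    using part_potential[OF g] unfolding AE_N_iff by eventually_elim (simp add: inf)
  moreover have "AE x in N. part.potential (\<lambda>y. ennreal (g y)) x = \<infinity> \<longrightarrow> part.potential (\<lambda>y. ennreal (f y)) x \<in> {0, \<infinity>}"
    by (rule part.potential_dichotomy)
      (use part.L1_pos_measurable[OF f] part.L1_pos_measurable[OF gN] part.L1_pos_nn_integral[OF gN] in auto)
  ultimately show "AE x in N. K N DY EY f x \<in> {0, \<infinity>}"
    using part.K_eq_potential[OF f] by eventually_elim simp
qed

lemma part_transient:
  assumes g: "g \<in> L1_pos M" "g \<in> L2 M" "AE x in M. 0 < g x"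
    and fin: "\<And>x. x \<in> Y \<Longrightarrow> potential (\<lambda>y. ennreal (g y)) x < \<infinity>"
  shows "transient N DY EY"
  unfolding transient_def
proof (intro bexI conjI)
  show gN: "g \<in> L1_pos N" by (rule L1_pos_restrict[OF g(1)])
  show "AE x in N. 0 < g x" using g(3) unfolding AE_N_iff by eventually_elim simp
  from part.K_eq_potential[OF gN] part_potential[OF g(1,2)] show "AE x in N. K N DY EY g x < \<infinity>"
    unfolding AE_N_iff by eventually_elim (metis fin)
qed

lemma part_Linf_one:
  assumes t: "0 < t"
  shows "AE x in M. x \<in> Y \<longrightarrow> ennreal (semigroup_Linf N DY EY t (\<lambda>_. 1) x) = P t (\<lambda>_. 1) x"
proof -
  have "AE x in N. semigroup_Linf N DY EY t (\<lambda>_. 1) x = enn2real (P t (\<lambda>_. 1) x)"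
    using part.semigroup_Linf_one[OF t] part_P_one[OF t] by eventually_elim simp
  with P_one_le[OF t] show ?thesis
    unfolding AE_N_iff by eventually_elim (auto simp: le_less_trans[OF _ ennreal_one_less_top])
qed

lemma part_dissipative:
  assumes loss: "\<And>x. x \<in> Y \<Longrightarrow> \<exists>n. P (real (Suc n)) (\<lambda>_. 1) x < 1"
  shows "dissipative N DY EY"
  unfolding dissipative_def
proof -
  have "AE x in M. \<forall>n. x \<in> Y \<longrightarrow> ennreal (semigroup_Linf N DY EY (real (Suc n)) (\<lambda>_. 1) x) = P (real (Suc n)) (\<lambda>_. 1) x"
    unfolding AE_all_countable using part_Linf_one by simp
  then show "AE x in N. \<exists>k\<ge>1. semigroup_Linf N DY EY (real k) (\<lambda>_. 1) x < 1"
    unfolding AE_N_iff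
  proof eventually_elim
    case (elim x)
    show ?case
    proof
      assume x: "x \<in> Y"
      then obtain n where "P (real (Suc n)) (\<lambda>_. 1) x < 1" using loss by blast
      then have "ennreal (semigroup_Linf N DY EY (real (Suc n)) (\<lambda>_. 1) x) < ennreal 1" using elim x by simp
      then have "semigroup_Linf N DY EY (real (Suc n)) (\<lambda>_. 1) x < 1" by (simp add: ennreal_less_iff not_le[symmetric] ennreal_le_iff2)
      then show "\<exists>k\<ge>1. semigroup_Linf N DY EY (real k) (\<lambda>_. 1) x < 1" by (intro exI[of _ "Suc n"]) simp
    qed
  qed
qed

lemma part_conservative:
  assumes no_loss: "\<And>x n. x \<in> Y \<Longrightarrow> 1 \<le> P (real (Suc n)) (\<lambda>_. 1) x"
  shows "conservative N DY EY"
  unfolding conservative_def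
proof (intro allI impI)
  fix t :: real assume t: "0 < t"
  obtain n :: nat where "t \<le> real n" using real_arch_simple by blast
  then have n: "t \<le> real (Suc n)" by simp
  from part_Linf_one[OF t] P_one_mono[OF t n] P_one_le[OF t]
  show "AE x in N. semigroup_Linf N DY EY t (\<lambda>_. 1) x = 1"
    unfolding AE_N_iff
  proof eventually_elim
    case (elim x)
    show ?case
    proof
      assume x: "x \<in> Y"
      have "P t (\<lambda>_. 1) x = 1" using no_loss[OF x, of n] elim(2,3) by simp
      then show "semigroup_Linf N DY EY t (\<lambda>_. 1) x = 1" using elim(1) x by simp
    qed
  qed
qed

text \<open>The mixed terms vanish, since the form does not couple \<open>Y\<close> and its complement. Leaving \<open>w\<close> arbitrary outside
  \<open>space M\<close> admits products of \<open>u\<close> with indicator functions.\<close>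

lemma form_complement:
  assumes u: "u \<in> D" and Z: "\<And>x. x \<in> space M \<Longrightarrow> w x = u x - onY u x" and w: "w \<in> D"
  shows "E u u = E (onY u) (onY u) + E w w"
proof -
  have "AE x in M. w x = (u - onY u) x" using Z by (auto intro: AE_I2)
  then have eq: "E w w = E (u - onY u) (u - onY u)"
    using D_null_cong(2)[OF w, of "u - onY u"] form.ip_sym[of w] norm2_zero_if_AE_eq[of w M "u - onY u"] u w
    by simp
  show ?thesis
    unfolding eq using u form_onY[OF u u] form.ip_sym[of u "onY u"] by (simp add: form.ip_simps)
qed

end

context sigma_finite_dirichlet_form
begin

text \<open>\<open>R\<close> is the set where the potential of a strictly positive function is infinite, and \<open>W\<close> the set where the
  semigroup loses mass. Both are infinity sets of excessive functions. The three parts live on \<open>R\<close>, \<open>W - R\<close> and the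
  remaining set.\<close>

theorem recurrent_dissipative_transient_decomposition:
  "\<exists>Y\<^sub>1 Y\<^sub>2 Y\<^sub>3.
    invariant_set M D E Y\<^sub>1 \<and> invariant_set M D E Y\<^sub>2 \<and> invariant_set M D E Y\<^sub>3 \<and>
    Y\<^sub>1 \<inter> Y\<^sub>2 = {} \<and> Y\<^sub>1 \<inter> Y\<^sub>3 = {} \<and> Y\<^sub>2 \<inter> Y\<^sub>3 = {} \<and> Y\<^sub>1 \<union> Y\<^sub>2 \<union> Y\<^sub>3 = space M \<and>
    recurrent (restrict_space M Y\<^sub>1) (part_dom M D Y\<^sub>1) (part_form E Y\<^sub>1) \<and>
    dissipative (restrict_space M Y\<^sub>2) (part_dom M D Y\<^sub>2) (part_form E Y\<^sub>2) \<and>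
    transient (restrict_space M Y\<^sub>3) (part_dom M D Y\<^sub>3) (part_form E Y\<^sub>3) \<and>
    conservative (restrict_space M Y\<^sub>3) (part_dom M D Y\<^sub>3) (part_form E Y\<^sub>3)"
proof -
  let ?g = "\<phi> 0"
  have g_pos: "AE x in M. 0 < ?g x" using cutoff_AE by eventually_elim simp
  then have g: "?g \<in> L1_pos M" "?g \<in> L2 M"
    using cutoff_integrable by (auto simp: L1_pos_def L1_def elim: eventually_mono)
  have gm: "(\<lambda>y. ennreal (?g y)) \<in> borel_measurable M" using L1_pos_measurable[OF g(1)] by simp
  define R where "R = {x \<in> space M. potential (\<lambda>y. ennreal (?g y)) x = \<infinity>}"
  define W where "W = {x \<in> space M. \<exists>n. P (real (Suc n)) (\<lambda>_. 1) x < 1}"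
  have R: "invariant_set M D E R"
    unfolding R_def by (rule infinity_set_invariant[OF potential_measurable[OF gm] P_potential_le[OF _ gm]])
  have W: "invariant_set M D E W" unfolding W_def by (rule mass_loss_set_invariant)
  define Y2 where "Y2 = W \<inter> (space M - R)"
  define Y3 where "Y3 = (space M - R) \<inter> (space M - W)"
  have Y2: "invariant_set M D E Y2" and Y3: "invariant_set M D E Y3"
    unfolding Y2_def Y3_def by (intro invariant_set_Int invariant_set_Compl R W)+
  interpret p1: invariant_part M D E R by unfold_locales (rule R)
  interpret p2: invariant_part M D E Y2 by unfold_locales (rule Y2)
  interpret p3: invariant_part M D E Y3 by unfold_locales (rule Y3)
  have "recurrent (restrict_space M R) (part_dom M D R) (part_form E R)"
    by (rule p1.part_recurrent[OF g]) (simp add: R_def)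
  moreover have "dissipative (restrict_space M Y2) (part_dom M D Y2) (part_form E Y2)"
    by (rule p2.part_dissipative) (simp add: Y2_def W_def)
  moreover have "transient (restrict_space M Y3) (part_dom M D Y3) (part_form E Y3)"
    by (rule p3.part_transient[OF g g_pos]) (simp add: Y3_def R_def less_top)
  moreover have "conservative (restrict_space M Y3) (part_dom M D Y3) (part_form E Y3)"
    by (rule p3.part_conservative) (auto simp: Y3_def W_def not_less)
  ultimately show ?thesis
    using R Y2 Y3 by (intro exI[of _ R] exI[of _ Y2] exI[of _ Y3]) (auto simp: Y2_def Y3_def R_def W_def)
qed

lemma form_invariant_sum:
  assumes inv: "invariant_set M D E Y\<^sub>1" "invariant_set M D E Y\<^sub>2" "invariant_set M D E Y\<^sub>3"
    and disj: "Y\<^sub>1 \<inter> Y\<^sub>2 = {}" "Y\<^sub>1 \<inter> Y\<^sub>3 = {}" "Y\<^sub>2 \<inter> Y\<^sub>3 = {}" and un: "Y\<^sub>1 \<union> Y\<^sub>2 \<union> Y\<^sub>3 = space M"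
    and u: "u \<in> D"
  shows "E u u =
       part_form E Y\<^sub>1 (\<lambda>x. indicator Y\<^sub>1 x * u x) (\<lambda>x. indicator Y\<^sub>1 x * u x) +
       part_form E Y\<^sub>2 (\<lambda>x. indicator Y\<^sub>2 x * u x) (\<lambda>x. indicator Y\<^sub>2 x * u x) +
       part_form E Y\<^sub>3 (\<lambda>x. indicator Y\<^sub>3 x * u x) (\<lambda>x. indicator Y\<^sub>3 x * u x)"
proof -
  interpret p1: invariant_part M D E Y\<^sub>1 by unfold_locales (rule inv)
  interpret p2: invariant_part M D E Y\<^sub>2 by unfold_locales (rule inv)
  interpret p3: invariant_part M D E Y\<^sub>3 by unfold_locales (rule inv)
  let ?v = "\<lambda>x. indicator Y\<^sub>2 x * u x + indicator Y\<^sub>3 x * u x"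
  have v: "?v \<in> D" using p2.onY_D[OF u] p3.onY_D[OF u] dom_add by blast
  have "E u u = E (p1.onY u) (p1.onY u) + E ?v ?v"
    by (rule p1.form_complement[OF u _ v]) (use disj un in \<open>auto simp: indicator_def\<close>)
  moreover have "E ?v ?v = E (p2.onY ?v) (p2.onY ?v) + E (p3.onY u) (p3.onY u)"
    by (rule p2.form_complement[OF v _ p3.onY_D[OF u]]) (use disj in \<open>auto simp: indicator_def\<close>)
  moreover have "p2.onY ?v = p2.onY u" using disj by (auto simp: fun_eq_iff indicator_def)
  ultimately show ?thesis by (simp add: part_form_def p1.onY_idem p2.onY_idem p3.onY_idem)
qed

end

theorem theorem4p12:
  fixes M :: "'a::t2_space measure"
    and D :: "('a \<Rightarrow> real) set"
    and E :: "('a \<Rightarrow> real) \<Rightarrow> ('a \<Rightarrow> real) \<Rightarrow> real"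
  assumes "radon_measure M" and "sigma_finite_measure M" and "full_support M"
    and "dirichlet_form M D E"
  shows "\<exists>Y\<^sub>1 Y\<^sub>2 Y\<^sub>3.
    invariant_set M D E Y\<^sub>1 \<and> invariant_set M D E Y\<^sub>2 \<and> invariant_set M D E Y\<^sub>3 \<and>
    Y\<^sub>1 \<inter> Y\<^sub>2 \<in> null_sets M \<and> Y\<^sub>1 \<inter> Y\<^sub>3 \<in> null_sets M \<and> Y\<^sub>2 \<inter> Y\<^sub>3 \<in> null_sets M \<and>
    space M - (Y\<^sub>1 \<union> Y\<^sub>2 \<union> Y\<^sub>3) \<in> null_sets M \<and>
    dirichlet_form (restrict_space M Y\<^sub>1) (part_dom M D Y\<^sub>1) (part_form E Y\<^sub>1) \<and>
    dirichlet_form (restrict_space M Y\<^sub>2) (part_dom M D Y\<^sub>2) (part_form E Y\<^sub>2) \<and>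
    dirichlet_form (restrict_space M Y\<^sub>3) (part_dom M D Y\<^sub>3) (part_form E Y\<^sub>3) \<and>
    recurrent (restrict_space M Y\<^sub>1) (part_dom M D Y\<^sub>1) (part_form E Y\<^sub>1) \<and>
    dissipative (restrict_space M Y\<^sub>2) (part_dom M D Y\<^sub>2) (part_form E Y\<^sub>2) \<and>
    transient (restrict_space M Y\<^sub>3) (part_dom M D Y\<^sub>3) (part_form E Y\<^sub>3) \<and>
    conservative (restrict_space M Y\<^sub>3) (part_dom M D Y\<^sub>3) (part_form E Y\<^sub>3) \<and>
    (\<forall>u\<in>D. E u u =
       part_form E Y\<^sub>1 (\<lambda>x. indicator Y\<^sub>1 x * u x) (\<lambda>x. indicator Y\<^sub>1 x * u x) +
       part_form E Y\<^sub>2 (\<lambda>x. indicator Y\<^sub>2 x * u x) (\<lambda>x. indicator Y\<^sub>2 x * u x) +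
       part_form E Y\<^sub>3 (\<lambda>x. indicator Y\<^sub>3 x * u x) (\<lambda>x. indicator Y\<^sub>3 x * u x))"
proof -
  interpret sigma_finite_dirichlet_form M D E
    using assms by (simp add: sigma_finite_dirichlet_form_def)
  obtain Y1 Y2 Y3 where inv: "invariant_set M D E Y1" "invariant_set M D E Y2" "invariant_set M D E Y3"
    and disj: "Y1 \<inter> Y2 = {}" "Y1 \<inter> Y3 = {}" "Y2 \<inter> Y3 = {}" and un: "Y1 \<union> Y2 \<union> Y3 = space M"
    and parts: "recurrent (restrict_space M Y1) (part_dom M D Y1) (part_form E Y1)"
      "dissipative (restrict_space M Y2) (part_dom M D Y2) (part_form E Y2)"
      "transient (restrict_space M Y3) (part_dom M D Y3) (part_form E Y3)"
      "conservative (restrict_space M Y3) (part_dom M D Y3) (part_form E Y3)"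
    using recurrent_dissipative_transient_decomposition by blast
  have dir: "dirichlet_form (restrict_space M Y) (part_dom M D Y) (part_form E Y)" if Y: "invariant_set M D E Y" for Y
  proof -
    interpret invariant_part M D E Y by unfold_locales (rule Y)
    show ?thesis by (rule dirichlet_form_part)
  qed
  show ?thesis
    using inv disj un parts dir form_invariant_sum[OF inv disj un]
    by (intro exI[of _ Y1] exI[of _ Y2] exI[of _ Y3]) simp
qed

end
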